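(* Let $\lambda>0$, $\lambda\neq1$, and let $k\geq1$ be an integer. The holonomy map $$hol:\ \mathfrak{D}(T^2,\mathrm{P}(\mathbb{A}^2-0))\longrightarrow \mathrm{Hom}(\mathbb{Z}^2,\mathrm{PGL}(2,\mathbb{R}))/\mathrm{PGL}(2,\mathbb{R})$$ is a twofold branched covering near the image of (the class of) a homogeneous flat affine torus $\mathcal{H}_{\lambda,\frac{\pi}{2},k}$ under the natural induced map $\mathfrak{D}(T^2,\mathbb{A}^2-0)\to\mathfrak{D}(T^2,\mathrm{P}(\mathbb{A}^2-0))$.
   Context: $\mathbb{A}^2-0=\mathbb{R}^2\setminus\{0\}$ with its $\mathrm{GL}(2,\mathbb{R})$-action; $\mathrm{P}(\mathbb{A}^2-0)=(\mathbb{A}^2-0)/\{\pm1\}$ with the induced action of $\mathrm{PGL}(2,\mathbb{R})=\mathrm{GL}(2,\mathbb{R})/\{\pm1\}$. For a homogeneous space $(X,G)$, a development map for an $(X,G)$-structure on $T^2=\mathbb{R}^2/\mathbb{Z}^2$ is a $C^\infty$ local diffeomorphism $D:\mathbb{R}^2\to X$ with $D(x+\gamma)=h(\gamma)D(x)$ for some homomorphism $h:\mathbb{Z}^2\to G$ (the holonomy); the set $\mathrm{Dev}(T^2,X,G)$ carries the compact $C^\infty$-topology. $\mathfrak{D}(T^2,X)=G\backslash\mathrm{Dev}(T^2,X,G)/\mathrm{Diff}_1(T^2)$, with the quotient topology, where $\mathrm{Diff}_1(T^2)$ is the group of diffeomorphisms homotopic to the identity, acting by precomposition with lifts; here $G=\mathrm{GL}(2,\mathbb{R})$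 for $X=\mathbb{A}^2-0$ and $G=\mathrm{PGL}(2,\mathbb{R})$ for $X=\mathrm{P}(\mathbb{A}^2-0)$. $hol$ sends the class of $D$ to the conjugacy class of $h$; $\mathrm{Hom}(\mathbb{Z}^2,G)/G$ has the quotient topology from pointwise convergence. The natural induced map of deformation spaces is given by composing development maps with the projection $\mathbb{A}^2-0\to\mathrm{P}(\mathbb{A}^2-0)$. The torus $\mathcal{H}_{\lambda,\alpha,k}$: let $X_k\to\mathbb{A}^2-0$ be the $k$-fold (connected) covering flat affine manifold, with polar coordinates $(r,\theta)$, $r>0$, $\theta\in\mathbb{R}/2\pi k\mathbb{Z}$. Let $\mathcal{H}_{\lambda,k}$ be the quotient of $X_k$ by the group generated by the affine transformation $(r,\theta)\mapsto(\lambda r,\theta)$. For $\alpha$ a rational multiple of $\pi$, $\mathcal{H}_{\lambda,\alpha,k}$ is the quotient of $\mathcal{H}_{\lambda,k}$ by the finite group generated by the rotation $(r,\theta)\mapsto(r,\theta+\alpha)$. It is a homogeneous flat affine two-torus modeled on $(\mathbb{A}^2-0,\mathrm{GL}(2,\mathbb{R}))$; via a marking (a diffeomorphism from $T^2$) it defines a point of $\mathfrak{D}(T^2,\mathbb{A}^2-0)$. *)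

theory Defs
  imports "HOL-Analysis.Analysis" "HOL-Algebra.Coset"
begin

section \<open>Quotient topologies\<close>

definition quot_topology :: "'a topology \<Rightarrow> ('a \<Rightarrow> 'b) \<Rightarrow> 'b topology" where
  "quot_topology X q =
     topology (\<lambda>U. U \<subseteq> q ` topspace X \<and> openin X {x \<in> topspace X. q x \<in> U})"

lemma openin_quot_topology:
  "openin (quot_topology X q) U \<longleftrightarrow>
     U \<subseteq> q ` topspace X \<and> openin X {x \<in> topspace X. q x \<in> U}"
proof -
  have "istopology (\<lambda>U. U \<subseteq> q ` topspace X \<and> openin X {x \<in> topspace X. q x \<in> U})"
    unfolding istopology_def
  proof (intro conjI allI impI; (elim conjE)?)
    fix S T assume "openin X {x \<in> topspace X. q x \<in> S}" "openin X {x \<in> topspace X. q x \<in> T}"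
    then have "openin X ({x \<in> topspace X. q x \<in> S} \<inter> {x \<in> topspace X. q x \<in> T})" by blast
    moreover have "{x \<in> topspace X. q x \<in> S} \<inter> {x \<in> topspace X. q x \<in> T} =
        {x \<in> topspace X. q x \<in> S \<inter> T}" by blast
    ultimately show "openin X {x \<in> topspace X. q x \<in> S \<inter> T}" by simp
  next
    fix K assume "\<forall>S\<in>K. S \<subseteq> q ` topspace X \<and> openin X {x \<in> topspace X. q x \<in> S}"
    then have "openin X (\<Union>S\<in>K. {x \<in> topspace X. q x \<in> S})" by blast
    moreover have "(\<Union>S\<in>K. {x \<in> topspace X. q x \<in> S}) = {x \<in> topspace X. q x \<in> \<Union>K}" by blast
    ultimately show "openin X {x \<in> topspace X. q x \<in> \<Union>K}" by simp
  qed blast+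
  then show ?thesis
    unfolding quot_topology_def by (subst topology_inverse') (assumption, rule refl)
qed

lemma topspace_quot_topology: "topspace (quot_topology X q) = q ` topspace X"
proof
  show "topspace (quot_topology X q) \<subseteq> q ` topspace X"
    using openin_topspace[of "quot_topology X q"] unfolding openin_quot_topology by (rule conjunct1)
  have "{x \<in> topspace X. q x \<in> q ` topspace X} = topspace X" by blast
  then have "openin (quot_topology X q) (q ` topspace X)"
    unfolding openin_quot_topology by (metis openin_topspace order_refl)
  then show "q ` topspace X \<subseteq> topspace (quot_topology X q)"
    by (rule openin_subset)
qed

lemma quotient_map_quot_topology: "quotient_map X (quot_topology X q) q"
  by (auto simp: quotient_map_def topspace_quot_topology openin_quot_topology)


section \<open>Smooth maps between open subsets of the plane\<close>

text \<open>
  The list \<open>js\<close> is a sequence of coordinate directions; \<open>iter_pderiv js f\<close> is the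
  corresponding iterated partial derivative, which is meaningful at points near which
  all derivatives of lower order are differentiable.
\<close>

primrec iter_pderiv :: "2 list \<Rightarrow> (real^2 \<Rightarrow> real^2) \<Rightarrow> real^2 \<Rightarrow> real^2" where
  "iter_pderiv [] f = f"
| "iter_pderiv (j # js) f = (\<lambda>x. frechet_derivative (iter_pderiv js f) (at x) (axis j 1))"

text \<open>
  Total differentiability of all iterated partial derivatives forces their continuity,
  so this is the class \<open>C\<^sup>\<infinity>\<close> on the open set \<open>S\<close>.
\<close>

definition smooth_on :: "(real^2) set \<Rightarrow> (real^2 \<Rightarrow> real^2) \<Rightarrow> bool" where
  "smooth_on S f \<longleftrightarrow> open S \<and> (\<forall>js. \<forall>x\<in>S. iter_pderiv js f differentiable (at x))"

definition diffeomorphism_between ::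
  "(real^2) set \<Rightarrow> (real^2) set \<Rightarrow> (real^2 \<Rightarrow> real^2) \<Rightarrow> bool" where
  "diffeomorphism_between S T f \<longleftrightarrow>
     bij_betw f S T \<and> smooth_on S f \<and> smooth_on T (the_inv_into S f)"


section \<open>The torus \<open>\<real>\<^sup>2/\<int>\<^sup>2\<close>\<close>

definition int_lattice :: "(int^2) monoid" where
  "int_lattice = \<lparr>carrier = UNIV, mult = (+), one = 0\<rparr>"

definition lattice_vec :: "int^2 \<Rightarrow> real^2" where
  "lattice_vec \<gamma> = (\<chi> i. of_int (\<gamma> $ i))"

definition torus_proj :: "real^2 \<Rightarrow> (real^2) set" where
  "torus_proj x = range (\<lambda>\<gamma>. x + lattice_vec \<gamma>)"

definition torus :: "(real^2) set topology" where
  "torus = quot_topology euclidean torus_proj"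

text \<open>
  The lifts to \<open>\<real>\<^sup>2\<close> of the diffeomorphisms of the torus which are homotopic to the
  identity. A homeomorphism of the torus is a diffeomorphism iff its lifts are.
\<close>

definition Diff1_lifts :: "(real^2 \<Rightarrow> real^2) set" where
  "Diff1_lifts = {\<phi>. diffeomorphism_between UNIV UNIV \<phi> \<and>
     (\<exists>\<psi>. homeomorphic_map torus torus \<psi> \<and> (\<forall>x. \<psi> (torus_proj x) = torus_proj (\<phi> x)) \<and>
          homotopic_with (\<lambda>_. True) torus torus \<psi> id)}"


section \<open>Two-dimensional homogeneous geometries and development maps\<close>

text \<open>
  The atlas consists of pairs of a chart domain and a chart with values in \<open>\<real>\<^sup>2\<close>; the
  values of a chart outside its domain are irrelevant.
\<close>

record ('x, 'g) geometry =
  atlas :: "('x set \<times> ('x \<Rightarrow> real^2)) set"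
  grp :: "'g monoid"
  grp_top :: "'g topology"
  action :: "'g \<Rightarrow> 'x \<Rightarrow> 'x"

definition Cinf_maps :: "('x, 'g) geometry \<Rightarrow> (real^2 \<Rightarrow> 'x) set" where
  "Cinf_maps M = {D. \<forall>x. \<exists>(V, c) \<in> atlas M. \<exists>U. x \<in> U \<and> D ` U \<subseteq> V \<and> smooth_on U (c \<circ> D)}"

definition local_diffeo :: "('x, 'g) geometry \<Rightarrow> (real^2 \<Rightarrow> 'x) \<Rightarrow> bool" where
  "local_diffeo M D \<longleftrightarrow> (\<forall>x. \<exists>(V, c) \<in> atlas M. \<exists>U W. x \<in> U \<and> D ` U \<subseteq> V \<and>
     diffeomorphism_between U W (c \<circ> D))"

text \<open>
  The subbasic neighbourhoods of the compact (weak) \<open>C\<^sup>\<infinity>\<close>-topology: the chart \<open>(V, c)\<close> is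
  used on the compact set \<open>K\<close>, and all derivatives of order at most \<open>r\<close> are \<open>\<epsilon>\<close>-close.
\<close>

definition Cinf_nbhd ::
  "('x, 'g) geometry \<Rightarrow> (real^2 \<Rightarrow> 'x) \<Rightarrow> (real^2) set \<Rightarrow> 'x set \<Rightarrow> ('x \<Rightarrow> real^2) \<Rightarrow> nat \<Rightarrow> real
    \<Rightarrow> (real^2 \<Rightarrow> 'x) set" where
  "Cinf_nbhd M f K V c r \<epsilon> = {g \<in> Cinf_maps M. g ` K \<subseteq> V \<and>
     (\<forall>x\<in>K. \<forall>js. length js \<le> r \<longrightarrow>
        norm (iter_pderiv js (c \<circ> g) x - iter_pderiv js (c \<circ> f) x) < \<epsilon>)}"

definition compact_Cinf_topology :: "('x, 'g) geometry \<Rightarrow> (real^2 \<Rightarrow> 'x) topology" where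
  "compact_Cinf_topology M = topology_generated_by
     {Cinf_nbhd M f K V c r \<epsilon> | f K V c r \<epsilon>.
        f \<in> Cinf_maps M \<and> compact K \<and> (V, c) \<in> atlas M \<and> f ` K \<subseteq> V \<and> \<epsilon> > 0}"

definition is_holonomy ::
  "('x, 'g) geometry \<Rightarrow> (real^2 \<Rightarrow> 'x) \<Rightarrow> (int^2 \<Rightarrow> 'g) \<Rightarrow> bool" where
  "is_holonomy M D h \<longleftrightarrow> h \<in> hom int_lattice (grp M) \<and>
     (\<forall>\<gamma> x. D (x + lattice_vec \<gamma>) = action M (h \<gamma>) (D x))"

definition Dev :: "('x, 'g) geometry \<Rightarrow> (real^2 \<Rightarrow> 'x) set" where
  "Dev M = {D. local_diffeo M D \<and> (\<exists>h. is_holonomy M D h)}"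

definition Dev_topology :: "('x, 'g) geometry \<Rightarrow> (real^2 \<Rightarrow> 'x) topology" where
  "Dev_topology M = subtopology (compact_Cinf_topology M) (Dev M)"

definition dev_class :: "('x, 'g) geometry \<Rightarrow> (real^2 \<Rightarrow> 'x) \<Rightarrow> (real^2 \<Rightarrow> 'x) set" where
  "dev_class M D = {\<lambda>x. action M g (D (\<phi> x)) | g \<phi>. g \<in> carrier (grp M) \<and> \<phi> \<in> Diff1_lifts}"

definition deformation_space :: "('x, 'g) geometry \<Rightarrow> (real^2 \<Rightarrow> 'x) set topology" where
  "deformation_space M = quot_topology (Dev_topology M) (dev_class M)"


section \<open>The space of conjugacy classes of homomorphisms and the holonomy map\<close>

definition conj_class ::
  "('x, 'g) geometry \<Rightarrow> (int^2 \<Rightarrow> 'g) \<Rightarrow> (int^2 \<Rightarrow> 'g) set" where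
  "conj_class M h =
     {\<lambda>\<gamma>. g \<otimes>\<^bsub>grp M\<^esub> h \<gamma> \<otimes>\<^bsub>grp M\<^esub> inv\<^bsub>grp M\<^esub> g | g. g \<in> carrier (grp M)}"

definition Hom_topology :: "('x, 'g) geometry \<Rightarrow> (int^2 \<Rightarrow> 'g) topology" where
  "Hom_topology M =
     subtopology (product_topology (\<lambda>_. grp_top M) UNIV) (hom int_lattice (grp M))"

definition character_space :: "('x, 'g) geometry \<Rightarrow> (int^2 \<Rightarrow> 'g) set topology" where
  "character_space M = quot_topology (Hom_topology M) (conj_class M)"

text \<open>
  For the effective actions considered below, the holonomy of a development map is
  unique, and its conjugacy class is the same for all members of a class of
  development maps; so the union in \<open>hol\<close> is over one and the same set.
\<close>

definition holonomy :: "('x, 'g) geometry \<Rightarrow> (real^2 \<Rightarrow> 'x) \<Rightarrow> int^2 \<Rightarrow> 'g" where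
  "holonomy M D = (THE h. is_holonomy M D h)"

definition hol :: "('x, 'g) geometry \<Rightarrow> (real^2 \<Rightarrow> 'x) set \<Rightarrow> (int^2 \<Rightarrow> 'g) set" where
  "hol M C = (\<Union>D\<in>C. conj_class M (holonomy M D))"


section \<open>The punctured plane and its quotient by the antipodal map\<close>

definition GL2 :: "(real^2^2) monoid" where
  "GL2 = \<lparr>carrier = {A. invertible A}, mult = (**), one = mat 1\<rparr>"

definition GL2_topology :: "(real^2^2) topology" where
  "GL2_topology = top_of_set (carrier GL2)"

definition PGL2 :: "(real^2^2) set monoid" where
  "PGL2 = GL2 Mod {mat 1, - mat 1}"

definition PGL2_topology :: "(real^2^2) set topology" where
  "PGL2_topology = quot_topology GL2_topology (\<lambda>A. {mat 1, - mat 1} #>\<^bsub>GL2\<^esub> A)"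

definition antipodal_proj :: "real^2 \<Rightarrow> (real^2) set" where
  "antipodal_proj v = {v, - v}"

definition punctured_plane :: "(real^2, real^2^2) geometry" where
  "punctured_plane =
     \<lparr>atlas = {(- {0}, id)}, grp = GL2, grp_top = GL2_topology, action = (*v)\<rparr>"

text \<open>The charts are the local inverses of the double covering \<open>antipodal_proj\<close>.\<close>

definition proj_punctured_plane :: "((real^2) set, (real^2^2) set) geometry" where
  "proj_punctured_plane =
     \<lparr>atlas = {(antipodal_proj ` V, the_inv_into V antipodal_proj) | V.
                 open V \<and> 0 \<notin> V \<and> inj_on antipodal_proj V},
      grp = PGL2, grp_top = PGL2_topology,
      action = (\<lambda>C p. {A *v v | A v. A \<in> C \<and> v \<in> p})\<rparr>"

definition induced_map :: "(real^2 \<Rightarrow> real^2) set \<Rightarrow> (real^2 \<Rightarrow> (real^2) set) set" where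
  "induced_map C = (\<Union>D\<in>C. dev_class proj_punctured_plane (antipodal_proj \<circ> D))"


section \<open>The tori \<open>H\<close> with parameters \<open>lam\<close>, \<open>\<alpha>\<close>, \<open>k\<close>\<close>

text \<open>
  The half plane \<open>{p. p $ 1 > 0}\<close> with coordinates \<open>(r, \<theta>)\<close> is the universal covering of
  the \<open>k\<close>-fold covering \<open>X\<^sub>k\<close> of the punctured plane. There the torus is the quotient by the
  group generated by \<open>(r, \<theta>) \<mapsto> (lam r, \<theta>)\<close>, \<open>(r, \<theta>) \<mapsto> (r, \<theta> + \<alpha>)\<close> and the deck
  transformation \<open>(r, \<theta>) \<mapsto> (r, \<theta> + 2 \<pi> k)\<close> of \<open>X\<^sub>k\<close>, whose orbit relation is \<open>H_rel\<close>.
\<close>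

definition polar_half_plane :: "(real^2) set" where
  "polar_half_plane = {p. p $ 1 > 0}"

definition polar_map :: "real^2 \<Rightarrow> real^2" where
  "polar_map p = vector [p $ 1 * cos (p $ 2), p $ 1 * sin (p $ 2)]"

definition H_rel :: "real \<Rightarrow> real \<Rightarrow> nat \<Rightarrow> real^2 \<Rightarrow> real^2 \<Rightarrow> bool" where
  "H_rel lam \<alpha> k p q \<longleftrightarrow> (\<exists>l m n :: int.
     q $ 1 = lam powi l * p $ 1 \<and> q $ 2 = p $ 2 + of_int m * \<alpha> + of_int n * (2 * pi * real k))"

text \<open>
  A marking, that is, a diffeomorphism from \<open>\<real>\<^sup>2/\<int>\<^sup>2\<close> onto the torus, is given by its lift
  to the universal coverings.
\<close>

definition H_marking :: "real \<Rightarrow> real \<Rightarrow> nat \<Rightarrow> (real^2 \<Rightarrow> real^2) \<Rightarrow> bool" where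
  "H_marking lam \<alpha> k F \<longleftrightarrow> diffeomorphism_between UNIV polar_half_plane F \<and>
     (\<forall>x y. torus_proj x = torus_proj y \<longleftrightarrow> H_rel lam \<alpha> k (F x) (F y))"

definition H_class :: "(real^2 \<Rightarrow> real^2) \<Rightarrow> (real^2 \<Rightarrow> real^2) set" where
  "H_class F = dev_class punctured_plane (polar_map \<circ> F)"


section \<open>Twofold branched coverings\<close>

definition covering_of_degree :: "nat \<Rightarrow> 'a topology \<Rightarrow> 'b topology \<Rightarrow> ('a \<Rightarrow> 'b) \<Rightarrow> bool" where
  "covering_of_degree d X Y f \<longleftrightarrow> continuous_map X Y f \<and>
     (\<forall>y \<in> topspace Y. \<exists>V. openin Y V \<and> y \<in> V \<and>
        (\<exists>\<S>. finite \<S> \<and> card \<S> = d \<and> disjoint \<S> \<and> \<Union>\<S> = {x \<in> topspace X. f x \<in> V} \<and>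
             (\<forall>S\<in>\<S>. openin X S \<and>
                homeomorphic_map (subtopology X S) (subtopology Y V) f)))"

text \<open>
  Closed, nowhere dense, and not separating the space locally, as for a subset of
  codimension two. The last condition is Fox's; it excludes foldings such as
  \<open>x \<mapsto> x\<^sup>2\<close> from the real line to the half line.
\<close>

definition branch_locus_in :: "'a topology \<Rightarrow> 'a set \<Rightarrow> bool" where
  "branch_locus_in X B \<longleftrightarrow> closedin X B \<and> X interior_of B = {} \<and>
     (\<forall>x U. openin X U \<and> x \<in> U \<longrightarrow>
        (\<exists>W. openin X W \<and> x \<in> W \<and> W \<subseteq> U \<and> connectedin X (W - B)))"

definition twofold_branched_covering ::
  "'a topology \<Rightarrow> 'b topology \<Rightarrow> ('a \<Rightarrow> 'b) \<Rightarrow> 'b set \<Rightarrow> bool" where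
  "twofold_branched_covering X Y f B \<longleftrightarrow>
     continuous_map X Y f \<and> open_map X Y f \<and> closed_map X Y f \<and>
     branch_locus_in Y B \<and> branch_locus_in X {x \<in> topspace X. f x \<in> B} \<and>
     (\<forall>y\<in>B. \<exists>!x. x \<in> topspace X \<and> f x = y) \<and>
     covering_of_degree 2 (subtopology X {x \<in> topspace X. f x \<notin> B})
       (subtopology Y (topspace Y - B)) f"

text \<open>The point \<open>x\<close> itself is required to be a branch point.\<close>

definition twofold_branched_covering_near ::
  "'a topology \<Rightarrow> 'b topology \<Rightarrow> ('a \<Rightarrow> 'b) \<Rightarrow> 'a \<Rightarrow> bool" where
  "twofold_branched_covering_near X Y f x \<longleftrightarrow>
     (\<exists>U V B. openin X U \<and> x \<in> U \<and> openin Y V \<and> f x \<in> B \<and>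
        twofold_branched_covering (subtopology X U) (subtopology Y V) f B)"

end

theory Submission
  imports Defs "HOL-Complex_Analysis.Cauchy_Integral_Formula"
begin

text \<open>
  The proof describes both spaces near the given point by the same coordinate, an invertible real
  matrix \<open>C\<close>, regarded as an \<open>\<real>\<close>-linear isomorphism from \<open>\<real>\<^sup>2\<close> to \<open>\<complex>\<close>. It yields the development map
  \<open>lin_dev C\<close>, the class of \<open>x \<mapsto> exp (C x)\<close> modulo signs, and its holonomy \<open>lin_hol C\<close>, which sends \<open>\<gamma>\<close> to
  the class of multiplication by \<open>exp (C \<gamma>)\<close>.

  A smooth map from the plane to the quotient of the punctured plane has a logarithm: it is
  \<open>exp \<circ> E\<close> modulo signs for a continuous complex function \<open>E\<close>. If the holonomy is conjugate to
  multiplication by complex numbers, then, after a linear change of coordinates, \<open>E\<close> is equivariant under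
  translations and thus develops a translation structure on the torus. When the translations
  span the plane, \<open>E\<close> is a proper local diffeomorphism, hence a diffeomorphism, and it is the
  composition of a linear map with the lift of a diffeomorphism homotopic to the identity
  (\<open>equivariant_logarithm_linear\<close>). Commuting matrices which are close to a pair of complex numbers, not both
  real, are simultaneously conjugate to such a pair by a matrix close to the given conjugation
  (\<open>commuting_near_complex\<close>). So every development map near \<open>lin_dev C\<close> is equivalent to \<open>lin_dev C'\<close> with
  \<open>C'\<close> near \<open>C\<close> (\<open>lin_dev_classes_open\<close>), and every homomorphism near \<open>lin_hol C\<close> is conjugate to some
  \<open>lin_hol C'\<close> (\<open>conj_classes_open\<close>).

  If the numbers \<open>exp (C e\<^sub>i)\<close> are not all real, the matrix is determined by the class of \<open>lin_dev C\<close> up to complex conjugation, which changes the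
  sign of the determinant (\<open>lin_dev_class_eqD\<close>). Hence \<open>C\<close> is a local coordinate of the deformation space. For the
  torus of the theorem, the imaginary parts of \<open>C e\<^sub>i\<close> are \<open>m\<^sub>i \<pi> / 2\<close> with integers \<open>m\<^sub>i\<close>, one of which is odd
  (\<open>marking_linear\<close>). Conjugation by a reflection replaces \<open>exp (C e\<^sub>i)\<close> by its complex conjugate, and signs
  do not matter in \<open>PGL(2,\<real>)\<close>. Near this torus exactly the matrices \<open>C\<close> and \<open>flip m C\<close> have conjugate
  holonomy, where \<open>flip m\<close> conjugates the values \<open>C e\<^sub>i\<close> and adds \<open>m\<^sub>i \<pi> \<i>\<close>. So the holonomy map is, locally,
  the quotient by the involution \<open>flip m\<close>. Its fixed points are the matrices whose second row
  has the entries \<open>m\<^sub>i \<pi> / 2\<close>, a plane of codimension two through the given torus, and the quotient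
  by such an involution is a twofold branched covering (\<open>twofold_branched_covering_if_involution\<close>).
\<close>

section \<open>Smooth maps of the plane\<close>

lemma frechet_derivative_cong_open:
  assumes "open S" "x \<in> S" "\<And>y. y \<in> S \<Longrightarrow> f y = g y"
  shows "frechet_derivative f (at x) = frechet_derivative g (at x)"
proof -
  have "(f has_derivative D) (at x) \<longleftrightarrow> (g has_derivative D) (at x)" for D
    using has_derivative_transform_within_open[OF _ assms(1,2)] assms(3) by metis
  then show ?thesis by (simp add: frechet_derivative_def)
qed

lemma differentiable_cong_open:
  assumes "open S" "x \<in> S" "\<And>y. y \<in> S \<Longrightarrow> f y = g y" "f differentiable (at x)"
  shows "g differentiable (at x)"
  using assms has_derivative_transform_within_open unfolding differentiable_def by metis

lemma has_derivative_imp_frechet_derivative_eq: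
  assumes "(f has_derivative D) (at x)" "D v = c"
  shows "f differentiable (at x) \<and> frechet_derivative f (at x) v = c"
  using assms(2) differentiableI[OF assms(1)] by (simp flip: frechet_derivative_at[OF assms(1)])

lemma iter_pderiv_cong_open:
  assumes "open S" "\<And>y. y \<in> S \<Longrightarrow> f y = g y" "x \<in> S"
  shows "iter_pderiv js f x = iter_pderiv js g x"
  using assms(3)
proof (induction js arbitrary: x)
  case (Cons j js)
  then show ?case
    using frechet_derivative_cong_open[OF assms(1) Cons.prems Cons.IH] by simp
qed (simp add: assms)

lemma smooth_on_cong:
  assumes f: "smooth_on S f" and eq: "\<And>y. y \<in> S \<Longrightarrow> f y = g y"
  shows "smooth_on S g"
  unfolding smooth_on_def
proof (intro conjI allI ballI)
  show S: "open S" using f by (simp add: smooth_on_def)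
  fix js x assume x: "x \<in> S"
  have "iter_pderiv js f differentiable (at x)" using f x by (simp add: smooth_on_def)
  then show "iter_pderiv js g differentiable (at x)"
    by (rule differentiable_cong_open[OF S x iter_pderiv_cong_open[OF S eq], rotated 2])
qed

lemma smooth_on_subset: "smooth_on S f \<Longrightarrow> open T \<Longrightarrow> T \<subseteq> S \<Longrightarrow> smooth_on T f"
  unfolding smooth_on_def by blast

lemma smooth_on_UNIV: "(\<And>x. \<exists>S. x \<in> S \<and> smooth_on S f) \<Longrightarrow> smooth_on UNIV f"
  unfolding smooth_on_def by blast

lemma smooth_on_iter_pderiv_continuous:
  "smooth_on S f \<Longrightarrow> continuous_on S (iter_pderiv js f)"
  unfolding smooth_on_def
  by (meson continuous_at_imp_continuous_on differentiable_imp_continuous_within)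

lemma smooth_on_imp_continuous_on: "smooth_on S f \<Longrightarrow> continuous_on S f"
  using smooth_on_iter_pderiv_continuous[of S f "[]"] by simp

text \<open>
  A coinduction principle: a family of differentiable functions which is closed under partial
  derivatives consists of smooth functions, and no higher derivative has to be computed.
\<close>

lemma smooth_onI_family:
  assumes S: "open S" and f: "f \<in> \<F>"
    and diff: "\<And>g x. g \<in> \<F> \<Longrightarrow> x \<in> S \<Longrightarrow> g differentiable (at x)"
    and closed: "\<And>g j. g \<in> \<F> \<Longrightarrow>
      \<exists>g'\<in>\<F>. \<forall>x\<in>S. frechet_derivative g (at x) (axis j 1) = g' x"
  shows "smooth_on S f"
proof -
  have *: "\<exists>g\<in>\<F>. \<forall>x\<in>S. iter_pderiv js f x = g x" for js
  proof (induction js)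
    case (Cons j js)
    then obtain g where g: "g \<in> \<F>" "\<And>x. x \<in> S \<Longrightarrow> iter_pderiv js f x = g x" by blast
    then show ?case
      using closed[OF g(1), of j] frechet_derivative_cong_open[OF S _ g(2)] by auto
  qed (use f in auto)
  show ?thesis
    unfolding smooth_on_def
  proof (intro conjI allI ballI S)
    fix js x assume x: "x \<in> S"
    obtain g where g: "g \<in> \<F>" "\<And>x. x \<in> S \<Longrightarrow> g x = iter_pderiv js f x"
      using *[of js] by auto
    show "iter_pderiv js f differentiable (at x)"
      by (rule differentiable_cong_open[OF S x g(2) diff[OF g(1) x]])
  qed
qed

text \<open>
  A substitute for a chain rule of higher order. The components of the derivatives of \<open>f \<circ> g\<close> are
  polynomials in these generators, and it is enough that the algebra is closed under
  differentiation.
\<close>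

inductive_set chain_rule_algebra :: "(real^2 \<Rightarrow> real^2) \<Rightarrow> (real^2 \<Rightarrow> real^2) \<Rightarrow> (real^2 \<Rightarrow> real) set"
  for f g where
  outer: "(\<lambda>x. iter_pderiv js f (g x) $ i) \<in> chain_rule_algebra f g"
| inner: "(\<lambda>x. iter_pderiv js g x $ i) \<in> chain_rule_algebra f g"
| plus: "a \<in> chain_rule_algebra f g \<Longrightarrow> b \<in> chain_rule_algebra f g \<Longrightarrow>
    (\<lambda>x. a x + b x) \<in> chain_rule_algebra f g"
| times: "a \<in> chain_rule_algebra f g \<Longrightarrow> b \<in> chain_rule_algebra f g \<Longrightarrow>
    (\<lambda>x. a x * b x) \<in> chain_rule_algebra f g"

lemma linear_axis_expansion:
  fixes L :: "real^2 \<Rightarrow> real^2"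
  assumes "linear L"
  shows "L v = v $ 1 *\<^sub>R L (axis 1 1) + v $ 2 *\<^sub>R L (axis 2 1)"
proof -
  have "v = v $ 1 *\<^sub>R axis 1 1 + v $ 2 *\<^sub>R axis 2 1"
    by (simp add: vec_eq_iff forall_2 axis_def)
  then have "L v = L (v $ 1 *\<^sub>R axis 1 1 + v $ 2 *\<^sub>R axis 2 1)" by (rule arg_cong)
  then show ?thesis using assms by (simp add: linear_add linear_scale)
qed

lemma chain_rule_algebra_closed:
  assumes f: "smooth_on T f" and g: "smooth_on S g" and gS: "g ` S \<subseteq> T"
    and a: "a \<in> chain_rule_algebra f g"
  shows "\<exists>a'\<in>chain_rule_algebra f g. \<forall>x\<in>S. a differentiable (at x) \<and>
           frechet_derivative a (at x) (axis j 1) = a' x"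
  using a
proof induction
  case (outer js i)
  let ?P = "iter_pderiv js f"
  define a' where "a' = (\<lambda>x. iter_pderiv (1 # js) f (g x) $ i * iter_pderiv [j] g x $ 1
     + iter_pderiv (2 # js) f (g x) $ i * iter_pderiv [j] g x $ 2)"
  have "a' \<in> chain_rule_algebra f g" unfolding a'_def
    by (intro chain_rule_algebra.intros)
  moreover have "(\<lambda>x. ?P (g x) $ i) differentiable (at x) \<and>
           frechet_derivative (\<lambda>x. ?P (g x) $ i) (at x) (axis j 1) = a' x" if x: "x \<in> S" for x
  proof -
    let ?D = "frechet_derivative ?P (at (g x))" and ?E = "frechet_derivative g (at x)"
    have D: "(?P has_derivative ?D) (at (g x))"
      using f gS x unfolding smooth_on_def by (metis frechet_derivative_works imageI subsetD)
    have "iter_pderiv [] g differentiable (at x)"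
      using g x unfolding smooth_on_def by blast
    then have E: "(g has_derivative ?E) (at x)"
      by (simp add: frechet_derivative_works)
    have "((\<lambda>x. ?P (g x)) has_derivative (\<lambda>h. ?D (?E h))) (at x)"
      by (rule has_derivative_compose[OF E D])
    then have *: "((\<lambda>x. ?P (g x) $ i) has_derivative (\<lambda>h. ?D (?E h) $ i)) (at x)"
      by (rule bounded_linear.has_derivative[OF bounded_linear_vec_nth])
    have "linear ?D" using D has_derivative_linear by blast
    then have "?D (?E (axis j 1)) $ i = a' x"
      using linear_axis_expansion[of ?D "?E (axis j 1)"] by (simp add: a'_def)
    then show ?thesis by (rule has_derivative_imp_frechet_derivative_eq[OF *])
  qed
  ultimately show ?case by (intro bexI ballI)
next
  case (inner js i)
  have "(\<lambda>x. iter_pderiv js g x $ i) differentiable (at x) \<and>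
           frechet_derivative (\<lambda>x. iter_pderiv js g x $ i) (at x) (axis j 1)
             = iter_pderiv (j # js) g x $ i" if x: "x \<in> S" for x
  proof -
    let ?D = "frechet_derivative (iter_pderiv js g) (at x)"
    have D: "(iter_pderiv js g has_derivative ?D) (at x)"
      using g x unfolding smooth_on_def by (metis frechet_derivative_works)
    then have *: "((\<lambda>x. iter_pderiv js g x $ i) has_derivative (\<lambda>h. ?D h $ i)) (at x)"
      by (rule bounded_linear.has_derivative[OF bounded_linear_vec_nth])
    then show ?thesis by (rule has_derivative_imp_frechet_derivative_eq) simp
  qed
  then show ?case
    by (intro bexI[of _ "\<lambda>x. iter_pderiv (j # js) g x $ i"] ballI chain_rule_algebra.inner)
next
  case (plus a b)
  then obtain a' b' where "a' \<in> chain_rule_algebra f g" "b' \<in> chain_rule_algebra f g"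
    and *: "\<forall>x\<in>S. a differentiable (at x) \<and> frechet_derivative a (at x) (axis j 1) = a' x"
     "\<forall>x\<in>S. b differentiable (at x) \<and> frechet_derivative b (at x) (axis j 1) = b' x" by blast
  then have "(\<lambda>x. a' x + b' x) \<in> chain_rule_algebra f g" by (intro chain_rule_algebra.plus)
  moreover have "(\<lambda>x. a x + b x) differentiable (at x) \<and>
      frechet_derivative (\<lambda>x. a x + b x) (at x) (axis j 1) = a' x + b' x" if "x \<in> S" for x
  proof -
    have "((\<lambda>x. a x + b x) has_derivative
        (\<lambda>h. frechet_derivative a (at x) h + frechet_derivative b (at x) h)) (at x)"
      using * that by (intro has_derivative_add) (auto simp: frechet_derivative_works)
    then show ?thesis
      by (rule has_derivative_imp_frechet_derivative_eq) (use * that in simp)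
  qed
  ultimately show ?case by (intro bexI ballI)
next
  case (times a b)
  then obtain a' b' where "a' \<in> chain_rule_algebra f g" "b' \<in> chain_rule_algebra f g"
    and *: "\<forall>x\<in>S. a differentiable (at x) \<and> frechet_derivative a (at x) (axis j 1) = a' x"
     "\<forall>x\<in>S. b differentiable (at x) \<and> frechet_derivative b (at x) (axis j 1) = b' x" by blast
  then have "(\<lambda>x. a x * b' x + a' x * b x) \<in> chain_rule_algebra f g"
    using times by (intro chain_rule_algebra.plus chain_rule_algebra.times)
  moreover have "(\<lambda>x. a x * b x) differentiable (at x) \<and>
      frechet_derivative (\<lambda>x. a x * b x) (at x) (axis j 1) = a x * b' x + a' x * b x"
    if "x \<in> S" for x
  proof -
    have "((\<lambda>x. a x * b x) has_derivative
        (\<lambda>h. a x * frechet_derivative b (at x) h + frechet_derivative a (at x) h * b x)) (at x)"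
      using * that by (intro has_derivative_mult) (auto simp: frechet_derivative_works)
    then show ?thesis
      by (rule has_derivative_imp_frechet_derivative_eq) (use * that in simp)
  qed
  ultimately show ?case by (intro bexI ballI)
qed

lemma smooth_on_compose:
  assumes f: "smooth_on T f" and g: "smooth_on S g" and gS: "g ` S \<subseteq> T"
  shows "smooth_on S (\<lambda>x. f (g x))"
proof (rule smooth_onI_family)
  let ?F = "{p. \<forall>i. (\<lambda>x. p x $ i) \<in> chain_rule_algebra f g}"
  show "open S" using g by (simp add: smooth_on_def)
  show "(\<lambda>x. f (g x)) \<in> ?F"
    using chain_rule_algebra.outer[of "[]" f g] by simp
  have comp: "p differentiable (at x) \<and>
      (\<forall>i. frechet_derivative p (at x) h $ i = frechet_derivative (\<lambda>x. p x $ i) (at x) h)"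
    if p: "p \<in> ?F" and x: "x \<in> S" for p x h
  proof -
    have d: "(\<lambda>x. p x $ i) differentiable (at x)" for i
      using chain_rule_algebra_closed[OF f g gS] p x by blast
    then have "\<forall>i. \<exists>D. ((\<lambda>x. p x $ i) has_derivative D) (at x)"
      by (auto simp: differentiable_def)
    then obtain D where D: "\<And>i. ((\<lambda>x. p x $ i) has_derivative D i) (at x)" by metis
    have "(p has_derivative (\<lambda>h. \<chi> i. D i h)) (at x)"
      unfolding has_derivative_componentwise_within[of p _ x UNIV]
      using D by (auto simp: Basis_vec_def inner_axis)
    then have "p differentiable (at x)" "frechet_derivative p (at x) = (\<lambda>h. \<chi> i. D i h)"
      by (auto simp: differentiable_def frechet_derivative_at[symmetric])
    then show ?thesis by (simp add: frechet_derivative_at[OF D, symmetric])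
  qed
  then show "p differentiable (at x)" if "p \<in> ?F" "x \<in> S" for p x using that by blast
  fix p j assume p: "p \<in> ?F"
  have "\<forall>i. \<exists>a'\<in>chain_rule_algebra f g. \<forall>x\<in>S.
      frechet_derivative (\<lambda>x. p x $ i) (at x) (axis j 1) = a' x"
    using chain_rule_algebra_closed[OF f g gS] p by blast
  then obtain a' where "\<And>i. a' i \<in> chain_rule_algebra f g"
    "\<And>i x. x \<in> S \<Longrightarrow> frechet_derivative (\<lambda>x. p x $ i) (at x) (axis j 1) = a' i x"
    by metis
  then show "\<exists>p'\<in>?F. \<forall>x\<in>S. frechet_derivative p (at x) (axis j 1) = p' x"
    using comp[OF p] by (intro bexI[of _ "\<lambda>x. \<chi> i. a' i x"]) (auto simp: vec_eq_iff)
qed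

lemma smooth_on_matrix: "open S \<Longrightarrow> smooth_on S (\<lambda>x. (A :: real^2^2) *v x)"
proof (rule smooth_onI_family)
  let ?F = "{\<lambda>x::real^2. (B :: real^2^2) *v x + b | B b. True}"
  have der: "((\<lambda>x. (B :: real^2^2) *v x + b) has_derivative (\<lambda>h. B *v h)) (at x)" for B b x
    by (auto intro!: derivative_eq_intros bounded_linear_imp_has_derivative)
  show "(\<lambda>x. A *v x) \<in> ?F" by (rule CollectI, intro exI[of _ A] exI[of _ 0], simp)
  show "g differentiable (at x)" if "g \<in> ?F" for g x
    using that der by (auto simp: differentiable_def)
  show "\<exists>g'\<in>?F. \<forall>x\<in>S. frechet_derivative g (at x) (axis j 1) = g' x" if g_in: "g \<in> ?F" for g j
  proof -
    obtain B b where g: "g = (\<lambda>x. B *v x + b)"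
      using g_in unfolding mem_Collect_eq by (elim exE conjE)
    have "frechet_derivative g (at x) (axis j 1) = 0 *v x + B *v axis j 1" for x
      unfolding g by (rule conjunct2[OF has_derivative_imp_frechet_derivative_eq[OF der]]) simp
    moreover have "(\<lambda>x. 0 *v x + B *v axis j 1) \<in> ?F" by blast
    ultimately show ?thesis by (intro bexI ballI)
  qed
qed

section \<open>Local diffeomorphisms of the plane\<close>

text \<open>
  The inverse is a parameter here because \<open>the_inv_into S f\<close> changes when the domain is
  shrunk.
\<close>

definition smooth_inverse ::
  "(real^2) set \<Rightarrow> (real^2) set \<Rightarrow> (real^2 \<Rightarrow> real^2) \<Rightarrow> (real^2 \<Rightarrow> real^2) \<Rightarrow> bool" where
  "smooth_inverse S T f g \<longleftrightarrow> smooth_on S f \<and> smooth_on T g \<and> f \<in> S \<rightarrow> T \<and> g \<in> T \<rightarrow> S \<and>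
     (\<forall>x\<in>S. g (f x) = x) \<and> (\<forall>y\<in>T. f (g y) = y)"

lemma smooth_inverse_sym: "smooth_inverse S T f g \<Longrightarrow> smooth_inverse T S g f"
  by (simp add: smooth_inverse_def)

lemma diffeomorphism_between_iff:
  "diffeomorphism_between S T f \<longleftrightarrow> (\<exists>g. smooth_inverse S T f g)"
proof
  assume "diffeomorphism_between S T f"
  then have b: "bij_betw f S T" and s: "smooth_on S f" "smooth_on T (the_inv_into S f)"
    by (auto simp: diffeomorphism_between_def)
  have "f \<in> S \<rightarrow> T" using bij_betwE[OF b] by auto
  moreover have "the_inv_into S f \<in> T \<rightarrow> S"
    using bij_betwE[OF bij_betw_the_inv_into[OF b]] by auto
  moreover have "\<forall>x\<in>S. the_inv_into S f (f x) = x"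
    using b by (simp add: bij_betw_def the_inv_into_f_f)
  moreover have "\<forall>y\<in>T. f (the_inv_into S f y) = y"
    using b by (auto simp: bij_betw_def f_the_inv_into_f)
  ultimately have "smooth_inverse S T f (the_inv_into S f)"
    using s by (simp add: smooth_inverse_def)
  then show "\<exists>g. smooth_inverse S T f g" by (rule exI[of _ "the_inv_into S f"])
next
  assume "\<exists>g. smooth_inverse S T f g"
  then obtain g where g: "smooth_on S f" "smooth_on T g" "f \<in> S \<rightarrow> T" "g \<in> T \<rightarrow> S"
    "\<forall>x\<in>S. g (f x) = x" "\<forall>y\<in>T. f (g y) = y"
    unfolding smooth_inverse_def by blast
  have bij: "bij_betw f S T"
    by (rule bij_betw_byWitness[where f' = g]) (use g in auto)
  have "the_inv_into S f y = g y" if "y \<in> T" for y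
    using g that bij by (intro the_inv_into_f_eq) (auto simp: bij_betw_def)
  then have "smooth_on T (the_inv_into S f)"
    by (intro smooth_on_cong[OF g(2)]) simp
  then show "diffeomorphism_between S T f"
    using g(1) bij by (simp add: diffeomorphism_between_def)
qed

lemma smooth_inverse_restrict:
  assumes fg: "smooth_inverse S T f g" and P: "open P"
  shows "smooth_inverse (S \<inter> P) (T \<inter> g -` P) f g"
proof -
  have s: "smooth_on S f" "smooth_on T g" using fg by (auto simp: smooth_inverse_def)
  have "open S" "open T" using s by (auto simp: smooth_on_def)
  then have "open (S \<inter> P)" "open (T \<inter> g -` P)"
    using P continuous_open_preimage[OF smooth_on_imp_continuous_on[OF s(2)]] by auto
  then show ?thesis using fg smooth_on_subset[OF s(1)] smooth_on_subset[OF s(2)]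
    unfolding smooth_inverse_def by auto
qed

lemma smooth_inverse_compose:
  assumes f: "smooth_inverse S T f f'" and h: "smooth_inverse T U h h'"
  shows "smooth_inverse S U (\<lambda>x. h (f x)) (\<lambda>y. f' (h' y))"
proof -
  have "smooth_on S (\<lambda>x. h (f x))"
    by (rule smooth_on_compose[of T]) (use f h in \<open>auto simp: smooth_inverse_def\<close>)
  moreover have "smooth_on U (\<lambda>y. f' (h' y))"
    by (rule smooth_on_compose[of T]) (use f h in \<open>auto simp: smooth_inverse_def\<close>)
  ultimately show ?thesis using f h by (auto simp: smooth_inverse_def Pi_iff)
qed

definition local_diffeo_at :: "(real^2 \<Rightarrow> real^2) \<Rightarrow> real^2 \<Rightarrow> bool" where
  "local_diffeo_at f x \<longleftrightarrow> (\<exists>S T g. x \<in> S \<and> smooth_inverse S T f g)"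

lemma local_diffeo_atI: "smooth_inverse S T f g \<Longrightarrow> x \<in> S \<Longrightarrow> local_diffeo_at f x"
  unfolding local_diffeo_at_def by (intro exI conjI)

lemma local_diffeo_at_iff:
  "local_diffeo_at f x \<longleftrightarrow> (\<exists>S T. x \<in> S \<and> diffeomorphism_between S T f)"
  unfolding local_diffeo_at_def diffeomorphism_between_iff by blast

lemma local_diffeo_at_inverse:
  assumes "smooth_inverse S T f g" "y \<in> T"
  shows "local_diffeo_at g y"
  by (rule local_diffeo_atI[OF smooth_inverse_sym[OF assms(1)] assms(2)])

lemma local_diffeo_at_compose:
  assumes "local_diffeo_at f x" "local_diffeo_at h (f x)"
  shows "local_diffeo_at (\<lambda>x. h (f x)) x"
proof -
  obtain S T f' where f: "x \<in> S" "smooth_inverse S T f f'"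
    using assms(1) unfolding local_diffeo_at_def by blast
  obtain U V h' where h: "f x \<in> U" "smooth_inverse U V h h'"
    using assms(2) unfolding local_diffeo_at_def by blast
  have op: "open T" "open U" using f(2) h(2) by (auto simp: smooth_inverse_def smooth_on_def)
  note r = smooth_inverse_restrict[OF smooth_inverse_sym[OF f(2)] op(2)]
    smooth_inverse_restrict[OF h(2) op(1)]
  have "smooth_inverse (S \<inter> f -` U) (V \<inter> h' -` T) (\<lambda>x. h (f x)) (\<lambda>y. f' (h' y))"
    by (rule smooth_inverse_compose[OF smooth_inverse_sym[OF r(1)]])
       (use r(2) in \<open>simp add: Int_commute\<close>)
  then show ?thesis by (rule local_diffeo_atI) (use f h in simp)
qed

lemma local_diffeo_at_matrix:
  assumes "invertible (A :: real^2^2)"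
  shows "local_diffeo_at (\<lambda>x. A *v x) x"
proof -
  obtain B where "A ** B = mat 1" "B ** A = mat 1" using assms by (auto simp: invertible_def)
  then have "smooth_inverse UNIV UNIV (\<lambda>x. A *v x) (\<lambda>x. B *v x)"
    by (auto simp: smooth_inverse_def smooth_on_matrix matrix_vector_mul_assoc)
  then show ?thesis by (rule local_diffeo_atI) simp
qed

lemma local_diffeo_at_cong:
  assumes f: "local_diffeo_at f x" and P: "open P" "x \<in> P" "\<And>y. y \<in> P \<Longrightarrow> f y = g y"
  shows "local_diffeo_at g x"
proof -
  obtain S T f' where f': "x \<in> S" "smooth_inverse S T f f'"
    using f unfolding local_diffeo_at_def by blast
  have r: "smooth_inverse (S \<inter> P) (T \<inter> f' -` P) f f'"
    by (rule smooth_inverse_restrict[OF f'(2) P(1)])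
  then have "smooth_on (S \<inter> P) g"
    by (intro smooth_on_cong[of "S \<inter> P" f g]) (use P(3) in \<open>auto simp: smooth_inverse_def\<close>)
  then have "smooth_inverse (S \<inter> P) (T \<inter> f' -` P) g f'"
    using r P(3) unfolding smooth_inverse_def by (auto simp: Pi_iff)
  then show ?thesis by (rule local_diffeo_atI) (use f' P in simp)
qed

text \<open>
  Near \<open>x\<close>, the map \<open>f\<close> is a local inverse of \<open>h\<close> after \<open>h \<circ> f\<close>. Continuity is needed for the values of \<open>f\<close>
  to stay in the domain of that inverse.
\<close>

lemma local_diffeo_at_cancel_left:
  assumes hf: "local_diffeo_at (\<lambda>x. h (f x)) x" and h: "local_diffeo_at h (f x)"
    and f: "open P" "x \<in> P" "continuous_on P f"
  shows "local_diffeo_at f x"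
proof -
  obtain U W h' where h: "f x \<in> U" "smooth_inverse U W h h'"
    using h unfolding local_diffeo_at_def by blast
  have "local_diffeo_at h' (h (f x))"
    by (rule local_diffeo_at_inverse[OF h(2)]) (use h in \<open>auto simp: smooth_inverse_def\<close>)
  then have l: "local_diffeo_at (\<lambda>x. h' (h (f x))) x"
    by (rule local_diffeo_at_compose[OF hf])
  have "open U" using h by (auto simp: smooth_inverse_def smooth_on_def)
  then have "open (P \<inter> f -` U)" using f continuous_open_preimage by blast
  then show ?thesis
    by (rule local_diffeo_at_cong[OF l]) (use f h in \<open>auto simp: smooth_inverse_def\<close>)
qed

lemma local_diffeo_at_homeomorphism:
  assumes "local_diffeo_at f x"
  obtains U W g where "x \<in> U" "open U" "open W" "homeomorphism U W f g"
proof -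
  obtain U W g where g: "x \<in> U" "smooth_inverse U W f g"
    using assms unfolding local_diffeo_at_def by blast
  have "homeomorphism U W f g"
    by (intro homeomorphismI smooth_on_imp_continuous_on)
       (use g in \<open>auto simp: smooth_inverse_def\<close>)
  moreover have "open U" "open W" using g by (auto simp: smooth_inverse_def smooth_on_def)
  ultimately show ?thesis using that g(1) by blast
qed

lemma local_diffeo_at_imp_isCont:
  assumes "local_diffeo_at f x"
  shows "isCont f x"
proof -
  obtain U W g where "x \<in> U" "open U" "open W" "homeomorphism U W f g"
    using local_diffeo_at_homeomorphism[OF assms] .
  then show ?thesis
    using homeomorphism_cont1 continuous_on_eq_continuous_at by blast
qed

lemma diffeomorphism_UNIV_iff:
  "diffeomorphism_between UNIV UNIV f \<longleftrightarrow> bij f \<and> (\<forall>x. local_diffeo_at f x)"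
proof
  assume "diffeomorphism_between UNIV UNIV f"
  then show "bij f \<and> (\<forall>x. local_diffeo_at f x)"
    unfolding local_diffeo_at_iff by (auto simp: diffeomorphism_between_def)
next
  assume f: "bij f \<and> (\<forall>x. local_diffeo_at f x)"
  define h where "h = inv_into UNIV f"
  have h: "h (f x) = x" "f (h x) = x" for x
    using f by (auto simp: h_def bij_is_inj bij_is_surj surj_f_inv_f)
  have ex: "\<exists>S T g. x \<in> S \<and> smooth_inverse S T f g" for x
    using f unfolding local_diffeo_at_def by blast
  have "\<exists>S. x \<in> S \<and> smooth_on S f" for x
    using ex[of x] unfolding smooth_inverse_def by blast
  then have sf: "smooth_on UNIV f" by (rule smooth_on_UNIV)
  have "\<exists>W. y \<in> W \<and> smooth_on W h" for y
  proof -
    obtain U W g where g: "h y \<in> U" "smooth_inverse U W f g" using ex by blast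
    have "h z = g z" if "z \<in> W" for z
      using g(2) that h unfolding smooth_inverse_def by metis
    then have "smooth_on W h"
      using g(2) smooth_on_cong[of W g h] unfolding smooth_inverse_def by simp
    moreover have "y \<in> W" using g h(2)[of y] unfolding smooth_inverse_def by (metis PiE)
    ultimately show ?thesis by blast
  qed
  then have "smooth_on UNIV h" by (rule smooth_on_UNIV)
  then have "smooth_inverse UNIV UNIV f h" using sf h by (simp add: smooth_inverse_def)
  then show "diffeomorphism_between UNIV UNIV f" unfolding diffeomorphism_between_iff by blast
qed

lemma diffeomorphism_UNIV_compose:
  assumes "diffeomorphism_between UNIV UNIV f" "diffeomorphism_between UNIV UNIV g"
  shows "diffeomorphism_between UNIV UNIV (\<lambda>x. f (g x))"
proof -
  have "bij (\<lambda>x. f (g x))"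
    using assms bij_comp[of g f] by (auto simp: diffeomorphism_UNIV_iff comp_def)
  moreover have "local_diffeo_at (\<lambda>x. f (g x)) x" for x
    by (rule local_diffeo_at_compose) (use assms in \<open>auto simp: diffeomorphism_UNIV_iff\<close>)
  ultimately show ?thesis by (simp add: diffeomorphism_UNIV_iff)
qed

lemma diffeomorphism_UNIV_inverse:
  assumes "diffeomorphism_between UNIV UNIV f"
  obtains g where "diffeomorphism_between UNIV UNIV g" "\<And>x. g (f x) = x" "\<And>x. f (g x) = x"
proof -
  obtain g where "smooth_inverse UNIV UNIV f g"
    using assms unfolding diffeomorphism_between_iff by blast
  then have "diffeomorphism_between UNIV UNIV g" "\<And>x. g (f x) = x" "\<And>x. f (g x) = x"
    using smooth_inverse_sym[of UNIV UNIV f g]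
    unfolding diffeomorphism_between_iff by (blast, auto simp: smooth_inverse_def)
  then show ?thesis by (rule that)
qed

section \<open>Complex coordinates and the exponential map\<close>

definition toC :: "real^2 \<Rightarrow> complex" where "toC v = Complex (v $ 1) (v $ 2)"

definition ofC :: "complex \<Rightarrow> real^2" where "ofC z = vector [Re z, Im z]"

lemma toC_sel [simp]: "Re (toC v) = v $ 1" "Im (toC v) = v $ 2"
  by (simp_all add: toC_def)

lemma ofC_sel [simp]: "ofC z $ 1 = Re z" "ofC z $ 2 = Im z"
  by (simp_all add: ofC_def)

lemma toC_ofC [simp]: "toC (ofC z) = z"
  by (simp add: complex_eq_iff)

lemma ofC_toC [simp]: "ofC (toC v) = v"
  by (simp add: vec_eq_iff forall_2)

lemma ofC_eq_iff [simp]: "ofC z = ofC w \<longleftrightarrow> z = w"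
  by (metis toC_ofC)

lemma toC_eq_iff [simp]: "toC v = toC w \<longleftrightarrow> v = w"
  by (metis ofC_toC)

lemma linear_toC: "linear toC"
  by (rule linearI) (simp_all add: complex_eq_iff)

lemma linear_ofC: "linear ofC"
  by (rule linearI) (simp_all add: vec_eq_iff forall_2)

lemma bounded_linear_toC: "bounded_linear toC"
  using linear_toC by (simp add: linear_conv_bounded_linear)

lemma bounded_linear_ofC: "bounded_linear ofC"
  using linear_ofC by (simp add: linear_conv_bounded_linear)

lemmas toC_simps [simp] = linear_0[OF linear_toC] linear_add[OF linear_toC]
  linear_diff[OF linear_toC] linear_neg[OF linear_toC]

lemmas ofC_simps [simp] = linear_0[OF linear_ofC] linear_add[OF linear_ofC, symmetric]
  linear_diff[OF linear_ofC, symmetric] linear_neg[OF linear_ofC, symmetric]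

lemma norm_toC [simp]: "norm (toC v) = norm v"
  by (simp add: cmod_def norm_vec_def L2_set_def sum_2)

lemma norm_ofC [simp]: "norm (ofC z) = norm z"
  by (metis norm_toC toC_ofC)

lemma ofC_eq_0_iff [simp]: "ofC z = 0 \<longleftrightarrow> z = 0"
  by (metis norm_ofC norm_eq_zero)

lemma toC_axis [simp]: "toC (axis 1 1) = 1" "toC (axis 2 1) = \<i>"
  by (simp_all add: complex_eq_iff axis_def)

lemmas continuous_on_toC [continuous_intros] = bounded_linear.continuous_on[OF bounded_linear_toC]
lemmas continuous_on_ofC [continuous_intros] = bounded_linear.continuous_on[OF bounded_linear_ofC]
lemmas tendsto_toC [tendsto_intros] = bounded_linear.tendsto[OF bounded_linear_toC]
lemmas tendsto_ofC [tendsto_intros] = bounded_linear.tendsto[OF bounded_linear_ofC]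

lemma open_vimage_toC: "open S \<Longrightarrow> open (toC -` S)"
  by (intro open_vimage) (auto intro!: continuous_intros)

definition cmat :: "complex \<Rightarrow> real^2^2" where
  "cmat z = vector [vector [Re z, - Im z], vector [Im z, Re z]]"

definition conj_mat :: "real^2^2" where
  "conj_mat = vector [vector [1, 0], vector [0, -1]]"

lemma cmat_mult_vec [simp]: "cmat z *v v = ofC (z * toC v)"
  by (simp add: vec_eq_iff forall_2 cmat_def matrix_vector_mult_def sum_2)

lemma conj_mat_mult_vec [simp]: "conj_mat *v v = ofC (cnj (toC v))"
  by (simp add: vec_eq_iff forall_2 conj_mat_def matrix_vector_mult_def sum_2)

lemma matrix_eqI: "(\<And>v. (A :: real^2^2) *v v = B *v v) \<Longrightarrow> A = B"
  by (simp add: matrix_eq)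

lemma cmat_mult: "cmat z ** cmat w = cmat (z * w)"
  by (rule matrix_eqI) (simp add: matrix_vector_mul_assoc[symmetric] mult.assoc)

lemma cmat_1: "cmat 1 = mat 1"
  by (rule matrix_eqI) simp

lemma cmat_minus: "cmat (- z) = - cmat z"
  by (simp add: vec_eq_iff forall_2 cmat_def)

lemma cmat_eq_iff [simp]: "cmat z = cmat w \<longleftrightarrow> z = w"
  by (auto simp: cmat_def vec_eq_iff forall_2 complex_eq_iff)

lemma invertible_cmat: "z \<noteq> 0 \<Longrightarrow> invertible (cmat z)"
  unfolding invertible_def
  by (rule exI[of _ "cmat (inverse z)"]) (simp add: cmat_mult cmat_1)

lemma conj_mat_square: "conj_mat ** conj_mat = mat 1"
  by (rule matrix_eqI) (simp add: matrix_vector_mul_assoc[symmetric])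

lemma invertible_conj_mat: "invertible conj_mat"
  unfolding invertible_def using conj_mat_square by blast

lemma conj_mat_cmat: "conj_mat ** cmat z ** conj_mat = cmat (cnj z)"
  by (rule matrix_eqI) (simp add: matrix_vector_mul_assoc[symmetric])

lemma smooth_on_holomorphic:
  assumes S: "open S" and F: "F holomorphic_on S"
  shows "smooth_on (toC -` S) (\<lambda>v. ofC (F (toC v)))"
proof (rule smooth_onI_family)
  let ?F = "{\<lambda>v. ofC (\<alpha> * (deriv ^^ n) F (toC v)) | \<alpha> n. True}"
  show "open (toC -` S)" using S by (rule open_vimage_toC)
  have "(\<lambda>v. ofC (1 * (deriv ^^ 0) F (toC v))) \<in> ?F" by blast
  then show "(\<lambda>v. ofC (F (toC v))) \<in> ?F" by simp
  have der: "((\<lambda>v. ofC (\<alpha> * (deriv ^^ n) F (toC v))) has_derivative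
      (\<lambda>h. ofC (\<alpha> * ((deriv ^^ Suc n) F (toC v) * toC h)))) (at v)"
    if v: "v \<in> toC -` S" for \<alpha> n v
  proof -
    have "(deriv ^^ n) F holomorphic_on S" using F S by (rule holomorphic_higher_deriv)
    then have "((deriv ^^ n) F has_field_derivative (deriv ^^ Suc n) F (toC v)) (at (toC v))"
      using S v by (simp add: holomorphic_derivI)
    then have "((deriv ^^ n) F has_derivative (\<lambda>h. (deriv ^^ Suc n) F (toC v) * h)) (at (toC v))"
      by (simp add: has_field_derivative_def)
    then have "((\<lambda>v. (deriv ^^ n) F (toC v)) has_derivative
        (\<lambda>h. (deriv ^^ Suc n) F (toC v) * toC h)) (at v)"
      by (rule has_derivative_compose[OF bounded_linear_imp_has_derivative[OF bounded_linear_toC]])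
    then show ?thesis
      by (intro bounded_linear.has_derivative[OF bounded_linear_ofC] has_derivative_mult_right)
  qed
  show "g differentiable (at v)" if g_in: "g \<in> ?F" and v: "v \<in> toC -` S" for g v
  proof -
    obtain \<alpha> n where "g = (\<lambda>v. ofC (\<alpha> * (deriv ^^ n) F (toC v)))"
      using g_in unfolding mem_Collect_eq by (elim exE conjE)
    then show ?thesis using differentiableI[OF der[OF v]] by simp
  qed
  show "\<exists>g'\<in>?F. \<forall>v\<in>toC -` S. frechet_derivative g (at v) (axis j 1) = g' v"
    if g_in: "g \<in> ?F" for g j
  proof -
    obtain \<alpha> n where g: "g = (\<lambda>v. ofC (\<alpha> * (deriv ^^ n) F (toC v)))"
      using g_in unfolding mem_Collect_eq by (elim exE conjE)
    let ?g' = "\<lambda>v. ofC ((\<alpha> * toC (axis j 1)) * (deriv ^^ Suc n) F (toC v))"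
    have "frechet_derivative g (at v) (axis j 1) = ?g' v" if "v \<in> toC -` S" for v
      unfolding g
      by (rule conjunct2[OF has_derivative_imp_frechet_derivative_eq[OF der[OF that]]])
         (simp add: mult_ac)
    moreover have "?g' \<in> ?F" by blast
    ultimately show ?thesis by (intro bexI ballI)
  qed
qed

lemma exp_not_nonpos_Reals:
  assumes "\<bar>Im z\<bar> < pi"
  shows "exp z \<notin> \<real>\<^sub>\<le>\<^sub>0"
proof
  assume "exp z \<in> \<real>\<^sub>\<le>\<^sub>0"
  then have "Re (exp z) \<le> 0" "Im (exp z) = 0" by (auto simp: complex_nonpos_Reals_iff)
  moreover have "exp z \<noteq> 0" by simp
  ultimately have "Re (exp z) < 0 \<and> Im (exp z) = 0"
    by (metis complex_eq_iff order_less_le zero_complex.sel)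
  then have "Im (Ln (exp z)) = pi" using Im_Ln_eq_pi[of "exp z"] by simp
  moreover have "Ln (exp z) = z" using assms by (intro Ln_exp) auto
  ultimately show False using assms by simp
qed

lemma local_diffeo_at_exp: "local_diffeo_at (\<lambda>v. ofC (exp (toC v))) x"
proof -
  define a where "a = toC x"
  define S where "S = {z. \<bar>Im (z - a)\<bar> < pi}"
  define T where "T = {w. w / exp a \<notin> \<real>\<^sub>\<le>\<^sub>0}"
  have S: "open S" unfolding S_def by (intro open_Collect_less continuous_intros)
  have "T = - ((\<lambda>w. w / exp a) -` \<real>\<^sub>\<le>\<^sub>0)" by (auto simp: T_def)
  moreover have "closed ((\<lambda>w. w / exp a) -` \<real>\<^sub>\<le>\<^sub>0)"
    by (intro closed_vimage continuous_intros) auto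
  ultimately have T: "open T" using open_Compl by auto
  have "smooth_on (toC -` T) (\<lambda>w. ofC (a + Ln (toC w / exp a)))"
    by (rule smooth_on_holomorphic[OF T]) (auto intro!: holomorphic_intros simp: T_def)
  moreover have "smooth_on (toC -` S) (\<lambda>v. ofC (exp (toC v)))"
    by (rule smooth_on_holomorphic[OF S]) (intro holomorphic_intros)
  moreover have "exp z \<in> T" "a + Ln (exp z / exp a) = z" if "z \<in> S" for z
    using that exp_not_nonpos_Reals[of "z - a"] Ln_exp[of "z - a"]
    by (auto simp: S_def T_def exp_diff)
  moreover have "a + Ln (w / exp a) \<in> S" "exp (a + Ln (w / exp a)) = w" if "w \<in> T" for w
  proof -
    have "w \<noteq> 0" using that by (auto simp: T_def)
    then show "exp (a + Ln (w / exp a)) = w" by (simp add: exp_add)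
    have "Im (Ln (w / exp a)) < pi" using that by (intro Im_Ln_less_pi) (simp add: T_def)
    moreover have "- pi < Im (Ln (w / exp a))" using \<open>w \<noteq> 0\<close> by (intro mpi_less_Im_Ln) simp
    ultimately show "a + Ln (w / exp a) \<in> S" by (simp add: S_def abs_less_iff)
  qed
  ultimately have "smooth_inverse (toC -` S) (toC -` T) (\<lambda>v. ofC (exp (toC v)))
      (\<lambda>w. ofC (a + Ln (toC w / exp a)))"
    unfolding smooth_inverse_def by auto
  then show ?thesis by (rule local_diffeo_atI) (simp add: S_def a_def)
qed

lemma iter_pderiv_exp_linear:
  "iter_pderiv js (\<lambda>v. ofC (\<alpha> * exp (toC (C *v v)))) =
     (\<lambda>x. ofC ((\<alpha> * (\<Prod>j\<leftarrow>js. toC (C *v axis j 1))) * exp (toC (C *v x))))"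
proof (induction js)
  case (Cons j js)
  define \<beta> where "\<beta> = \<alpha> * (\<Prod>j\<leftarrow>js. toC (C *v axis j 1))"
  have "((\<lambda>v. ofC (\<beta> * exp (toC (C *v v)))) has_derivative
      (\<lambda>h. ofC (\<beta> * (exp (toC (C *v x)) * toC (C *v h))))) (at x)" for x
  proof -
    have "((\<lambda>v. toC (C *v v)) has_derivative (\<lambda>h. toC (C *v h))) (at x)"
      by (intro bounded_linear.has_derivative[OF bounded_linear_toC]
          bounded_linear_imp_has_derivative matrix_vector_mul_bounded_linear)
    moreover have "(exp has_derivative (\<lambda>h. exp (toC (C *v x)) * h)) (at (toC (C *v x)))"
      using DERIV_exp[of "toC (C *v x)"] by (simp add: has_field_derivative_def)
    ultimately have "((\<lambda>v. exp (toC (C *v v))) has_derivative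
        (\<lambda>h. exp (toC (C *v x)) * toC (C *v h))) (at x)"
      by (rule has_derivative_compose)
    then show ?thesis
      by (intro bounded_linear.has_derivative[OF bounded_linear_ofC] has_derivative_mult_right)
  qed
  note der = this
  have "frechet_derivative (\<lambda>v. ofC (\<beta> * exp (toC (C *v v)))) (at x) (axis j 1) =
      ofC ((\<beta> * toC (C *v axis j 1)) * exp (toC (C *v x)))" for x
    by (rule conjunct2[OF has_derivative_imp_frechet_derivative_eq[OF der]]) (simp add: mult_ac)
  then show ?case using Cons by (simp add: \<beta>_def mult_ac)
qed simp

section \<open>Equivariant local diffeomorphisms of the plane\<close>

text \<open>
  The sheets over a point \<open>y\<close> are disjoint balls about the points of its fibre. Properness makes
  the fibre finite, and it makes the image of the complement of these balls closed, so that
  some neighbourhood of \<open>y\<close> has no further preimages.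
\<close>

lemma covering_space_if_proper_local_homeomorphism:
  fixes p :: "'a::euclidean_space \<Rightarrow> 'b::euclidean_space"
  assumes local: "\<And>x. \<exists>U W q. x \<in> U \<and> open U \<and> open W \<and> homeomorphism U W p q"
    and proper: "\<And>K. compact K \<Longrightarrow> compact (p -` K)"
    and surj: "surj p"
  shows "covering_space UNIV p UNIV"
proof (rule covering_spaceI)
  have "isCont p x" for x
  proof -
    obtain U W q where *: "x \<in> U" "open U" "homeomorphism U W p q" using local[of x] by metis
    show ?thesis
      using homeomorphism_cont1[OF *(3)] * by (simp add: continuous_on_eq_continuous_at)
  qed
  then show cont: "continuous_on UNIV p" by (simp add: continuous_at_imp_continuous_on)
  show "p ` UNIV = UNIV" by (fact surj)
  fix y :: 'b
  obtain U q where U: "\<And>x. x \<in> U x \<and> open (U x) \<and> open (p ` U x) \<and> homeomorphism (U x) (p ` U x) p (q x)"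
  proof -
    have "\<exists>U q. x \<in> U \<and> open U \<and> open (p ` U) \<and> homeomorphism U (p ` U) p q" for x
      using local[of x] homeomorphism_image1 by metis
    then show ?thesis using that by metis
  qed
  have inj: "a = b" if "a \<in> U x" "b \<in> U x" "p a = p b" for a b x
    using that U[of x] by (metis homeomorphism_apply1)
  define P where "P = p -` {y}"
  have "compact P" unfolding P_def by (rule proper) simp
  then obtain P' where P': "P' \<subseteq> P" "finite P'" "P \<subseteq> (\<Union>x\<in>P'. U x)"
    using compactE_image[of P P U] U by blast
  have "P \<subseteq> P'"
  proof
    fix a assume a: "a \<in> P"
    then obtain x where x: "x \<in> P'" "a \<in> U x" using P' by blast
    have "x \<in> U x" using U[of x] by (rule conjunct1)
    moreover have "p a = p x" using a x P' by (auto simp: P_def)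
    ultimately have "a = x" using inj x(2) by simp
    then show "a \<in> P'" using x by simp
  qed
  then have fin: "finite P" using P' finite_subset by blast
  obtain r where r: "r > 0" "\<And>x. x \<in> P \<Longrightarrow> ball x r \<subseteq> U x"
      "\<And>x x'. x \<in> P \<Longrightarrow> x' \<in> P \<Longrightarrow> x \<noteq> x' \<Longrightarrow> ball x r \<inter> ball x' r = {}"
  proof -
    have "\<exists>r>0. ball x r \<subseteq> U x" for x using U[of x] openE by blast
    then obtain s where s: "\<And>x. s x > 0" "\<And>x. ball x (s x) \<subseteq> U x" by metis
    define r where "r = Min (insert 1 (s ` P))"
    have r: "r > 0" "\<And>x. x \<in> P \<Longrightarrow> r \<le> s x" using fin s by (auto simp: r_def)
    define D where "D = insert 1 ((\<lambda>(a, b). dist a b / 2) ` {(a, b). a \<in> P \<and> b \<in> P \<and> a \<noteq> b})"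
    have finD: "finite D" unfolding D_def
      by (intro finite.insertI finite_imageI finite_subset[OF _ finite_cartesian_product[OF fin fin]])
         auto
    define t where "t = min r (Min D)"
    have "Min D > 0" using finD by (auto simp: D_def)
    then have t: "t > 0" "t \<le> r" using r by (auto simp: t_def)
    show ?thesis
    proof (rule that[of t])
      show "ball x t \<subseteq> U x" if "x \<in> P" for x
        using s(2)[of x] r(2)[OF that] t(2) by (meson order_trans subset_ball)
      show "ball x t \<inter> ball x' t = {}" if "x \<in> P" "x' \<in> P" "x \<noteq> x'" for x x'
      proof -
        have "dist x x' / 2 \<in> D" using that by (auto simp: D_def)
        then have "Min D \<le> dist x x' / 2" by (rule Min_le[OF finD])
        then have "t + t \<le> dist x x'" by (simp add: t_def)
        then show ?thesis by (intro disjoint_ballI)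
      qed
    qed (fact t)
  qed
  define B where "B = - (\<Union>x\<in>P. ball x r)"
  have "closed B" unfolding B_def by (intro closed_Compl open_UN ballI open_ball)
  then have "closedin (top_of_set UNIV) (p ` B)"
    by (intro proper_map[of UNIV]) (use proper in auto)
  then have clB: "closed (p ` B)" by simp
  have oball: "open (p ` ball x r)" if "x \<in> P" for x
  proof -
    have "openin (top_of_set (U x)) (ball x r)"
      using r(2)[OF that] by (intro open_subset) auto
    then have "openin (top_of_set (p ` U x)) (p ` ball x r)"
      using U[of x] by (intro homeomorphism_imp_open_map[of "U x" _ p "q x"]) auto
    then show ?thesis by (rule openin_open_trans) (use U[of x] in simp)
  qed
  define T where "T = (\<Inter>x\<in>P. p ` ball x r) \<inter> - p ` B"
  have T: "open T" unfolding T_def using fin oball clB by auto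
  have "y \<in> T"
  proof -
    have "y \<in> p ` ball x r" if "x \<in> P" for x
      using that r(1) by (intro image_eqI[of _ _ x]) (auto simp: P_def)
    moreover have "y \<notin> p ` B"
    proof
      assume "y \<in> p ` B"
      then obtain b where "b \<in> B" "p b = y" by blast
      then have "b \<in> (\<Union>x\<in>P. ball x r)" using r(1) by (intro UN_I[of b]) (simp_all add: P_def)
      then show False using \<open>b \<in> B\<close> by (simp add: B_def)
    qed
    ultimately show ?thesis by (auto simp: T_def)
  qed
  define v where "v = (\<lambda>x. ball x r \<inter> p -` T) ` P"
  have "\<Union> v = UNIV \<inter> p -` T"
    by (auto simp: v_def T_def B_def)
  moreover have "\<forall>u\<in>v. openin (top_of_set UNIV) u"
    using continuous_open_vimage[OF T] cont
    by (auto simp: v_def continuous_on_eq_continuous_at)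
  moreover have "disjoint v"
    unfolding v_def disjoint_def using r(3) by (auto simp: disjoint_iff)
  moreover have "\<exists>q. homeomorphism u T p q" if u_in: "u \<in> v" for u
  proof -
    obtain x where x: "x \<in> P" "u = ball x r \<inter> p -` T" using u_in by (auto simp: v_def)
    have sub: "u \<subseteq> U x" using x r(2)[OF x(1)] by auto
    have "p ` u = p ` ball x r \<inter> T" using x(2) by blast
    also have "\<dots> = T" using x(1) by (auto simp: T_def)
    finally have "p ` u = T" .
    then have "homeomorphism u T p (q x)"
      using U[of x] by (intro homeomorphism_of_subsets[OF _ sub empty_subsetI]) auto
    then show ?thesis by (rule exI[of _ "q x"])
  qed
  ultimately show "\<exists>T. y \<in> T \<and> openin (top_of_set UNIV) T \<and>
      (\<exists>v. \<Union> v = UNIV \<inter> p -` T \<and> (\<forall>u\<in>v. openin (top_of_set UNIV) u) \<and> disjoint v \<and>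
           (\<forall>u\<in>v. \<exists>q. homeomorphism u T p q))"
    using T \<open>y \<in> T\<close> by (intro exI[of _ T] conjI exI[of _ v]) auto
qed

text \<open>
  The base is simply connected, so the identity lifts to a section \<open>g\<close> through any given point \<open>a\<close>.
  Then \<open>g \<circ> p\<close> and the identity are lifts of \<open>p\<close> which agree at \<open>a\<close>, hence everywhere.
\<close>

lemma inj_if_proper_local_homeomorphism:
  fixes p :: "'a::euclidean_space \<Rightarrow> 'a"
  assumes local: "\<And>x. \<exists>U W q. x \<in> U \<and> open U \<and> open W \<and> homeomorphism U W p q"
    and proper: "\<And>K. compact K \<Longrightarrow> compact (p -` K)"
    and surj: "surj p"
  shows "inj p"
proof (rule injI)
  fix a b assume ab: "p a = p b"
  have cov: "covering_space UNIV p UNIV"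
    by (rule covering_space_if_proper_local_homeomorphism[OF local proper surj])
  have cont: "continuous_on UNIV p" using cov by (rule covering_space_imp_continuous)
  obtain g where g: "continuous_on UNIV g" "g (p a) = a" "\<And>y. p (g y) = y"
    by (rule covering_space_lift_strong[OF cov UNIV_I[of a] UNIV_I[of "p a"], of "\<lambda>x. x"])
       (auto intro: convex_imp_simply_connected convex_imp_locally_path_connected continuous_intros)
  have "g (p b) = b"
  proof (rule covering_space_lift_unique[OF cov, of "\<lambda>x. g (p x)" a "\<lambda>x. x" UNIV p])
    show "continuous_on UNIV (\<lambda>x. g (p x))"
      by (rule continuous_on_compose2[OF g(1) cont]) auto
  qed (use g cont in auto)
  then show "a = b" using g ab by simp
qed

lemma lattice_vec_simps [simp]:
  "lattice_vec 0 = 0" "lattice_vec (\<gamma> + \<delta>) = lattice_vec \<gamma> + lattice_vec \<delta>"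
  "lattice_vec (- \<gamma>) = - lattice_vec \<gamma>"
  "lattice_vec (\<gamma> - \<delta>) = lattice_vec \<gamma> - lattice_vec \<delta>" "lattice_vec \<gamma> $ i = of_int (\<gamma> $ i)"
  by (simp_all add: lattice_vec_def vec_eq_iff)

lemma lattice_vec_axis [simp]: "lattice_vec (axis i 1) = axis i 1"
  by (simp add: lattice_vec_def vec_eq_iff axis_def)

lemma torus_proj_eq_iff: "torus_proj x = torus_proj y \<longleftrightarrow> (\<exists>\<gamma>. y = x + lattice_vec \<gamma>)"
proof
  assume "torus_proj x = torus_proj y"
  moreover have "y + lattice_vec 0 \<in> torus_proj y" unfolding torus_proj_def by blast
  ultimately show "\<exists>\<gamma>. y = x + lattice_vec \<gamma>" by (auto simp: torus_proj_def)
next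
  assume "\<exists>\<gamma>. y = x + lattice_vec \<gamma>"
  then obtain \<gamma> where y: "y = x + lattice_vec \<gamma>" by blast
  show "torus_proj x = torus_proj y" unfolding torus_proj_def
  proof (intro equalityI subsetI; elim imageE; hypsubst)
    show "x + lattice_vec \<delta> \<in> range (\<lambda>\<gamma>. y + lattice_vec \<gamma>)" for \<delta>
      by (rule range_eqI[of _ _ "\<delta> - \<gamma>"]) (simp add: y)
    show "y + lattice_vec \<delta> \<in> range (\<lambda>\<gamma>. x + lattice_vec \<gamma>)" for \<delta>
      by (rule range_eqI[of _ _ "\<gamma> + \<delta>"]) (simp add: y)
  qed
qed

lemma fundamental_domain: "\<exists>\<gamma>. x - lattice_vec \<gamma> \<in> cbox 0 1"
proof
  show "x - lattice_vec (\<chi> i. \<lfloor>x $ i\<rfloor>) \<in> cbox 0 1"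
    by (auto simp: cbox_def Basis_vec_def inner_axis lattice_vec_def; linarith)
qed

text \<open>
  The difference of \<open>E\<close> and the identity is periodic, therefore bounded, so that \<open>E\<close> is proper.
\<close>

lemma equivariant_local_diffeo_bij:
  assumes local: "\<And>x. local_diffeo_at E x"
    and equi: "\<And>x \<gamma>. E (x + lattice_vec \<gamma>) = E x + lattice_vec \<gamma>"
  shows "bij E"
proof -
  have cont: "continuous_on UNIV E"
    using local local_diffeo_at_imp_isCont by (simp add: continuous_at_imp_continuous_on)
  have "compact ((\<lambda>x. E x - x) ` cbox 0 1)"
    by (intro compact_continuous_image continuous_intros continuous_on_subset[OF cont]) auto
  then have "bounded ((\<lambda>x. E x - x) ` cbox 0 1)" by (rule compact_imp_bounded)
  then obtain B where "\<forall>y\<in>(\<lambda>x. E x - x) ` cbox 0 1. norm y \<le> B"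
    unfolding bounded_iff by blast
  then have B: "norm (E x - x) \<le> B" if "x \<in> cbox 0 1" for x
    using that by simp
  have bd: "norm (E x - x) \<le> B" for x
  proof -
    obtain \<gamma> where \<gamma>: "x - lattice_vec \<gamma> \<in> cbox 0 1" using fundamental_domain by blast
    have "E x - x = E (x - lattice_vec \<gamma>) - (x - lattice_vec \<gamma>)"
      using equi[of "x - lattice_vec \<gamma>" \<gamma>] by simp
    then show ?thesis using B[OF \<gamma>] by (simp only:)
  qed
  have proper: "compact (E -` K)" if K: "compact K" for K
  proof -
    obtain R where R: "\<And>y. y \<in> K \<Longrightarrow> norm y \<le> R"
      using compact_imp_bounded[OF K] unfolding bounded_iff by blast
    have "norm x \<le> R + B" if "x \<in> E -` K" for x
    proof -
      have "norm x \<le> norm (E x) + norm (E x - x)"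
        using norm_triangle_sub[of x "E x"] norm_minus_commute[of x "E x"] by simp
      moreover have "norm (E x) \<le> R" by (rule R) (use that in simp)
      ultimately show ?thesis using bd[of x] by linarith
    qed
    then have "bounded (E -` K)" by (rule boundedI)
    moreover have "closed (E -` K)"
      using cont compact_imp_closed[OF K] by (intro closed_vimage)
    ultimately show ?thesis by (simp add: compact_eq_bounded_closed)
  qed
  have locald: "\<exists>U W q. x \<in> U \<and> open U \<and> open W \<and> homeomorphism U W E q" for x
    using local_diffeo_at_homeomorphism[OF local[of x]] by metis
  have "open (range E)"
  proof (subst open_subopen, clarify)
    fix x
    obtain U W q where *: "x \<in> U" "open W" "homeomorphism U W E q" using locald[of x] by metis
    have "E ` U = W" using *(3) by (simp add: homeomorphism_def)
    then show "\<exists>T. open T \<and> E x \<in> T \<and> T \<subseteq> range E"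
      using * by (intro exI[of _ W]) auto
  qed
  moreover have "closedin (top_of_set UNIV) (E ` UNIV)"
    by (rule proper_map[of UNIV]) (use proper in auto)
  ultimately have surj: "surj E"
    using connected_clopen[of "UNIV :: (real^2) set"] by (auto simp: connected_UNIV)
  have "inj E" by (rule inj_if_proper_local_homeomorphism[OF locald proper surj])
  then show ?thesis using surj by (simp add: bij_def)
qed

section \<open>Diffeomorphisms of the torus homotopic to the identity\<close>

lemma topspace_torus: "topspace torus = range torus_proj"
  by (simp add: torus_def topspace_quot_topology)

lemma quotient_map_torus_proj: "quotient_map euclidean torus torus_proj"
  unfolding torus_def by (rule quotient_map_quot_topology)

lemma continuous_map_torus_proj:
  assumes "continuous_on UNIV f"
  shows "continuous_map euclidean torus (\<lambda>x. torus_proj (f x))"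
proof -
  have "continuous_map euclidean torus (torus_proj \<circ> f)"
    by (rule continuous_map_compose[OF _ quotient_imp_continuous_map[OF quotient_map_torus_proj]])
       (use assms in simp)
  then show ?thesis by (simp add: comp_def)
qed

lemma open_map_torus_proj: "open_map euclidean torus torus_proj"
  unfolding open_map_def
proof (intro allI impI)
  fix U :: "(real^2) set" assume "openin euclidean U"
  then have "open ((\<lambda>x. lattice_vec \<gamma> + x) ` U)" for \<gamma> by (simp add: open_translation)
  then have "open (\<Union>\<gamma>. (\<lambda>x. lattice_vec \<gamma> + x) ` U)" by (intro open_UN ballI)
  moreover have "(\<Union>\<gamma>. (\<lambda>x. lattice_vec \<gamma> + x) ` U) = {x. torus_proj x \<in> torus_proj ` U}"
  proof (intro equalityI subsetI)
    fix x assume "x \<in> (\<Union>\<gamma>. (\<lambda>x. lattice_vec \<gamma> + x) ` U)"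
    then obtain \<gamma> u where u: "u \<in> U" "x = lattice_vec \<gamma> + u" by blast
    have "torus_proj u = torus_proj x"
      unfolding torus_proj_eq_iff by (rule exI[of _ \<gamma>]) (simp add: u add.commute)
    then have "torus_proj x \<in> torus_proj ` U" using u(1) by (metis imageI)
    then show "x \<in> {x. torus_proj x \<in> torus_proj ` U}" by simp
  next
    fix x assume "x \<in> {x. torus_proj x \<in> torus_proj ` U}"
    then obtain u where u: "u \<in> U" "torus_proj u = torus_proj x" by auto
    then obtain \<gamma> where "x = u + lattice_vec \<gamma>" using torus_proj_eq_iff by blast
    then show "x \<in> (\<Union>\<gamma>. (\<lambda>x. lattice_vec \<gamma> + x) ` U)"
      using u by (intro UN_I[of \<gamma>] image_eqI[of _ _ u]) auto
  qed
  ultimately show "openin torus (torus_proj ` U)"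
    unfolding torus_def openin_quot_topology by auto
qed

lemma continuous_map_torus_lift:
  assumes "continuous_on UNIV f" "\<And>x. F (torus_proj x) = torus_proj (f x)"
  shows "continuous_map torus torus F"
proof -
  have "continuous_map euclidean torus (F \<circ> torus_proj)"
    using continuous_map_torus_proj[OF assms(1)] by (simp add: comp_def assms(2))
  then show ?thesis using continuous_compose_quotient_map_eq[OF quotient_map_torus_proj] by blast
qed

lemma quotient_map_interval_times_torus_proj:
  "quotient_map (prod_topology (top_of_set {0..1::real}) euclidean)
     (prod_topology (top_of_set {0..1}) torus) (\<lambda>(t, x). (t, torus_proj x))"
proof (rule continuous_open_imp_quotient_map)
  show "continuous_map (prod_topology (top_of_set {0..1::real}) euclidean)
     (prod_topology (top_of_set {0..1}) torus) (\<lambda>(t, x). (t, torus_proj x))"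
    unfolding continuous_map_pairwise
    using continuous_map_compose[OF continuous_map_snd quotient_imp_continuous_map[OF quotient_map_torus_proj]]
    by (auto simp: comp_def case_prod_unfold intro: continuous_map_fst)
  show "open_map (prod_topology (top_of_set {0..1::real}) euclidean)
     (prod_topology (top_of_set {0..1}) torus) (\<lambda>(t, x). (t, torus_proj x))"
    unfolding open_map_def openin_prod_topology_alt
  proof (intro allI impI)
    fix W t c
    assume W: "\<forall>x y. (x, y) \<in> W \<longrightarrow> (\<exists>U V. openin (top_of_set {0..1::real}) U \<and>
        openin (euclidean :: (real^2) topology) V \<and> x \<in> U \<and> y \<in> V \<and> U \<times> V \<subseteq> W)"
      and "(t, c) \<in> (\<lambda>(t, x). (t, torus_proj x)) ` W"
    then obtain x where x: "(t, x) \<in> W" "c = torus_proj x" by auto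
    obtain U V where UV: "openin (top_of_set {0..1::real}) U" "openin euclidean V"
      "t \<in> U" "x \<in> V" "U \<times> V \<subseteq> W"
      using W[rule_format, OF x(1)] by (elim exE conjE)
    have "openin torus (torus_proj ` V)"
      using open_map_torus_proj UV(2) unfolding open_map_def by simp
    moreover have "U \<times> torus_proj ` V \<subseteq> (\<lambda>(t, x). (t, torus_proj x)) ` W" using UV(5) by auto
    ultimately show "\<exists>U V. openin (top_of_set {0..1::real}) U \<and> openin torus V \<and> t \<in> U \<and>
        c \<in> V \<and> U \<times> V \<subseteq> (\<lambda>(t, x). (t, torus_proj x)) ` W"
      using UV x by (intro exI[of _ U] exI[of _ "torus_proj ` V"]) auto
  qed
  show "(\<lambda>(t, x). (t, torus_proj x)) ` topspace (prod_topology (top_of_set {0..1::real}) euclidean) =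
      topspace (prod_topology (top_of_set {0..1}) torus)"
    by (auto simp: topspace_torus)
qed

text \<open>
  The straight-line homotopy from \<open>\<phi>\<close> to the identity commutes with the lattice and descends to
  the torus.
\<close>

lemma equivariant_diffeomorphism_in_Diff1_lifts:
  assumes \<phi>: "diffeomorphism_between UNIV UNIV \<phi>"
    and equi: "\<And>x \<gamma>. \<phi> (x + lattice_vec \<gamma>) = \<phi> x + lattice_vec \<gamma>"
  shows "\<phi> \<in> Diff1_lifts"
proof -
  obtain \<phi>' where \<phi>': "diffeomorphism_between UNIV UNIV \<phi>'" "\<And>x. \<phi>' (\<phi> x) = x" "\<And>x. \<phi> (\<phi>' x) = x"
    using diffeomorphism_UNIV_inverse[OF \<phi>] by metis
  have equi': "\<phi>' (x + lattice_vec \<gamma>) = \<phi>' x + lattice_vec \<gamma>" for x \<gamma>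
    using equi[of "\<phi>' x" \<gamma>] \<phi>' by metis
  have cont: "continuous_on UNIV \<phi>" "continuous_on UNIV \<phi>'"
    using \<phi> \<phi>'(1) by (auto simp: diffeomorphism_between_def smooth_on_imp_continuous_on)
  define s where "s c = (SOME x. torus_proj x = c)" for c
  have s: "torus_proj (s (torus_proj x)) = torus_proj x" for x
    unfolding s_def by (rule someI[of _ x]) simp
  have s': "\<exists>\<gamma>. s (torus_proj x) = x + lattice_vec \<gamma>" for x
    using s[of x] torus_proj_eq_iff by metis
  have desc: "torus_proj (f (s (torus_proj x))) = torus_proj (f x)"
    if "\<And>x \<gamma>. f (x + lattice_vec \<gamma>) = f x + lattice_vec \<gamma>" for f x
  proof -
    obtain \<gamma> where "s (torus_proj x) = x + lattice_vec \<gamma>" using s'[of x] by blast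
    then have "f x = f (s (torus_proj x)) + lattice_vec (- \<gamma>)" using that[of x \<gamma>] by simp
    then show ?thesis unfolding torus_proj_eq_iff by blast
  qed
  define \<psi> where "\<psi> c = torus_proj (\<phi> (s c))" for c
  define \<psi>' where "\<psi>' c = torus_proj (\<phi>' (s c))" for c
  have \<psi>: "\<psi> (torus_proj x) = torus_proj (\<phi> x)" "\<psi>' (torus_proj x) = torus_proj (\<phi>' x)" for x
    unfolding \<psi>_def \<psi>'_def using desc[of \<phi>] desc[of \<phi>'] equi equi' by auto
  have "homeomorphic_maps torus torus \<psi> \<psi>'"
    unfolding homeomorphic_maps_def
    using continuous_map_torus_lift[OF cont(1) \<psi>(1)] continuous_map_torus_lift[OF cont(2) \<psi>(2)] \<psi> \<phi>'
    by (auto simp: topspace_torus)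
  then have hom: "homeomorphic_map torus torus \<psi>" using homeomorphic_maps_map by blast
  define h where "h = (\<lambda>(t::real, c). torus_proj ((1 - t) *\<^sub>R \<phi> (s c) + t *\<^sub>R s c))"
  have h: "h (t, torus_proj x) = torus_proj ((1 - t) *\<^sub>R \<phi> x + t *\<^sub>R x)" for t x
    unfolding h_def prod.case
    by (rule desc[of "\<lambda>x. (1 - t) *\<^sub>R \<phi> x + t *\<^sub>R x"]) (simp add: equi algebra_simps)
  have "continuous_map (prod_topology (top_of_set {0..1}) torus) torus h"
  proof -
    have "continuous_on ({0..1} \<times> UNIV) (\<lambda>p::real \<times> (real^2). (1 - fst p) *\<^sub>R \<phi> (snd p) + fst p *\<^sub>R snd p)"
      by (intro continuous_intros continuous_on_compose2[OF cont(1)]) auto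
    then have "continuous_map (top_of_set ({0..1} \<times> UNIV)) torus
        (torus_proj \<circ> (\<lambda>p::real \<times> (real^2). (1 - fst p) *\<^sub>R \<phi> (snd p) + fst p *\<^sub>R snd p))"
      by (intro continuous_map_compose[OF _ quotient_imp_continuous_map[OF quotient_map_torus_proj]])
         simp
    moreover have "top_of_set ({0..1::real} \<times> (UNIV :: (real^2) set)) =
        prod_topology (top_of_set {0..1}) euclidean"
      using prod_topology_subtopology_eu[of "{0..1::real}" "UNIV :: (real^2) set"] by simp
    moreover have "torus_proj \<circ> (\<lambda>p::real \<times> (real^2). (1 - fst p) *\<^sub>R \<phi> (snd p) + fst p *\<^sub>R snd p) =
        h \<circ> (\<lambda>(t, x). (t, torus_proj x))"
      by (auto simp: fun_eq_iff h)
    ultimately have "continuous_map (prod_topology (top_of_set {0..1}) euclidean) torus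
        (h \<circ> (\<lambda>(t, x). (t, torus_proj x)))" by simp
    then show ?thesis
      using continuous_compose_quotient_map_eq[OF quotient_map_interval_times_torus_proj] by blast
  qed
  moreover have "h (0, c) = \<psi> c" "h (1, c) = id c" if "c \<in> topspace torus" for c
    using that h \<psi> by (auto simp: topspace_torus)
  ultimately have "homotopic_with (\<lambda>_. True) torus torus \<psi> id"
    by (subst homotopic_with) (auto intro!: exI[of _ h])
  then show ?thesis unfolding Diff1_lifts_def using \<phi> hom \<psi>(1) by blast
qed

text \<open>
  The circle-valued function \<open>exp (2 \<pi> \<i> y\<^sub>i)\<close> on the torus turns the image under \<open>\<psi>\<close> of the
  loop from \<open>x\<close> to \<open>x + \<gamma>\<close> into a loop in \<open>\<complex> - {0}\<close>, whose winding number is the \<open>i\<close>-th coordinate of \<open>\<phi> (x + \<gamma>) - \<phi> x\<close>.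
  The homotopy to the identity does not change this number.
\<close>

lemma Diff1_lifts_equivariant:
  assumes "\<phi> \<in> Diff1_lifts"
  shows "\<phi> (x + lattice_vec \<gamma>) = \<phi> x + lattice_vec \<gamma>"
proof -
  obtain \<psi> where \<phi>: "diffeomorphism_between UNIV UNIV \<phi>"
    and \<psi>: "\<And>x. \<psi> (torus_proj x) = torus_proj (\<phi> x)"
    and hom: "homotopic_with (\<lambda>_. True) torus torus \<psi> id"
    using assms unfolding Diff1_lifts_def by blast
  have cont: "continuous_on UNIV \<phi>"
    using \<phi> by (auto simp: diffeomorphism_between_def smooth_on_imp_continuous_on)
  define p where "p t = x + t *\<^sub>R lattice_vec \<gamma>" for t
  have cp: "continuous_map (top_of_set {0..1}) torus (torus_proj \<circ> p)"
    by (intro continuous_map_compose[OF _ quotient_imp_continuous_map[OF quotient_map_torus_proj]])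
       (auto simp: p_def intro!: continuous_intros)
  have p01: "torus_proj (p 0) = torus_proj (p 1)"
    unfolding torus_proj_eq_iff by (auto simp: p_def)
  have "\<phi> (x + lattice_vec \<gamma>) $ i - \<phi> x $ i = lattice_vec \<gamma> $ i" for i
  proof -
    define ex where "ex c = exp (complex_of_real (2 * pi) * \<i> * ((SOME x. torus_proj x = c) $ i))" for c
    have ex: "ex (torus_proj y) = exp (complex_of_real (2 * pi) * \<i> * (y $ i))" for y
    proof -
      have "torus_proj (SOME x. torus_proj x = torus_proj y) = torus_proj y"
        by (rule someI[of _ y]) simp
      then obtain \<delta> where "y = (SOME x. torus_proj x = torus_proj y) + lattice_vec \<delta>"
        unfolding torus_proj_eq_iff by blast
      then have "y $ i = (SOME x. torus_proj x = torus_proj y) $ i + of_int (\<delta> $ i)"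
        by (metis lattice_vec_simps(5) vector_add_component)
      then show ?thesis unfolding ex_def
        by (subst exp_eq) (auto intro!: exI[of _ "- (\<delta> $ i)"] simp: algebra_simps)
    qed
    have "continuous_on UNIV (\<lambda>y::real^2. exp (complex_of_real (2 * pi) * \<i> * (y $ i)))"
      by (intro continuous_intros)
    then have "continuous_map euclidean euclidean (ex \<circ> torus_proj)"
      by (simp add: ex comp_def)
    then have "continuous_map euclidean (top_of_set (- {0})) (ex \<circ> torus_proj)"
      by (rule continuous_map_into_subtopology) (simp add: ex)
    then have cex: "continuous_map torus (top_of_set (- {0})) ex"
      using continuous_compose_quotient_map_eq[OF quotient_map_torus_proj] by blast
    have "homotopic_with (\<lambda>r. r 0 = r 1) (top_of_set {0..1::real}) torus
        (\<psi> \<circ> (torus_proj \<circ> p)) (id \<circ> (torus_proj \<circ> p))"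
      by (rule homotopic_with_compose_continuous_map_right[OF hom cp]) (simp add: p01)
    then have "homotopic_with (\<lambda>r. pathfinish r = pathstart r) (top_of_set {0..1}) (top_of_set (- {0}))
        (ex \<circ> (\<psi> \<circ> (torus_proj \<circ> p))) (ex \<circ> (id \<circ> (torus_proj \<circ> p)))"
      by (rule homotopic_with_compose_continuous_map_left[OF _ cex])
         (simp add: pathfinish_def pathstart_def)
    moreover have "ex \<circ> (\<psi> \<circ> (torus_proj \<circ> p)) = exp \<circ> (\<lambda>t. complex_of_real (2 * pi) * \<i> * (\<phi> (p t) $ i))"
      "ex \<circ> (id \<circ> (torus_proj \<circ> p)) = exp \<circ> (\<lambda>t. complex_of_real (2 * pi) * \<i> * (p t $ i))"
      by (auto simp: fun_eq_iff \<psi> ex)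
    ultimately have "homotopic_loops (- {0}) (exp \<circ> (\<lambda>t. complex_of_real (2 * pi) * \<i> * (\<phi> (p t) $ i)))
        (exp \<circ> (\<lambda>t. complex_of_real (2 * pi) * \<i> * (p t $ i)))"
      by (simp add: homotopic_loops_def)
    then have "winding_number (exp \<circ> (\<lambda>t. complex_of_real (2 * pi) * \<i> * (\<phi> (p t) $ i))) 0 =
        winding_number (exp \<circ> (\<lambda>t. complex_of_real (2 * pi) * \<i> * (p t $ i))) 0"
      by (rule winding_number_homotopic_loops)
    moreover have cont_p: "continuous_on {0..1} p"
      unfolding p_def by (intro continuous_intros)
    have "path (\<lambda>t. complex_of_real (2 * pi) * \<i> * (\<phi> (p t) $ i))" "path (\<lambda>t. complex_of_real (2 * pi) * \<i> * (p t $ i))"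
      unfolding path_def
      by (intro continuous_intros continuous_on_compose2[OF cont cont_p] cont_p; simp)+
    ultimately have "(complex_of_real (2 * pi) * \<i> * (\<phi> (p 1) $ i) - complex_of_real (2 * pi) * \<i> * (\<phi> (p 0) $ i)) / (2 * complex_of_real pi * \<i>) =
        (complex_of_real (2 * pi) * \<i> * (p 1 $ i) - complex_of_real (2 * pi) * \<i> * (p 0 $ i)) / (2 * complex_of_real pi * \<i>)"
      by (simp only: winding_number_compose_exp pathstart_def pathfinish_def)
    then have "complex_of_real (\<phi> (p 1) $ i - \<phi> (p 0) $ i) = of_real (p 1 $ i - p 0 $ i)"
      by (simp add: diff_divide_distrib)
    then have "\<phi> (p 1) $ i - \<phi> (p 0) $ i = p 1 $ i - p 0 $ i" by (simp only: of_real_eq_iff)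
    then show ?thesis by (simp add: p_def)
  qed
  then show ?thesis by (simp add: vec_eq_iff algebra_simps)
qed

lemma Diff1_lifts_iff:
  "\<phi> \<in> Diff1_lifts \<longleftrightarrow> diffeomorphism_between UNIV UNIV \<phi> \<and>
     (\<forall>x \<gamma>. \<phi> (x + lattice_vec \<gamma>) = \<phi> x + lattice_vec \<gamma>)"
proof
  assume "\<phi> \<in> Diff1_lifts"
  moreover from this have "diffeomorphism_between UNIV UNIV \<phi>" by (simp add: Diff1_lifts_def)
  ultimately show "diffeomorphism_between UNIV UNIV \<phi> \<and>
     (\<forall>x \<gamma>. \<phi> (x + lattice_vec \<gamma>) = \<phi> x + lattice_vec \<gamma>)"
    using Diff1_lifts_equivariant by simp
qed (use equivariant_diffeomorphism_in_Diff1_lifts in simp)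

lemma Diff1_lifts_id: "(\<lambda>x. x) \<in> Diff1_lifts"
  unfolding Diff1_lifts_iff diffeomorphism_UNIV_iff
  using local_diffeo_at_matrix[of "mat 1"] by (auto simp: invertible_def bij_def inj_def)

lemma Diff1_lifts_compose: "\<phi> \<in> Diff1_lifts \<Longrightarrow> \<psi> \<in> Diff1_lifts \<Longrightarrow> (\<lambda>x. \<phi> (\<psi> x)) \<in> Diff1_lifts"
  by (simp add: Diff1_lifts_iff diffeomorphism_UNIV_compose)

lemma Diff1_lifts_inverse:
  assumes "\<phi> \<in> Diff1_lifts"
  obtains \<phi>' where "\<phi>' \<in> Diff1_lifts" "\<And>x. \<phi>' (\<phi> x) = x" "\<And>x. \<phi> (\<phi>' x) = x"
proof -
  have \<phi>: "diffeomorphism_between UNIV UNIV \<phi>" "\<And>x \<gamma>. \<phi> (x + lattice_vec \<gamma>) = \<phi> x + lattice_vec \<gamma>"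
    using assms by (auto simp: Diff1_lifts_iff)
  obtain \<phi>' where \<phi>': "diffeomorphism_between UNIV UNIV \<phi>'" "\<And>x. \<phi>' (\<phi> x) = x" "\<And>x. \<phi> (\<phi>' x) = x"
    using diffeomorphism_UNIV_inverse[OF \<phi>(1)] by metis
  have "\<phi>' (x + lattice_vec \<gamma>) = \<phi>' x + lattice_vec \<gamma>" for x \<gamma>
    using \<phi>(2)[of "\<phi>' x" \<gamma>] \<phi>'(2,3) by metis
  then have "\<phi>' \<in> Diff1_lifts" using \<phi>'(1) by (simp add: Diff1_lifts_iff)
  then show ?thesis using that \<phi>'(2,3) by blast
qed

lemma Diff1_lifts_continuous: "\<phi> \<in> Diff1_lifts \<Longrightarrow> continuous_on UNIV \<phi>"
  by (auto simp: Diff1_lifts_iff diffeomorphism_between_def smooth_on_imp_continuous_on)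

section \<open>The projective geometry\<close>

abbreviation "PP \<equiv> proj_punctured_plane"
abbreviation "pj \<equiv> antipodal_proj"

definition mclass :: "real^2^2 \<Rightarrow> (real^2^2) set" where "mclass A = {A, - A}"

lemma PP_sel [simp]: "grp PP = PGL2" "grp_top PP = PGL2_topology"
  "action PP C p = {A *v v | A v. A \<in> C \<and> v \<in> p}"
  by (simp_all add: proj_punctured_plane_def)

lemma matrix_minus_mult [simp]:
  fixes A :: "real^2^2"
  shows "(- A) ** B = - (A ** B)" "A ** (- B) = - (A ** B)" "(- A) *v v = - (A *v v)" "A *v (- v) = - (A *v v)"
  by (simp_all add: vec_eq_iff matrix_matrix_mult_def matrix_vector_mult_def sum_negf)

lemma invertible_minus [simp]: "invertible (- A) \<longleftrightarrow> invertible (A :: real^2^2)"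
proof -
  have "invertible (- A)" if A: "invertible A" for A :: "real^2^2"
  proof -
    obtain B where "A ** B = mat 1" "B ** A = mat 1" using A unfolding invertible_def by blast
    then show ?thesis unfolding invertible_def by (intro exI[of _ "- B"]) simp
  qed
  from this[of A] this[of "- A"] show ?thesis by auto
qed

lemma matrix_inv_mult:
  fixes A :: "real^2^2"
  assumes "invertible A"
  shows "A ** matrix_inv A = mat 1" "matrix_inv A ** A = mat 1" "invertible (matrix_inv A)"
proof -
  have "\<exists>A'. A ** A' = mat 1 \<and> A' ** A = mat 1" using assms by (simp add: invertible_def)
  then have *: "A ** matrix_inv A = mat 1 \<and> matrix_inv A ** A = mat 1"
    unfolding matrix_inv_def by (rule someI_ex)
  then show "A ** matrix_inv A = mat 1" "matrix_inv A ** A = mat 1" by auto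
  show "invertible (matrix_inv A)"
    unfolding invertible_def using * by (intro exI[of _ A]) simp
qed

lemma matrix_inv_mult_vec [simp]:
  fixes A :: "real^2^2"
  assumes "invertible A"
  shows "A *v (matrix_inv A *v v) = v" "matrix_inv A *v (A *v v) = v"
  using matrix_inv_mult[OF assms] by (simp_all add: matrix_vector_mul_assoc)

lemma invertible_mult_vec_eq_0 [simp]:
  fixes A :: "real^2^2"
  assumes "invertible A"
  shows "A *v v = 0 \<longleftrightarrow> v = 0"
  using matrix_inv_mult_vec(2)[OF assms, of v] by (metis matrix_vector_mult_0_right)

lemma invertible_mult2: "invertible A \<Longrightarrow> invertible B \<Longrightarrow> invertible (A ** B :: real^2^2)"
  by (rule invertible_mult)

lemma mclass_eq_iff: "mclass A = mclass B \<longleftrightarrow> A = B \<or> A = - B"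
  by (auto simp: mclass_def doubleton_eq_iff)

lemma mclass_minus: "mclass (- A) = mclass A"
  by (simp add: mclass_eq_iff)

lemma r_coset_mclass: "{mat 1, - mat 1} #>\<^bsub>GL2\<^esub> A = mclass A"
  by (auto simp: r_coset_def GL2_def mclass_def)

lemma carrier_GL2: "carrier GL2 = {A. invertible A}"
  by (simp add: GL2_def)

lemma carrier_PGL2: "carrier PGL2 = mclass ` {A. invertible A}"
  by (auto simp: PGL2_def FactGroup_def RCOSETS_def r_coset_mclass carrier_GL2)

lemma mult_PGL2: "mclass A \<otimes>\<^bsub>PGL2\<^esub> mclass B = mclass (A ** B)"
  by (auto simp: PGL2_def FactGroup_def set_mult_def GL2_def mclass_def)

lemma one_PGL2: "\<one>\<^bsub>PGL2\<^esub> = mclass (mat 1)"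
  by (simp add: PGL2_def FactGroup_def mclass_def)

lemma PGL2_cases:
  assumes "C \<in> carrier PGL2"
  obtains A where "invertible A" "C = mclass A"
  using assms by (auto simp: carrier_PGL2)

lemma group_PGL2: "group PGL2"
proof (rule groupI)
  show "\<one>\<^bsub>PGL2\<^esub> \<in> carrier PGL2"
    unfolding one_PGL2 carrier_PGL2 by (intro imageI) (simp add: invertible_def exI[of _ "mat 1"])
next
  fix x y assume "x \<in> carrier PGL2" "y \<in> carrier PGL2"
  then obtain A B where "invertible A" "x = mclass A" "invertible B" "y = mclass B"
    by (elim PGL2_cases)
  then show "x \<otimes>\<^bsub>PGL2\<^esub> y \<in> carrier PGL2"
    by (simp add: mult_PGL2 carrier_PGL2 invertible_mult2)
next
  fix x y z assume "x \<in> carrier PGL2" "y \<in> carrier PGL2" "z \<in> carrier PGL2"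
  then obtain A B C where "x = mclass A" "y = mclass B" "z = mclass C"
    by (elim PGL2_cases)
  then show "x \<otimes>\<^bsub>PGL2\<^esub> y \<otimes>\<^bsub>PGL2\<^esub> z = x \<otimes>\<^bsub>PGL2\<^esub> (y \<otimes>\<^bsub>PGL2\<^esub> z)"
    by (simp add: mult_PGL2 matrix_mul_assoc)
next
  fix x assume "x \<in> carrier PGL2"
  then obtain A where A: "invertible A" "x = mclass A" by (elim PGL2_cases)
  then show "\<one>\<^bsub>PGL2\<^esub> \<otimes>\<^bsub>PGL2\<^esub> x = x" by (simp add: mult_PGL2 one_PGL2)
  have "mclass (matrix_inv A) \<otimes>\<^bsub>PGL2\<^esub> x = \<one>\<^bsub>PGL2\<^esub>"
    using A by (simp add: mult_PGL2 one_PGL2 matrix_inv_mult)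
  then show "\<exists>y\<in>carrier PGL2. y \<otimes>\<^bsub>PGL2\<^esub> x = \<one>\<^bsub>PGL2\<^esub>"
    using A matrix_inv_mult(3)[OF A(1)] by (intro bexI) (auto simp: carrier_PGL2)
qed

lemma inv_PGL2:
  assumes "invertible A"
  shows "inv\<^bsub>PGL2\<^esub> (mclass A) = mclass (matrix_inv A)"
  by (rule group.inv_equality[OF group_PGL2])
     (use assms matrix_inv_mult[OF assms] in \<open>auto simp: mult_PGL2 one_PGL2 carrier_PGL2\<close>)

lemma pj_eq_iff: "pj v = pj w \<longleftrightarrow> w = v \<or> w = - v"
  by (auto simp: antipodal_proj_def doubleton_eq_iff)

lemma pj_minus [simp]: "pj (- v) = pj v"
  by (simp add: pj_eq_iff)

lemma action_PP [simp]: "{A' *v v' | A' v'. A' \<in> mclass A \<and> v' \<in> pj v} = pj (A *v v)"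
proof (intro equalityI subsetI)
  fix p assume "p \<in> pj (A *v v)"
  then consider "p = A *v v" | "p = (- A) *v v" by (auto simp: antipodal_proj_def)
  then show "p \<in> {A' *v v' | A' v'. A' \<in> mclass A \<and> v' \<in> pj v}"
    by cases (unfold mem_Collect_eq, rule exI[of _ A], rule exI[of _ v],
      simp add: mclass_def antipodal_proj_def,
      rule exI[of _ "- A"], rule exI[of _ v], simp add: mclass_def antipodal_proj_def)
qed (auto simp: mclass_def antipodal_proj_def)

lemma in_conj_class_PP_iff:
  "h \<in> conj_class PP (\<lambda>\<gamma>. mclass (H \<gamma>)) \<longleftrightarrow>
     (\<exists>B. h = (\<lambda>\<gamma>. mclass (B ** H \<gamma> ** matrix_inv B)) \<and> invertible B)"
  unfolding conj_class_def PP_sel mem_Collect_eq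
proof
  assume "\<exists>g. h = (\<lambda>\<gamma>. g \<otimes>\<^bsub>PGL2\<^esub> mclass (H \<gamma>) \<otimes>\<^bsub>PGL2\<^esub> inv\<^bsub>PGL2\<^esub> g) \<and> g \<in> carrier PGL2"
  then obtain g where g: "h = (\<lambda>\<gamma>. g \<otimes>\<^bsub>PGL2\<^esub> mclass (H \<gamma>) \<otimes>\<^bsub>PGL2\<^esub> inv\<^bsub>PGL2\<^esub> g)" "g \<in> carrier PGL2"
    by (elim exE conjE)
  obtain B where B: "invertible B" "g = mclass B" by (rule PGL2_cases[OF g(2)])
  have "h = (\<lambda>\<gamma>. mclass (B ** H \<gamma> ** matrix_inv B))"
    unfolding g(1) using B by (simp add: inv_PGL2 mult_PGL2)
  then show "\<exists>B. h = (\<lambda>\<gamma>. mclass (B ** H \<gamma> ** matrix_inv B)) \<and> invertible B"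
    using B(1) by (intro exI[of _ B] conjI)
next
  assume "\<exists>B. h = (\<lambda>\<gamma>. mclass (B ** H \<gamma> ** matrix_inv B)) \<and> invertible B"
  then obtain B where B: "h = (\<lambda>\<gamma>. mclass (B ** H \<gamma> ** matrix_inv B))" "invertible B"
    by (elim exE conjE)
  have "h = (\<lambda>\<gamma>. mclass B \<otimes>\<^bsub>PGL2\<^esub> mclass (H \<gamma>) \<otimes>\<^bsub>PGL2\<^esub> inv\<^bsub>PGL2\<^esub> (mclass B))"
    unfolding B(1) using B(2) by (simp add: inv_PGL2 mult_PGL2)
  moreover have "mclass B \<in> carrier PGL2" using B by (simp add: carrier_PGL2)
  ultimately show "\<exists>g. h = (\<lambda>\<gamma>. g \<otimes>\<^bsub>PGL2\<^esub> mclass (H \<gamma>) \<otimes>\<^bsub>PGL2\<^esub> inv\<^bsub>PGL2\<^esub> g) \<and> g \<in> carrier PGL2"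
    by (intro exI[of _ "mclass B"] conjI)
qed

lemma conj_class_PP_conjugate:
  assumes A: "invertible A"
  shows "conj_class PP (\<lambda>\<gamma>. mclass (A ** H \<gamma> ** matrix_inv A)) = conj_class PP (\<lambda>\<gamma>. mclass (H \<gamma>))"
proof -
  note Ainv = matrix_inv_mult[OF A]
  have inv_mult: "matrix_inv (B ** C) = matrix_inv C ** matrix_inv B"
    if B: "invertible B" and C: "invertible C" for B C :: "real^2^2"
  proof -
    note i = matrix_inv_mult[OF B] matrix_inv_mult[OF C] matrix_inv_mult[OF invertible_mult2[OF B C]]
    have "matrix_inv C ** matrix_inv B ** (B ** C) = matrix_inv C ** (matrix_inv B ** B) ** C"
      by (simp only: matrix_mul_assoc)
    then have "matrix_inv C ** matrix_inv B ** (B ** C) = mat 1" using i by simp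
    then have "matrix_inv C ** matrix_inv B ** (B ** C) ** matrix_inv (B ** C) = matrix_inv (B ** C)" by simp
    moreover have "matrix_inv C ** matrix_inv B ** ((B ** C) ** matrix_inv (B ** C)) = matrix_inv C ** matrix_inv B"
      using i(7) by simp
    ultimately show ?thesis by (simp only: matrix_mul_assoc)
  qed
  show ?thesis
  proof (intro equalityI subsetI)
    fix h assume "h \<in> conj_class PP (\<lambda>\<gamma>. mclass (A ** H \<gamma> ** matrix_inv A))"
    then obtain B where B: "h = (\<lambda>\<gamma>. mclass (B ** (A ** H \<gamma> ** matrix_inv A) ** matrix_inv B))"
      "invertible B" unfolding in_conj_class_PP_iff by (elim exE conjE)
    have "h = (\<lambda>\<gamma>. mclass ((B ** A) ** H \<gamma> ** matrix_inv (B ** A)))"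
      unfolding B(1) using B(2) A by (simp add: inv_mult matrix_mul_assoc)
    then show "h \<in> conj_class PP (\<lambda>\<gamma>. mclass (H \<gamma>))"
      unfolding in_conj_class_PP_iff
      using invertible_mult2[OF B(2) A] by (intro exI[of _ "B ** A"] conjI)
  next
    fix h assume "h \<in> conj_class PP (\<lambda>\<gamma>. mclass (H \<gamma>))"
    then obtain B where B: "h = (\<lambda>\<gamma>. mclass (B ** H \<gamma> ** matrix_inv B))" "invertible B"
      unfolding in_conj_class_PP_iff by (elim exE conjE)
    define C where "C = B ** matrix_inv A"
    have C: "invertible C" unfolding C_def by (rule invertible_mult2[OF B(2) Ainv(3)])
    have "C ** A = B" unfolding C_def using Ainv by (simp flip: matrix_mul_assoc)
    then have "h = (\<lambda>\<gamma>. mclass ((C ** A) ** H \<gamma> ** matrix_inv (C ** A)))" using B(1) by simp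
    also have "\<dots> = (\<lambda>\<gamma>. mclass (C ** (A ** H \<gamma> ** matrix_inv A) ** matrix_inv C))"
      using C A by (simp add: inv_mult matrix_mul_assoc)
    finally show "h \<in> conj_class PP (\<lambda>\<gamma>. mclass (A ** H \<gamma> ** matrix_inv A))"
      unfolding in_conj_class_PP_iff using C by (intro exI[of _ C] conjI)
  qed
qed

text \<open>
  The ball is convex and omits the origin, so it does not contain two opposite points.
\<close>

lemma inj_on_pj_ball: "inj_on pj (ball v (norm v))"
proof (rule inj_onI)
  fix a b assume ab: "a \<in> ball v (norm v)" "b \<in> ball v (norm v)" "pj a = pj b"
  have "b \<noteq> - a"
  proof
    assume "b = - a"
    then have "norm (v + v) < norm v + norm v"
      using ab norm_triangle_ineq[of "v - a" "v + a"] by (simp add: dist_norm)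
    then show False using norm_scaleR[of 2 v] by (simp add: scaleR_2)
  qed
  then show "a = b" using ab(3) by (auto simp: pj_eq_iff)
qed

lemma atlas_PP: "(V, c) \<in> atlas PP \<longleftrightarrow>
    (\<exists>W. V = pj ` W \<and> c = the_inv_into W pj \<and> open W \<and> 0 \<notin> W \<and> inj_on pj W)"
  by (auto simp: proj_punctured_plane_def)

text \<open>
  A chart is a section of the double covering \<open>antipodal_proj\<close>, so along a lift \<open>f\<close> it agrees with \<open>f\<close> up
  to a locally constant sign.
\<close>

lemma chart_PP_lift:
  assumes Vc: "(V, c) \<in> atlas PP" and f: "continuous_on UNIV f" and x: "pj (f x) \<in> V"
  obtains P \<sigma> where "open P" "x \<in> P" "\<sigma> = 1 \<or> \<sigma> = -1"
    "\<forall>y\<in>P. pj (f y) \<in> V \<and> c (pj (f y)) = \<sigma> *\<^sub>R f y"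
proof -
  obtain W where W: "V = pj ` W" "c = the_inv_into W pj" "open W" "inj_on pj W"
    using Vc atlas_PP by auto
  obtain w where w: "w \<in> W" "pj (f x) = pj w" using x W(1) by auto
  then have "\<exists>\<sigma>. (\<sigma> = 1 \<or> \<sigma> = -1) \<and> w = \<sigma> *\<^sub>R f x" by (auto simp: pj_eq_iff intro: exI[of _ 1] exI[of _ "-1"])
  then obtain \<sigma> where \<sigma>: "\<sigma> = 1 \<or> \<sigma> = -1" "w = \<sigma> *\<^sub>R f x" by blast
  define P where "P = (\<lambda>y. \<sigma> *\<^sub>R f y) -` W"
  have pj\<sigma>: "pj (\<sigma> *\<^sub>R f y) = pj (f y)" for y using \<sigma>(1) by auto
  have cP: "c (pj (f y)) = \<sigma> *\<^sub>R f y" if "y \<in> P" for y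
    using that W(2) the_inv_into_f_f[OF W(4), of "\<sigma> *\<^sub>R f y"] by (simp add: P_def pj\<sigma>)
  have VP: "pj (f y) \<in> V" if "y \<in> P" for y
  proof -
    have "pj (\<sigma> *\<^sub>R f y) \<in> pj ` W" using that by (intro imageI) (simp add: P_def)
    then show ?thesis by (simp add: pj\<sigma> W(1))
  qed
  have "open P" unfolding P_def using W(3) f by (intro open_vimage continuous_intros)
  moreover have "x \<in> P" using w \<sigma> by (simp add: P_def)
  ultimately show thesis using VP cP by (intro that[OF _ _ \<sigma>(1)]) auto
qed

lemma chart_PP_at:
  assumes "v \<noteq> 0"
  shows "(pj ` ball v (norm v), the_inv_into (ball v (norm v)) pj) \<in> atlas PP"
  unfolding atlas_PP using assms inj_on_pj_ball by (intro exI[of _ "ball v (norm v)"]) auto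

lemma chart_PP_at_apply: "w \<in> ball v (norm v) \<Longrightarrow> the_inv_into (ball v (norm v)) pj (pj w) = w"
  by (rule the_inv_into_f_f[OF inj_on_pj_ball])

text \<open>
  Squaring identifies the quotient of the punctured plane by the antipodal map with \<open>\<complex> - {0}\<close>. The squared map has
  a logarithm because the plane is contractible, and half of it is the logarithm of a lift.
\<close>

lemma Cinf_maps_PP_lift:
  assumes "D \<in> Cinf_maps PP"
  obtains E :: "real^2 \<Rightarrow> complex" where "continuous_on UNIV E" "D = (\<lambda>x. pj (ofC (exp (E x))))"
proof -
  define sq where "sq p = (toC (SOME v. pj v = p))\<^sup>2" for p
  have sq: "sq (pj v) = (toC v)\<^sup>2" for v
  proof -
    define w where "w = (SOME w. pj w = pj v)"
    have "pj w = pj v" unfolding w_def by (rule someI[of _ v]) simp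
    then have "v = w \<or> v = - w" by (simp add: pj_eq_iff)
    then show ?thesis by (auto simp: sq_def w_def[symmetric])
  qed
  have loc: "\<exists>U g. x \<in> U \<and> open U \<and> continuous_on U g \<and> (\<forall>y\<in>U. D y = pj (g y) \<and> g y \<noteq> 0)" for x
  proof -
    obtain V c U where c: "(V, c) \<in> atlas PP" "x \<in> U" "D ` U \<subseteq> V" "smooth_on U (c \<circ> D)"
      using assms unfolding Cinf_maps_def by blast
    obtain W where W: "V = pj ` W" "c = the_inv_into W pj" "0 \<notin> W" "inj_on pj W"
      using c(1) atlas_PP by auto
    have "D y = pj (c (D y)) \<and> c (D y) \<noteq> 0" if "y \<in> U" for y
    proof -
      obtain w where "w \<in> W" "D y = pj w" using c(3) W(1) \<open>y \<in> U\<close> by auto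
      moreover from this have "c (D y) = w" using W by (simp add: the_inv_into_f_f)
      ultimately show ?thesis using W(3) by auto
    qed
    then show ?thesis
      using c smooth_on_imp_continuous_on[OF c(4)]
      by (intro exI[of _ U] exI[of _ "c \<circ> D"]) (auto simp: smooth_on_def)
  qed
  have "continuous_on UNIV (\<lambda>x. sq (D x))"
    unfolding continuous_on_eq_continuous_at[OF open_UNIV]
  proof
    fix x
    obtain U g where g: "x \<in> U" "open U" "continuous_on U g" "\<forall>y\<in>U. D y = pj (g y) \<and> g y \<noteq> 0"
      using loc[of x] by (elim exE conjE)
    have "continuous_on U (\<lambda>y. (toC (g y))\<^sup>2)" by (intro continuous_intros g(3))
    then have "continuous_on U (\<lambda>y. sq (D y))"
      by (rule continuous_on_cong[THEN iffD1, rotated -1]) (use g(4) sq in auto)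
    then show "isCont (\<lambda>x. sq (D x)) x" using g(1,2) by (simp add: continuous_on_eq_continuous_at)
  qed
  moreover have nz: "sq (D x) \<noteq> 0" for x
  proof -
    obtain U g where "x \<in> U" "\<forall>y\<in>U. D y = pj (g y) \<and> g y \<noteq> 0" using loc[of x] by (elim exE conjE)
    then show ?thesis using sq linear_0[OF linear_toC] by (metis toC_eq_iff zero_eq_power2)
  qed
  ultimately obtain L where L: "continuous_on UNIV L" "\<And>x. sq (D x) = exp (L x)"
    using continuous_logarithm_on_contractible[of UNIV "\<lambda>x. sq (D x)"]
    by (metis UNIV_I convex_UNIV convex_imp_contractible)
  show thesis
  proof (rule that[of "\<lambda>x. L x / 2"])
    show "continuous_on UNIV (\<lambda>x. L x / 2)" by (intro continuous_intros L(1)) auto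
    have "D x = pj (ofC (exp (L x / 2)))" for x
    proof -
      obtain U g where g: "x \<in> U" "\<forall>y\<in>U. D y = pj (g y) \<and> g y \<noteq> 0" using loc[of x] by (elim exE conjE)
      have "(toC (g x))\<^sup>2 = (exp (L x / 2))\<^sup>2"
        using g L(2)[of x] sq by (simp flip: exp_double)
      then have "toC (g x) = exp (L x / 2) \<or> toC (g x) = - exp (L x / 2)"
        by (simp add: power2_eq_iff)
      then have "g x = ofC (exp (L x / 2)) \<or> g x = - ofC (exp (L x / 2))"
        by (metis ofC_toC linear_neg[OF linear_ofC])
      then show ?thesis using g pj_minus by metis
    qed
    then show "D = (\<lambda>x. pj (ofC (exp (L x / 2))))" by (rule ext)
  qed
qed

lemma local_diffeo_at_scaleR_iff:
  assumes "\<sigma> = 1 \<or> \<sigma> = -1"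
  shows "local_diffeo_at (\<lambda>y. \<sigma> *\<^sub>R f y) x \<longleftrightarrow> local_diffeo_at f x"
proof -
  have i: "invertible (\<sigma> *\<^sub>R mat 1 :: real^2^2)"
    using assms by (auto simp: invertible_def intro: exI[of _ "mat 1"] exI[of _ "- mat 1"])
  have m: "(\<sigma> *\<^sub>R mat 1 :: real^2^2) *v v = \<sigma> *\<^sub>R v" for v
    using assms by auto
  have "local_diffeo_at (\<lambda>y. \<sigma> *\<^sub>R f y) x" if "local_diffeo_at f x" for f
    using local_diffeo_at_compose[OF that local_diffeo_at_matrix[OF i]] by (simp add: m)
  from this[of f] this[of "\<lambda>y. \<sigma> *\<^sub>R f y"] show ?thesis using assms by auto
qed

lemma local_diffeo_PP_lift_iff:
  assumes f: "continuous_on UNIV f" "\<And>x. f x \<noteq> 0"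
  shows "local_diffeo PP (\<lambda>x. pj (f x)) \<longleftrightarrow> (\<forall>x. local_diffeo_at f x)"
proof
  assume D: "local_diffeo PP (\<lambda>x. pj (f x))"
  show "\<forall>x. local_diffeo_at f x"
  proof
    fix x
    obtain V c U W where c: "(V, c) \<in> atlas PP" "x \<in> U" "(\<lambda>x. pj (f x)) ` U \<subseteq> V"
      "diffeomorphism_between U W (c \<circ> (\<lambda>x. pj (f x)))"
      using D unfolding local_diffeo_def by blast
    have "pj (f x) \<in> V" using c by auto
    obtain P \<sigma> where P: "open P" "x \<in> P" "\<sigma> = 1 \<or> \<sigma> = -1"
      and cP: "\<forall>y\<in>P. pj (f y) \<in> V \<and> c (pj (f y)) = \<sigma> *\<^sub>R f y"
      by (rule chart_PP_lift[OF c(1) f(1) \<open>pj (f x) \<in> V\<close>])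
    have "local_diffeo_at (c \<circ> (\<lambda>x. pj (f x))) x"
      unfolding local_diffeo_at_iff using c(2,4) by (intro exI conjI)
    then have "local_diffeo_at (\<lambda>y. \<sigma> *\<^sub>R f y) x"
      by (rule local_diffeo_at_cong[OF _ P(1,2)]) (simp add: cP)
    then show "local_diffeo_at f x" using local_diffeo_at_scaleR_iff[OF P(3)] by blast
  qed
next
  assume loc: "\<forall>x. local_diffeo_at f x"
  show "local_diffeo PP (\<lambda>x. pj (f x))"
    unfolding local_diffeo_def
  proof
    fix x
    let ?B = "ball (f x) (norm (f x))"
    let ?c = "the_inv_into ?B pj"
    define P where "P = f -` ?B"
    have P: "open P" "x \<in> P" unfolding P_def using f by (auto intro: open_vimage)
    have "local_diffeo_at (?c \<circ> (\<lambda>x. pj (f x))) x"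
      by (rule local_diffeo_at_cong[OF loc[rule_format] P])
         (simp add: P_def chart_PP_at_apply)
    then obtain S T g where "x \<in> S" "smooth_inverse S T (?c \<circ> (\<lambda>x. pj (f x))) g"
      unfolding local_diffeo_at_def by blast
    then have S: "x \<in> S \<inter> P" "smooth_inverse (S \<inter> P) (T \<inter> g -` P) (?c \<circ> (\<lambda>x. pj (f x))) g"
      using P smooth_inverse_restrict by auto
    have "diffeomorphism_between (S \<inter> P) (T \<inter> g -` P) (?c \<circ> (\<lambda>x. pj (f x)))"
      unfolding diffeomorphism_between_iff by (rule exI[of _ g]) (rule S(2))
    moreover have "(\<lambda>x. pj (f x)) ` (S \<inter> P) \<subseteq> pj ` ?B" by (auto simp: P_def)
    ultimately have "\<exists>U W. x \<in> U \<and> (\<lambda>x. pj (f x)) ` U \<subseteq> pj ` ?B \<and>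
        diffeomorphism_between U W (?c \<circ> (\<lambda>x. pj (f x)))"
      using S(1) by (intro exI[of _ "S \<inter> P"] exI[of _ "T \<inter> g -` P"]) simp
    then show "\<exists>(V, c)\<in>atlas PP. \<exists>U W. x \<in> U \<and> (\<lambda>x. pj (f x)) ` U \<subseteq> V \<and>
        diffeomorphism_between U W (c \<circ> (\<lambda>x. pj (f x)))"
      by (intro bexI[OF _ chart_PP_at[OF f(2)[of x]]]) simp
  qed
qed

lemma Dev_subset_Cinf_maps: "Dev M \<subseteq> Cinf_maps M"
proof
  fix D assume "D \<in> Dev M"
  then have D: "local_diffeo M D" by (simp add: Dev_def)
  show "D \<in> Cinf_maps M"
    unfolding Cinf_maps_def
  proof (intro CollectI allI)
    fix x
    obtain V c U W where "(V, c) \<in> atlas M" "x \<in> U" "D ` U \<subseteq> V" "diffeomorphism_between U W (c \<circ> D)"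
      using D unfolding local_diffeo_def by blast
    then show "\<exists>(V, c)\<in>atlas M. \<exists>U. x \<in> U \<and> D ` U \<subseteq> V \<and> smooth_on U (c \<circ> D)"
      by (intro bexI[of _ "(V, c)"]) (auto simp: diffeomorphism_between_def)
  qed
qed

section \<open>Linear development maps and their classes\<close>

definition lexp :: "real^2^2 \<Rightarrow> real^2 \<Rightarrow> complex" where
  "lexp C x = exp (toC (C *v x))"

definition lin_dev :: "real^2^2 \<Rightarrow> real^2 \<Rightarrow> (real^2) set" where
  "lin_dev C = (\<lambda>x. pj (ofC (lexp C x)))"

definition lin_hol :: "real^2^2 \<Rightarrow> int^2 \<Rightarrow> (real^2^2) set" where
  "lin_hol C = (\<lambda>\<gamma>. mclass (cmat (lexp C (lattice_vec \<gamma>))))"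

lemma lexp_nonzero [simp]: "lexp C x \<noteq> 0"
  by (simp add: lexp_def)

lemma lexp_0 [simp]: "lexp C 0 = 1"
  by (simp add: lexp_def)

lemma lexp_add: "lexp C (x + y) = lexp C x * lexp C y"
  by (simp add: lexp_def matrix_vector_right_distrib exp_add)

lemma continuous_on_lexp: "continuous_on S (lexp C)"
  unfolding lexp_def
  by (intro continuous_intros linear_continuous_on matrix_vector_mul_bounded_linear)

lemma lexp_surj:
  assumes "invertible C" "z \<noteq> 0"
  obtains x where "lexp C x = z"
  using assms by (intro that[of "matrix_inv C *v ofC (Ln z)"]) (simp add: lexp_def)

lemma in_dev_class_PP_iff:
  "D \<in> dev_class PP (\<lambda>x. pj (f x)) \<longleftrightarrow>
     (\<exists>A \<phi>. D = (\<lambda>x. pj (A *v f (\<phi> x))) \<and> invertible A \<and> \<phi> \<in> Diff1_lifts)"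
  unfolding dev_class_def mem_Collect_eq
proof
  assume "\<exists>g \<phi>. D = (\<lambda>x. action PP g (pj (f (\<phi> x)))) \<and> g \<in> carrier (grp PP) \<and> \<phi> \<in> Diff1_lifts"
  then obtain g \<phi> where g: "D = (\<lambda>x. action PP g (pj (f (\<phi> x))))" "g \<in> carrier PGL2" "\<phi> \<in> Diff1_lifts"
    unfolding PP_sel(1) by (elim exE conjE)
  obtain A where A: "invertible A" "g = mclass A" by (rule PGL2_cases[OF g(2)])
  have "D = (\<lambda>x. pj (A *v f (\<phi> x)))" unfolding g(1) A(2) by simp
  then show "\<exists>A \<phi>. D = (\<lambda>x. pj (A *v f (\<phi> x))) \<and> invertible A \<and> \<phi> \<in> Diff1_lifts"
    using A g by (intro exI[of _ A] exI[of _ \<phi>] conjI)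
next
  assume "\<exists>A \<phi>. D = (\<lambda>x. pj (A *v f (\<phi> x))) \<and> invertible A \<and> \<phi> \<in> Diff1_lifts"
  then obtain A \<phi> where A: "D = (\<lambda>x. pj (A *v f (\<phi> x)))" "invertible A" "\<phi> \<in> Diff1_lifts"
    by (elim exE conjE)
  have "D = (\<lambda>x. action PP (mclass A) (pj (f (\<phi> x))))" unfolding A(1) by simp
  moreover have "mclass A \<in> carrier (grp PP)" using A(2) by (simp add: carrier_PGL2)
  ultimately show "\<exists>g \<phi>. D = (\<lambda>x. action PP g (pj (f (\<phi> x)))) \<and> g \<in> carrier (grp PP) \<and> \<phi> \<in> Diff1_lifts"
    using A(3) by (intro exI[of _ "mclass A"] exI[of _ \<phi>] conjI)
qed

lemma in_dev_class_PP_self: "(\<lambda>x. pj (f x)) \<in> dev_class PP (\<lambda>x. pj (f x))"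
  unfolding in_dev_class_PP_iff
  by (rule exI[of _ "mat 1"], rule exI[of _ "\<lambda>x. x"])
     (auto simp: Diff1_lifts_id invertible_def)

lemma dev_class_PP_eq:
  assumes A: "invertible A" and \<phi>: "\<phi> \<in> Diff1_lifts"
  shows "dev_class PP (\<lambda>x. pj (A *v f (\<phi> x))) = dev_class PP (\<lambda>x. pj (f x))"
proof (intro equalityI subsetI)
  fix D assume "D \<in> dev_class PP (\<lambda>x. pj (A *v f (\<phi> x)))"
  then obtain B \<psi> where D: "D = (\<lambda>x. pj (B *v (A *v f (\<phi> (\<psi> x)))))" "invertible B" "\<psi> \<in> Diff1_lifts"
    unfolding in_dev_class_PP_iff by (elim exE conjE)
  have "D = (\<lambda>x. pj ((B ** A) *v f (\<phi> (\<psi> x))))" unfolding D(1) by (simp add: matrix_vector_mul_assoc)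
  then show "D \<in> dev_class PP (\<lambda>x. pj (f x))"
    unfolding in_dev_class_PP_iff
    using invertible_mult2[OF D(2) A] Diff1_lifts_compose[OF \<phi> D(3)]
    by (intro exI[of _ "B ** A"] exI[of _ "\<lambda>x. \<phi> (\<psi> x)"] conjI)
next
  fix D assume "D \<in> dev_class PP (\<lambda>x. pj (f x))"
  then obtain B \<psi> where D: "D = (\<lambda>x. pj (B *v f (\<psi> x)))" "invertible B" "\<psi> \<in> Diff1_lifts"
    unfolding in_dev_class_PP_iff by (elim exE conjE)
  obtain \<phi>' where \<phi>': "\<phi>' \<in> Diff1_lifts" "\<And>x. \<phi>' (\<phi> x) = x" "\<And>x. \<phi> (\<phi>' x) = x"
    using Diff1_lifts_inverse[OF \<phi>] by metis
  have "D = (\<lambda>x. pj ((B ** matrix_inv A) *v (A *v f (\<phi> (\<phi>' (\<psi> x))))))"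
    unfolding D(1) using A by (simp add: \<phi>'(3) flip: matrix_vector_mul_assoc)
  then show "D \<in> dev_class PP (\<lambda>x. pj (A *v f (\<phi> x)))"
    unfolding in_dev_class_PP_iff
    using invertible_mult2[OF D(2) matrix_inv_mult(3)[OF A]] Diff1_lifts_compose[OF \<phi>'(1) D(3)]
    by (intro exI[of _ "B ** matrix_inv A"] exI[of _ "\<lambda>x. \<phi>' (\<psi> x)"] conjI)
qed

lemma is_holonomy_lin_dev:
  assumes A: "invertible A" and \<phi>: "\<phi> \<in> Diff1_lifts"
  shows "is_holonomy PP (\<lambda>x. pj (A *v ofC (lexp C (\<phi> x))))
    (\<lambda>\<gamma>. mclass (A ** cmat (lexp C (lattice_vec \<gamma>)) ** matrix_inv A))"
proof -
  let ?H = "\<lambda>\<gamma>. A ** cmat (lexp C (lattice_vec \<gamma>)) ** matrix_inv A"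
  have inv: "invertible (?H \<gamma>)" for \<gamma>
    by (intro invertible_mult2 A matrix_inv_mult(3) invertible_cmat lexp_nonzero)
  have "?H (\<gamma> + \<delta>) = ?H \<gamma> ** ?H \<delta>" for \<gamma> \<delta>
    by (rule matrix_eqI) (simp add: lexp_add A mult_ac flip: matrix_vector_mul_assoc)
  then have "(\<lambda>\<gamma>. mclass (?H \<gamma>)) \<in> hom int_lattice PGL2"
    using inv by (auto simp: hom_def int_lattice_def carrier_PGL2 mult_PGL2)
  moreover have "pj (A *v ofC (lexp C (\<phi> (x + lattice_vec \<gamma>)))) = pj (?H \<gamma> *v (A *v ofC (lexp C (\<phi> x))))" for x \<gamma>
    using \<phi> by (simp add: Diff1_lifts_iff lexp_add A mult_ac flip: matrix_vector_mul_assoc)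
  ultimately show ?thesis unfolding is_holonomy_def by simp
qed

lemma is_holonomy_lin_hol: "is_holonomy PP (lin_dev C) (lin_hol C)"
proof -
  have i: "invertible (mat 1 :: real^2^2)" by (auto simp: invertible_def)
  have "matrix_inv (mat 1 :: real^2^2) = mat 1" using matrix_inv_mult(1)[OF i] by simp
  then show ?thesis
    using is_holonomy_lin_dev[OF i Diff1_lifts_id, of C] by (simp add: lin_dev_def lin_hol_def)
qed

lemma lin_hol_hom: "lin_hol C \<in> hom int_lattice PGL2"
  using is_holonomy_lin_hol[of C] by (simp add: is_holonomy_def)

lemma lin_dev_in_Dev:
  assumes "invertible C"
  shows "lin_dev C \<in> Dev PP"
proof -
  have "local_diffeo_at (\<lambda>x. ofC (lexp C x)) x" for x
    unfolding lexp_def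
    by (rule local_diffeo_at_compose[OF local_diffeo_at_matrix[OF assms] local_diffeo_at_exp])
  then have "local_diffeo PP (lin_dev C)"
    unfolding lin_dev_def
    by (subst local_diffeo_PP_lift_iff) (auto intro: continuous_on_lexp continuous_on_ofC)
  then show ?thesis using is_holonomy_lin_hol[of C] unfolding Dev_def by auto
qed

lemma matrix_mult_vec_component: "((A :: real^2^2) *v v) $ i = A $ i $ 1 * v $ 1 + A $ i $ 2 * v $ 2"
  by (simp add: matrix_vector_mult_def sum_2)

text \<open>
  A matrix for which every vector is an eigenvector to the eigenvalue \<open>1\<close> or \<open>-1\<close> is a scalar, as
  the sum of the basis vectors shows.
\<close>

lemma mclass_eqI:
  assumes B: "invertible B" and eq: "\<And>v. v \<noteq> 0 \<Longrightarrow> pj (A *v v) = pj (B *v v)"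
  shows "mclass A = mclass B"
proof -
  define M where "M = matrix_inv B ** A"
  have BM: "B ** M = A" unfolding M_def using matrix_inv_mult[OF B] by (simp add: matrix_mul_assoc)
  have M: "M *v v = v \<or> M *v v = - v" if "v \<noteq> 0" for v
  proof -
    have "B *v v = A *v v \<or> B *v v = - (A *v v)" using eq[OF that] by (simp add: pj_eq_iff)
    then have "A *v v = B *v v \<or> A *v v = - (B *v v)" by auto
    then show ?thesis using B by (auto simp: M_def simp flip: matrix_vector_mul_assoc)
  qed
  let ?e1 = "axis 1 1 :: real^2" and ?e2 = "axis 2 1 :: real^2"
  have nz: "?e1 \<noteq> 0" "?e2 \<noteq> 0" "?e1 + ?e2 \<noteq> 0"
    by (auto simp: vec_eq_iff forall_2 axis_def)
  have "M = mat 1 \<or> M = - mat 1"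
    using M[OF nz(1)] M[OF nz(2)] M[OF nz(3)]
    by (auto simp: vec_eq_iff forall_2 axis_def matrix_mult_vec_component mat_def)
  then show ?thesis using BM by (auto simp: mclass_eq_iff)
qed

lemma holonomy_unique:
  assumes h: "is_holonomy PP (\<lambda>x. pj (f x)) h" "is_holonomy PP (\<lambda>x. pj (f x)) h'"
    and f: "\<And>v. v \<noteq> 0 \<Longrightarrow> \<exists>x. f x = v"
  shows "h = h'"
proof
  fix \<gamma>
  have "h \<gamma> \<in> carrier PGL2" "h' \<gamma> \<in> carrier PGL2"
    using h by (auto simp: is_holonomy_def hom_def int_lattice_def)
  then obtain A B where A: "invertible A" "h \<gamma> = mclass A" and B: "invertible B" "h' \<gamma> = mclass B"
    by (auto simp: carrier_PGL2)
  have "pj (A *v v) = pj (B *v v)" if v: "v \<noteq> 0" for v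
  proof -
    obtain x where x: "f x = v" using f[OF v] by blast
    have "pj (f (x + lattice_vec \<gamma>)) = pj (A *v f x)"
      using h(1) unfolding is_holonomy_def by (simp add: A(2))
    moreover have "pj (f (x + lattice_vec \<gamma>)) = pj (B *v f x)"
      using h(2) unfolding is_holonomy_def by (simp add: B(2))
    ultimately show ?thesis using x by simp
  qed
  then show "h \<gamma> = h' \<gamma>" unfolding A(2) B(2) by (rule mclass_eqI[OF B(1)])
qed

lemma holonomy_lin_dev:
  assumes C: "invertible C" and A: "invertible A" and \<phi>: "\<phi> \<in> Diff1_lifts"
  shows "holonomy PP (\<lambda>x. pj (A *v ofC (lexp C (\<phi> x)))) =
    (\<lambda>\<gamma>. mclass (A ** cmat (lexp C (lattice_vec \<gamma>)) ** matrix_inv A))"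
  unfolding holonomy_def
proof (rule the_equality)
  show "is_holonomy PP (\<lambda>x. pj (A *v ofC (lexp C (\<phi> x))))
      (\<lambda>\<gamma>. mclass (A ** cmat (lexp C (lattice_vec \<gamma>)) ** matrix_inv A))"
    by (rule is_holonomy_lin_dev[OF A \<phi>])
  fix h assume h: "is_holonomy PP (\<lambda>x. pj (A *v ofC (lexp C (\<phi> x)))) h"
  show "h = (\<lambda>\<gamma>. mclass (A ** cmat (lexp C (lattice_vec \<gamma>)) ** matrix_inv A))"
  proof (rule holonomy_unique[OF h is_holonomy_lin_dev[OF A \<phi>]])
    fix v :: "real^2" assume "v \<noteq> 0"
    obtain \<phi>' where \<phi>': "\<And>x. \<phi> (\<phi>' x) = x" using Diff1_lifts_inverse[OF \<phi>] by metis
    have "toC (matrix_inv A *v v) \<noteq> 0"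
      using \<open>v \<noteq> 0\<close> matrix_inv_mult(3)[OF A] by (metis invertible_mult_vec_eq_0 toC_eq_iff toC_simps(1))
    then obtain x where "lexp C x = toC (matrix_inv A *v v)" using lexp_surj[OF C] by metis
    then show "\<exists>x. A *v ofC (lexp C (\<phi> x)) = v" using A by (intro exI[of _ "\<phi>' x"]) (simp add: \<phi>')
  qed
qed

lemma hol_lin_dev:
  assumes C: "invertible C"
  shows "hol PP (dev_class PP (lin_dev C)) = conj_class PP (lin_hol C)"
proof -
  have "conj_class PP (holonomy PP D) = conj_class PP (lin_hol C)"
    if D_in: "D \<in> dev_class PP (lin_dev C)" for D
  proof -
    obtain A \<phi> where A: "D = (\<lambda>x. pj (A *v ofC (lexp C (\<phi> x))))" "invertible A" "\<phi> \<in> Diff1_lifts"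
      using D_in unfolding lin_dev_def in_dev_class_PP_iff by (elim exE conjE)
    show ?thesis
      unfolding A(1) holonomy_lin_dev[OF C A(2,3)] lin_hol_def
      by (rule conj_class_PP_conjugate[OF A(2)])
  qed
  then have "hol PP (dev_class PP (lin_dev C)) =
      (\<Union>D\<in>dev_class PP (lin_dev C). conj_class PP (lin_hol C))"
    unfolding hol_def by (intro SUP_cong refl)
  moreover have "lin_dev C \<in> dev_class PP (lin_dev C)"
    unfolding lin_dev_def by (rule in_dev_class_PP_self)
  then have "dev_class PP (lin_dev C) \<noteq> {}" by (intro notI) simp
  ultimately show ?thesis by (simp only: UN_constant if_False)
qed

text \<open>
  Every real linear map of \<open>\<complex>\<close> has the form \<open>u \<mapsto> \<alpha> u + \<beta> cnj u\<close>. The intertwining relation says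
  \<open>\<alpha> (z - w) = 0\<close> and \<open>\<beta> (cnj z - w) = 0\<close>, and one of \<open>\<alpha>\<close>, \<open>\<beta>\<close> vanishes since \<open>z \<noteq> cnj z\<close>.
\<close>

lemma intertwining_cmat:
  assumes A: "A ** cmat z = cmat w ** A" "invertible A" and z: "Im z \<noteq> 0"
  obtains \<alpha> where "A = cmat \<alpha>" "w = z" | \<alpha> where "A = cmat \<alpha> ** conj_mat" "w = cnj z"
proof -
  define p q where "p = toC (A *v axis 1 1)" and "q = toC (A *v axis 2 1)"
  define \<alpha> \<beta> where "\<alpha> = (p - \<i> * q) / 2" and "\<beta> = (p + \<i> * q) / 2"
  have A\<alpha>: "toC (A *v v) = \<alpha> * toC v + \<beta> * cnj (toC v)" for v
  proof -
    have "A *v v = v $ 1 *\<^sub>R (A *v axis 1 1) + v $ 2 *\<^sub>R (A *v axis 2 1)"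
      using linear_axis_expansion[of "(*v) A" v] by simp
    then have "toC (A *v v) = v $ 1 *\<^sub>R p + v $ 2 *\<^sub>R q"
      by (simp add: p_def q_def linear_scale[OF linear_toC])
    moreover have "toC v = v $ 1 *\<^sub>R 1 + v $ 2 *\<^sub>R \<i>" "cnj (toC v) = v $ 1 *\<^sub>R 1 - v $ 2 *\<^sub>R \<i>"
      by (simp_all add: complex_eq_iff)
    ultimately show ?thesis
      unfolding \<alpha>_def \<beta>_def by (simp add: complex_eq_iff field_simps)
  qed
  have "(A ** cmat z) *v ofC u = (cmat w ** A) *v ofC u" for u
    by (simp only: A(1))
  then have "A *v (cmat z *v ofC u) = cmat w *v (A *v ofC u)" for u
    by (simp only: matrix_vector_mul_assoc)
  then have "toC (A *v (cmat z *v ofC u)) = toC (cmat w *v (A *v ofC u))" for u by simp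
  then have eq: "\<alpha> * (z * u) + \<beta> * cnj (z * u) = w * (\<alpha> * u + \<beta> * cnj u)" for u
    by (simp add: A\<alpha>)
  have "\<alpha> * z + \<beta> * cnj z = w * (\<alpha> + \<beta>)" using eq[of 1] by simp
  moreover have "\<i> * (\<alpha> * z - \<beta> * cnj z) = \<i> * (w * (\<alpha> - \<beta>))" using eq[of \<i>] by (simp add: algebra_simps)
  then have "\<alpha> * z - \<beta> * cnj z = w * (\<alpha> - \<beta>)" by simp
  ultimately have eqs: "\<alpha> * z + \<beta> * cnj z = w * (\<alpha> + \<beta>)" "\<alpha> * z - \<beta> * cnj z = w * (\<alpha> - \<beta>)"
    by blast+
  have "2 * (\<alpha> * (z - w)) = (\<alpha> * z + \<beta> * cnj z - w * (\<alpha> + \<beta>)) + (\<alpha> * z - \<beta> * cnj z - w * (\<alpha> - \<beta>))"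
    "2 * (\<beta> * (cnj z - w)) = (\<alpha> * z + \<beta> * cnj z - w * (\<alpha> + \<beta>)) - (\<alpha> * z - \<beta> * cnj z - w * (\<alpha> - \<beta>))"
    by (simp_all add: algebra_simps)
  then have e: "\<alpha> * (z - w) = 0" "\<beta> * (cnj z - w) = 0" by (simp_all add: eqs)
  show thesis
  proof (cases "\<beta> = 0")
    case True
    have "A = cmat \<alpha>"
    proof (rule matrix_eqI)
      fix v show "A *v v = cmat \<alpha> *v v" using A\<alpha>[of v] True by (metis add.right_neutral cmat_mult_vec mult_zero_left ofC_toC)
    qed
    moreover have "\<alpha> \<noteq> 0"
    proof
      assume "\<alpha> = 0"
      then have "A *v axis 1 1 = 0" using A\<alpha>[of "axis 1 1"] True by (simp flip: toC_eq_iff)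
      then show False using A(2) by (simp add: axis_eq_0_iff)
    qed
    ultimately show thesis using e(1) that(1)[of \<alpha>] by simp
  next
    case False
    then have w: "w = cnj z" using e(2) by simp
    then have "z - w \<noteq> 0" using z by (auto simp: complex_eq_iff)
    then have "\<alpha> = 0" using e(1) by simp
    have "A = cmat \<beta> ** conj_mat"
    proof (rule matrix_eqI)
      fix v show "A *v v = (cmat \<beta> ** conj_mat) *v v"
        using A\<alpha>[of v] \<open>\<alpha> = 0\<close> by (simp flip: matrix_vector_mul_assoc toC_eq_iff)
    qed
    then show thesis using that(2) w by blast
  qed
qed

lemma continuous_exp_constant:
  fixes d :: "'a::topological_space \<Rightarrow> complex"
  assumes S: "connected S" and d: "continuous_on S d" and e: "\<And>x. x \<in> S \<Longrightarrow> exp (d x) = a"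
    and xy: "x \<in> S" "y \<in> S"
  shows "d x = d y"
proof -
  have "2 * pi \<le> norm (d y - d x)" if "d y \<noteq> d x" "x \<in> S" "y \<in> S" for x y
  proof -
    have "exp (d y) = exp (d x)" using e that by simp
    then obtain n :: int where n: "d y = d x + (of_int (2 * n) * pi) * \<i>" using exp_eq by blast
    then have "n \<noteq> 0" using that by auto
    then have "1 \<le> \<bar>real_of_int n\<bar>" by linarith
    then show ?thesis using n by (simp add: norm_mult)
  qed
  then have "d constant_on S"
    by (intro continuous_discrete_range_constant[OF S d]) (auto intro!: exI[of _ "2 * pi"])
  then obtain k where "\<forall>x\<in>S. d x = k" unfolding constant_on_def by (elim exE)
  then show ?thesis using xy by simp
qed

lemma matrix_eq_if_lattice_values:
  fixes C C' :: "real^2^2"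
  assumes "\<And>j. C *v axis j 1 = C' *v axis j 1"
  shows "C = C'"
proof (rule matrix_eqI)
  fix v :: "real^2"
  show "C *v v = C' *v v"
    using linear_axis_expansion[of "(*v) C" v] linear_axis_expansion[of "(*v) C'" v] assms by simp
qed

lemma lexp_conj: "lexp (conj_mat ** C) x = cnj (lexp C x)"
  by (simp add: lexp_def exp_cnj flip: matrix_vector_mul_assoc)

text \<open>
  The difference of the logarithms takes values in a discrete set, so it is constant. Its
  values at \<open>0\<close> and at the basis vectors compare the two matrices because \<open>\<phi>\<close> commutes with the lattice.
\<close>

lemma lexp_rigid:
  assumes eq: "\<And>x. pj (ofC (lexp C' x)) = pj (ofC (\<alpha> * lexp C (\<phi> x)))" and \<phi>: "\<phi> \<in> Diff1_lifts"
  shows "C' = C"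
proof -
  define d where "d x = toC (C' *v x) - toC (C *v \<phi> x)" for x
  have "exp (2 * d x) = \<alpha>\<^sup>2" for x
  proof -
    have "\<alpha> * lexp C (\<phi> x) = lexp C' x \<or> \<alpha> * lexp C (\<phi> x) = - lexp C' x"
      using eq[of x] by (auto simp: pj_eq_iff)
    then have "(\<alpha> * lexp C (\<phi> x))\<^sup>2 = (lexp C' x)\<^sup>2" by auto
    then have "(lexp C' x)\<^sup>2 / (lexp C (\<phi> x))\<^sup>2 = \<alpha>\<^sup>2"
      by (simp add: power_mult_distrib nonzero_divide_eq_eq)
    then show ?thesis by (simp add: d_def lexp_def exp_diff exp_double power_divide)
  qed
  moreover have "continuous_on UNIV (\<lambda>x. 2 * d x)"
    unfolding d_def
    by (intro continuous_intros linear_continuous_on matrix_vector_mul_bounded_linear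
        continuous_on_compose2[OF linear_continuous_on[OF matrix_vector_mul_bounded_linear[of C]]]
        Diff1_lifts_continuous[OF \<phi>]) auto
  ultimately have d: "2 * d x = 2 * d y" for x y
    using continuous_exp_constant[OF connected_UNIV, of "\<lambda>x. 2 * d x" "\<alpha>\<^sup>2" x y] by simp
  have "C *v axis j 1 = C' *v axis j 1" for j
  proof -
    have "\<phi> (0 + lattice_vec (axis j 1)) = \<phi> 0 + lattice_vec (axis j 1)"
      using \<phi> by (simp only: Diff1_lifts_iff)
    then have "\<phi> (axis j 1) = \<phi> 0 + axis j 1" by simp
    then have "toC (C *v \<phi> (axis j 1)) = toC (C *v \<phi> 0) + toC (C *v axis j 1)"
      by (simp add: matrix_vector_right_distrib)
    then have "toC (C *v axis j 1) = toC (C' *v axis j 1)"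
      using d[of "axis j 1" 0] by (simp add: d_def)
    then show ?thesis by (simp only: toC_eq_iff)
  qed
  then show ?thesis by (intro matrix_eq_if_lattice_values) simp
qed

text \<open>
  A matrix which conjugates a holonomy with a value that is not real to another complex holonomy is
  complex linear or antilinear. In the second case it can be absorbed into \<open>C\<close> by a conjugation.
\<close>

lemma lin_dev_class_eqD:
  assumes C: "invertible C" "invertible C'"
    and eq: "dev_class PP (lin_dev C) = dev_class PP (lin_dev C')"
    and j: "Im (lexp C (axis j 1)) \<noteq> 0"
  shows "C' = C \<or> C' = conj_mat ** C"
proof -
  have "lin_dev C' \<in> dev_class PP (lin_dev C)"
    unfolding eq unfolding lin_dev_def by (rule in_dev_class_PP_self)
  then obtain A \<phi> where A: "lin_dev C' = (\<lambda>x. pj (A *v ofC (lexp C (\<phi> x))))" "invertible A" "\<phi> \<in> Diff1_lifts"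
    unfolding lin_dev_def[of C] in_dev_class_PP_iff by (elim exE conjE)
  have "holonomy PP (lin_dev C') = (\<lambda>\<gamma>. mclass (A ** cmat (lexp C (lattice_vec \<gamma>)) ** matrix_inv A))"
    unfolding A(1) by (rule holonomy_lin_dev[OF C(1) A(2,3)])
  moreover have "holonomy PP (lin_dev C') = lin_hol C'"
  proof -
    have i: "invertible (mat 1 :: real^2^2)" by (auto simp: invertible_def)
    have "matrix_inv (mat 1 :: real^2^2) = mat 1" using matrix_inv_mult(1)[OF i] by simp
    then show ?thesis
      using holonomy_lin_dev[OF C(2) i Diff1_lifts_id] by (simp add: lin_dev_def lin_hol_def)
  qed
  ultimately have "mclass (A ** cmat (lexp C (lattice_vec \<gamma>)) ** matrix_inv A) =
      mclass (cmat (lexp C' (lattice_vec \<gamma>)))" for \<gamma>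
    unfolding lin_hol_def by (metis (no_types, lifting))
  then have "A ** cmat (lexp C (axis j 1)) ** matrix_inv A = cmat (lexp C' (axis j 1)) \<or>
      A ** cmat (lexp C (axis j 1)) ** matrix_inv A = cmat (- lexp C' (axis j 1))"
    unfolding cmat_minus mclass_eq_iff by (metis lattice_vec_axis)
  then obtain w where w: "A ** cmat (lexp C (axis j 1)) ** matrix_inv A = cmat w" by blast
  have "A ** cmat (lexp C (axis j 1)) = A ** cmat (lexp C (axis j 1)) ** (matrix_inv A ** A)"
    using matrix_inv_mult[OF A(2)] by simp
  also have "\<dots> = cmat w ** A" unfolding matrix_mul_assoc w ..
  finally have tw: "A ** cmat (lexp C (axis j 1)) = cmat w ** A" .
  have D: "pj (ofC (lexp C' x)) = pj (A *v ofC (lexp C (\<phi> x)))" for x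
    using fun_cong[OF A(1), of x] by (simp add: lin_dev_def)
  show ?thesis
    using tw A(2) j
  proof (rule intertwining_cmat)
    fix \<alpha> assume "A = cmat \<alpha>"
    then have "C' = C" using D by (intro lexp_rigid[OF _ A(3), of C' \<alpha> C]) simp
    then show ?thesis ..
  next
    fix \<alpha> assume "A = cmat \<alpha> ** conj_mat"
    then have "C' = conj_mat ** C"
      using D by (intro lexp_rigid[OF _ A(3), of C' \<alpha>]) (simp add: lexp_conj flip: matrix_vector_mul_assoc)
    then show ?thesis ..
  qed
qed

text \<open>
  In the coordinate given by \<open>C\<close>, the map \<open>E\<close> commutes with the translations in the lattice,
  and it is a local diffeomorphism because \<open>exp\<close> is one.
\<close>

lemma equivariant_logarithm_linear:
  assumes E: "continuous_on UNIV E" and loc: "\<And>x. local_diffeo_at (\<lambda>x. ofC (exp (E x))) x"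
    and C: "invertible C"
    and equi: "\<And>x \<gamma>. E (x + lattice_vec \<gamma>) = E x + toC (C *v lattice_vec \<gamma>)"
  obtains \<phi> where "\<phi> \<in> Diff1_lifts" "\<And>x. exp (E x) = lexp C (\<phi> x)"
proof -
  define \<phi> where "\<phi> x = matrix_inv C *v ofC (E x)" for x
  have C\<phi>: "toC (C *v \<phi> x) = E x" for x using C by (simp add: \<phi>_def)
  have "local_diffeo_at (\<lambda>x. ofC (E x)) x" for x
    by (rule local_diffeo_at_cancel_left[of "\<lambda>v. ofC (exp (toC v))", OF _ local_diffeo_at_exp open_UNIV])
       (auto simp: loc intro!: continuous_intros E)
  then have "local_diffeo_at \<phi> x" for x
    unfolding \<phi>_def
    by (rule local_diffeo_at_compose[OF _ local_diffeo_at_matrix[OF matrix_inv_mult(3)[OF C]]])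
  moreover have "\<phi> (x + lattice_vec \<gamma>) = \<phi> x + lattice_vec \<gamma>" for x \<gamma>
  proof -
    have "ofC (E (x + lattice_vec \<gamma>)) = ofC (E x) + C *v lattice_vec \<gamma>"
      unfolding equi linear_add[OF linear_ofC] by simp
    then show ?thesis using C by (simp add: \<phi>_def matrix_vector_right_distrib)
  qed
  ultimately have "\<phi> \<in> Diff1_lifts"
    unfolding Diff1_lifts_iff diffeomorphism_UNIV_iff using equivariant_local_diffeo_bij by blast
  moreover have "exp (E x) = lexp C (\<phi> x)" for x by (simp add: lexp_def C\<phi>)
  ultimately show thesis by (rule that)
qed

section \<open>Commuting matrices near a complex pair\<close>

lemma bounded_bilinear_matrix_vector_mult:
  "bounded_bilinear (\<lambda>(A :: real^2^2) (v :: real^2). A *v v)"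
  unfolding bilinear_conv_bounded_bilinear[symmetric] bilinear_def
  by (auto intro!: linearI simp: matrix_vector_right_distrib matrix_vector_mult_add_rdistrib
      scaleR_matrix_vector_assoc matrix_vector_mult_scaleR)

lemma bounded_bilinear_matrix_mult:
  "bounded_bilinear (\<lambda>(A :: real^2^2) (B :: real^2^2). A ** B)"
  unfolding bilinear_conv_bounded_bilinear[symmetric] bilinear_def
  by (auto intro!: linearI simp: vec_eq_iff matrix_matrix_mult_def sum_2 algebra_simps)

lemmas tendsto_matrix_mult = bounded_bilinear.tendsto[OF bounded_bilinear_matrix_mult]

lemma tendsto_matrixI:
  fixes A :: "'d \<Rightarrow> real^2^2"
  assumes "\<And>i k. ((\<lambda>d. A d $ i $ k) \<longlongrightarrow> L $ i $ k) F"
  shows "(A \<longlongrightarrow> L) F"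
  by (intro vec_tendstoI assms)

lemma tendsto_entry: "(A \<longlongrightarrow> L) F \<Longrightarrow> ((\<lambda>d. A d $ i $ k) \<longlongrightarrow> L $ i $ k) F"
  by (intro tendsto_vec_nth)

lemma matrix_mult_component: "((A :: real^2^2) ** B) $ i $ k = A $ i $ 1 * B $ 1 $ k + A $ i $ 2 * B $ 2 $ k"
  by (simp add: matrix_matrix_mult_def sum_2)

text \<open>
  The inverse by the adjugate, whose entries are visibly continuous, unlike the choice in
  \<open>matrix_inv\<close>.
\<close>

definition inv2 :: "real^2^2 \<Rightarrow> real^2^2" where
  "inv2 X = (1 / det X) *\<^sub>R vector [vector [X $ 2 $ 2, - X $ 1 $ 2], vector [- X $ 2 $ 1, X $ 1 $ 1]]"

lemma inv2_mult:
  assumes "det X \<noteq> 0"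
  shows "X ** inv2 X = mat 1" "inv2 X ** X = mat 1"
proof -
  let ?Y = "vector [vector [X $ 2 $ 2, - X $ 1 $ 2], vector [- X $ 2 $ 1, X $ 1 $ 1]] :: real^2^2"
  have "X ** ?Y = det X *\<^sub>R mat 1" "?Y ** X = det X *\<^sub>R mat 1"
    by (simp_all add: vec_eq_iff forall_2 matrix_mult_component mat_def det_2)
  then show "X ** inv2 X = mat 1" "inv2 X ** X = mat 1"
    using assms
    by (simp_all add: inv2_def bounded_bilinear.scaleR_left[OF bounded_bilinear_matrix_mult]
        bounded_bilinear.scaleR_right[OF bounded_bilinear_matrix_mult])
qed

lemma tendsto_det:
  fixes X :: "'d \<Rightarrow> real^2^2"
  shows "(X \<longlongrightarrow> L) F \<Longrightarrow> ((\<lambda>d. det (X d)) \<longlongrightarrow> det L) F"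
  unfolding det_2 by (intro tendsto_intros)

lemma tendsto_inv2:
  assumes "(X \<longlongrightarrow> L) F" "det L \<noteq> 0"
  shows "((\<lambda>d. inv2 (X d)) \<longlongrightarrow> inv2 L) F"
  unfolding inv2_def
proof (intro tendsto_scaleR tendsto_divide tendsto_const tendsto_det assms tendsto_matrixI)
  fix i k :: 2
  have "\<And>i k. ((\<lambda>d. X d $ i $ k) \<longlongrightarrow> L $ i $ k) F" using assms(1) by (rule tendsto_entry)
  then show "((\<lambda>d. vector [vector [X d $ 2 $ 2, - X d $ 1 $ 2], vector [- X d $ 2 $ 1, X d $ 1 $ 1]] $ i $ k)
      \<longlongrightarrow> vector [vector [L $ 2 $ 2, - L $ 1 $ 2], vector [- L $ 2 $ 1, L $ 1 $ 1]] $ i $ k) F"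
    using exhaust_2[of i] exhaust_2[of k] by (auto intro!: tendsto_minus)
qed

lemma inverse_unique_matrix:
  fixes X Y Z :: "real^2^2"
  assumes "X ** Y = mat 1" "Z ** X = mat 1"
  shows "Y = Z"
proof -
  have "Y = (Z ** X) ** Y" by (simp add: assms(2))
  also have "\<dots> = Z ** (X ** Y)" by (simp only: matrix_mul_assoc)
  also have "\<dots> = Z" by (simp add: assms(1))
  finally show ?thesis .
qed

lemma commute_cmat:
  assumes "M ** cmat z = cmat z ** M" "Im z \<noteq> 0"
  shows "M = cmat (Complex (M $ 1 $ 1) (M $ 2 $ 1))"
proof -
  have "(M ** cmat z) $ i $ k = (cmat z ** M) $ i $ k" for i k using assms(1) by simp
  from this[of 1 1] this[of 1 2]
  have "Im z * (M $ 1 $ 2 + M $ 2 $ 1) = 0" "Im z * (M $ 2 $ 2 - M $ 1 $ 1) = 0"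
    using assms(2) by (simp_all add: matrix_mult_component cmat_def algebra_simps)
  then have "M $ 1 $ 2 = - M $ 2 $ 1" "M $ 2 $ 2 = M $ 1 $ 1"
    using assms(2) by (auto simp: add_eq_0_iff)
  then show ?thesis by (simp add: vec_eq_iff forall_2 cmat_def)
qed

text \<open>
  By the Cayley-Hamilton theorem \<open>J = (B - t) / s\<close> squares to \<open>-1\<close>, and the matrix \<open>P\<close> with the columns \<open>e\<^sub>1\<close>
  and \<open>J e\<^sub>1\<close> transforms \<open>J\<close> into the rotation by a right angle. If \<open>B = cmat (Complex t s)\<close> then \<open>P = 1\<close>, so the
  conjugation is close to the identity when \<open>B\<close> is close to such a matrix.
\<close>

lemma conjugate_to_cmat:
  fixes B :: "real^2^2"
  assumes t: "t = (B $ 1 $ 1 + B $ 2 $ 2) / 2" and s: "s\<^sup>2 = det B - t\<^sup>2" "s \<noteq> 0"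
    and P: "P = vector [vector [1, (B $ 1 $ 1 - t) / s], vector [0, B $ 2 $ 1 / s]]"
  shows "B ** P = P ** cmat (Complex t s)" "det P \<noteq> 0"
proof -
  have d: "s * s = B $ 1 $ 1 * B $ 2 $ 2 - B $ 1 $ 2 * B $ 2 $ 1 - t * t"
    using s(1) by (simp add: power2_eq_square det_2)
  have t2: "B $ 2 $ 2 = 2 * t - B $ 1 $ 1" using t by simp
  have "B $ 2 $ 1 \<noteq> 0"
  proof
    assume "B $ 2 $ 1 = 0"
    then have "s * s = - ((B $ 1 $ 1 - t) * (B $ 1 $ 1 - t))"
      using d t2 by (simp add: algebra_simps)
    moreover have "s * s > 0" using s(2) not_square_less_zero[of s] by (simp add: less_le)
    moreover have "(B $ 1 $ 1 - t) * (B $ 1 $ 1 - t) \<ge> 0" by simp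
    ultimately show False by linarith
  qed
  then show "det P \<noteq> 0" using s(2) by (simp add: P det_2)
  have "B $ 1 $ 1 * (B $ 1 $ 1 - t) + B $ 1 $ 2 * B $ 2 $ 1 = (B $ 1 $ 1 - t) * t - s * s"
    using d t2 by (simp add: algebra_simps)
  then have "(B $ 1 $ 1 * (B $ 1 $ 1 - t) + B $ 1 $ 2 * B $ 2 $ 1) / s = ((B $ 1 $ 1 - t) * t - s * s) / s"
    by simp
  then have "(B ** P) $ 1 $ 2 = (P ** cmat (Complex t s)) $ 1 $ 2"
    using s(2) by (simp add: P matrix_mult_component cmat_def add_divide_distrib
        diff_divide_distrib algebra_simps)
  moreover have "(B ** P) $ 1 $ 1 = (P ** cmat (Complex t s)) $ 1 $ 1"
    "(B ** P) $ 2 $ 1 = (P ** cmat (Complex t s)) $ 2 $ 1"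
    using s(2) by (simp_all add: P matrix_mult_component cmat_def)
  moreover have "(B ** P) $ 2 $ 2 = (P ** cmat (Complex t s)) $ 2 $ 2"
    using s(2) by (simp add: P matrix_mult_component cmat_def t2 field_simps)
  ultimately show "B ** P = P ** cmat (Complex t s)"
    by (simp add: vec_eq_iff forall_2)
qed

text \<open>
  The matrix close to the number that is not real is conjugated explicitly by \<open>conjugate_to_cmat\<close>; a
  matrix which commutes with it becomes complex under the same conjugation (\<open>commute_cmat\<close>). The
  filter stands for the approximation: it is used for sequences of development maps and for sequences of homomorphisms.
\<close>

lemma commuting_near_complex:
  fixes A :: "'d \<Rightarrow> 2 \<Rightarrow> real^2^2" and F :: "'d filter"
  assumes G: "invertible G" and a: "Im (a j) \<noteq> 0"
    and lim: "\<And>i. ((\<lambda>d. A d i) \<longlongrightarrow> G ** cmat (a i) ** matrix_inv G) F"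
    and comm: "eventually (\<lambda>d. A d 1 ** A d 2 = A d 2 ** A d 1) F"
  obtains Q R b where "(Q \<longlongrightarrow> G) F" "(R \<longlongrightarrow> matrix_inv G) F" "\<And>i. ((\<lambda>d. b d i) \<longlongrightarrow> a i) F"
    "eventually (\<lambda>d. Q d ** R d = mat 1 \<and> R d ** Q d = mat 1 \<and> (\<forall>i. A d i = Q d ** cmat (b d i) ** R d)) F"
proof -
  define G' where "G' = matrix_inv G"
  have GG: "G ** G' = mat 1" "G' ** G = mat 1" using matrix_inv_mult[OF G] by (auto simp: G'_def)
  define B where "B d i = G' ** A d i ** G" for d i
  have B: "((\<lambda>d. B d i) \<longlongrightarrow> cmat (a i)) F" for i
  proof -
    have "((\<lambda>d. B d i) \<longlongrightarrow> G' ** (G ** cmat (a i) ** G') ** G) F"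
      unfolding B_def G'_def by (intro tendsto_matrix_mult tendsto_const lim)
    moreover have "G' ** (G ** cmat (a i) ** G') ** G = (G' ** G) ** cmat (a i) ** (G' ** G)"
      by (simp only: matrix_mul_assoc)
    ultimately show ?thesis by (simp add: GG)
  qed
  note Be = tendsto_entry[OF B[of j]]
  define t where "t d = (B d j $ 1 $ 1 + B d j $ 2 $ 2) / 2" for d
  define s where "s d = sgn (Im (a j)) * sqrt (det (B d j) - (t d)\<^sup>2)" for d
  define P :: "'d \<Rightarrow> real^2^2" where "P d = vector [vector [1, (B d j $ 1 $ 1 - t d) / s d], vector [0, B d j $ 2 $ 1 / s d]]" for d
  have t: "(t \<longlongrightarrow> Re (a j)) F"
    unfolding t_def by (rule tendsto_eq_intros Be refl | simp add: cmat_def)+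
  have D: "((\<lambda>d. det (B d j) - (t d)\<^sup>2) \<longlongrightarrow> (Im (a j))\<^sup>2) F"
    by (rule tendsto_eq_intros tendsto_det[OF B] t refl | simp add: cmat_def det_2 power2_eq_square)+
  have s: "(s \<longlongrightarrow> Im (a j)) F"
  proof -
    have "(s \<longlongrightarrow> sgn (Im (a j)) * sqrt ((Im (a j))\<^sup>2)) F"
      unfolding s_def by (intro tendsto_mult tendsto_const tendsto_real_sqrt D)
    then show ?thesis by (simp add: sgn_mult_abs)
  qed
  have P: "(P \<longlongrightarrow> mat 1) F"
  proof (rule tendsto_matrixI)
    fix i k :: 2
    have "((\<lambda>d. (B d j $ 1 $ 1 - t d) / s d) \<longlongrightarrow> 0) F" "((\<lambda>d. B d j $ 2 $ 1 / s d) \<longlongrightarrow> 1) F"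
      by (rule tendsto_eq_intros Be t s refl a | simp add: cmat_def a)+
    then show "((\<lambda>d. P d $ i $ k) \<longlongrightarrow> mat 1 $ i $ k) F"
      using exhaust_2[of i] exhaust_2[of k] by (auto simp: P_def mat_def)
  qed
  have R1: "((\<lambda>d. inv2 (P d)) \<longlongrightarrow> mat 1) F"
  proof -
    have "inv2 (mat 1 :: real^2^2) = mat 1" by (simp add: inv2_def vec_eq_iff forall_2 mat_def det_2)
    then show ?thesis using tendsto_inv2[OF P] by simp
  qed
  define Q where "Q d = G ** P d" for d
  define R where "R d = inv2 (P d) ** G'" for d
  define M where "M d i = inv2 (P d) ** B d i ** P d" for d i
  define b where "b d i = Complex (M d i $ 1 $ 1) (M d i $ 2 $ 1)" for d i
  have Q: "(Q \<longlongrightarrow> G) F" unfolding Q_def using tendsto_matrix_mult[OF tendsto_const P, of G] by simp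
  have R: "(R \<longlongrightarrow> matrix_inv G) F"
    unfolding R_def using tendsto_matrix_mult[OF R1 tendsto_const, of G'] by (simp add: G'_def)
  have b: "((\<lambda>d. b d i) \<longlongrightarrow> a i) F" for i
  proof -
    have "((\<lambda>d. M d i) \<longlongrightarrow> mat 1 ** cmat (a i) ** mat 1) F"
      unfolding M_def by (intro tendsto_matrix_mult R1 B P)
    then have "((\<lambda>d. b d i) \<longlongrightarrow> Complex (cmat (a i) $ 1 $ 1) (cmat (a i) $ 2 $ 1)) F"
      unfolding b_def by (intro tendsto_Complex tendsto_entry) simp_all
    then show ?thesis by (simp add: cmat_def)
  qed
  have "eventually (\<lambda>d. det (B d j) - (t d)\<^sup>2 > 0) F"
    using order_tendstoD(1)[OF D, of 0] a by simp
  then have "eventually (\<lambda>d. Q d ** R d = mat 1 \<and> R d ** Q d = mat 1 \<and> (\<forall>i. A d i = Q d ** cmat (b d i) ** R d)) F"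
    using comm
  proof eventually_elim
    case (elim d)
    have s2: "(s d)\<^sup>2 = det (B d j) - (t d)\<^sup>2" "s d \<noteq> 0"
      using elim(1) a by (auto simp: s_def power_mult_distrib sgn_if)
    have BP: "B d j ** P d = P d ** cmat (Complex (t d) (s d))" and dP: "det (P d) \<noteq> 0"
      using conjugate_to_cmat[OF t_def[of d] s2 P_def[of d]] by auto
    note PP' = inv2_mult[OF dP]
    have Mj: "M d j = cmat (Complex (t d) (s d))"
      unfolding M_def matrix_mul_assoc[symmetric] BP by (simp add: matrix_mul_assoc PP')
    have Bc: "B d 1 ** B d 2 = B d 2 ** B d 1"
    proof -
      have "B d i ** B d k = G' ** A d i ** (G ** G') ** A d k ** G" for i k
        unfolding B_def by (simp only: matrix_mul_assoc)
      then have "B d i ** B d k = G' ** (A d i ** A d k) ** G" for i k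
        by (simp add: GG matrix_mul_assoc)
      then show ?thesis by (simp add: elim(2))
    qed
    have Bij: "B d i ** B d k = B d k ** B d i" for i k
      using exhaust_2[of i] exhaust_2[of k] Bc by auto
    have MM: "M d i ** M d k = inv2 (P d) ** (B d i ** B d k) ** P d" for i k
    proof -
      have "M d i ** M d k = inv2 (P d) ** B d i ** (P d ** inv2 (P d)) ** B d k ** P d"
        unfolding M_def by (simp only: matrix_mul_assoc)
      then show ?thesis by (simp add: PP' matrix_mul_assoc)
    qed
    have M: "M d i = cmat (b d i)" for i
      unfolding b_def using s2(2) MM[of i j] MM[of j i] Bij[of i j]
      by (intro commute_cmat[of _ "Complex (t d) (s d)"]) (simp_all add: Mj)
    have "A d i = Q d ** cmat (b d i) ** R d" for i
    proof -
      have "Q d ** cmat (b d i) ** R d =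
          G ** (P d ** inv2 (P d)) ** G' ** A d i ** G ** (P d ** inv2 (P d)) ** G'"
        unfolding M[symmetric] M_def Q_def R_def B_def by (simp only: matrix_mul_assoc)
      also have "\<dots> = (G ** G') ** A d i ** (G ** G')" by (simp add: PP' matrix_mul_assoc)
      finally show ?thesis by (simp add: GG)
    qed
    moreover have "Q d ** R d = G ** (P d ** inv2 (P d)) ** G'" "R d ** Q d = inv2 (P d) ** (G' ** G) ** P d"
      unfolding Q_def R_def by (simp_all only: matrix_mul_assoc)
    then have "Q d ** R d = mat 1" "R d ** Q d = mat 1" by (simp_all add: PP' GG)
    ultimately show ?case by blast
  qed
  with Q R b show thesis by (rule that)
qed

definition colmat :: "(2 \<Rightarrow> complex) \<Rightarrow> real^2^2" where
  "colmat u = (\<chi> i k. ofC (u k) $ i)"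

lemma colmat_axis [simp]: "colmat u *v axis k 1 = ofC (u k)"
  by (simp add: vec_eq_iff colmat_def matrix_vector_mult_basis column_def)

lemma toC_colmat_lattice: "toC (colmat u *v lattice_vec \<gamma>) = of_int (\<gamma> $ 1) * u 1 + of_int (\<gamma> $ 2) * u 2"
  by (simp add: complex_eq_iff matrix_mult_vec_component colmat_def)

lemma colmat_columns: "colmat (\<lambda>k. toC (C *v axis k 1)) = C"
  by (rule matrix_eq_if_lattice_values) simp

lemma tendsto_colmat:
  assumes "\<And>k. ((\<lambda>d. u d k) \<longlongrightarrow> l k) F"
  shows "((\<lambda>d. colmat (u d)) \<longlongrightarrow> colmat l) F"
  unfolding colmat_def by (intro tendsto_vec_lambda tendsto_vec_nth tendsto_ofC assms)

section \<open>Maps near a linear development map\<close>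

lemma lattice_equivariant_from_generators:
  fixes E :: "real^2 \<Rightarrow> complex"
  assumes gen: "\<And>y i. E (y + axis i 1) = E y + k i"
  shows "E (y + lattice_vec \<gamma>) = E y + toC (colmat k *v lattice_vec \<gamma>)"
proof -
  have step: "E (y + of_int n *\<^sub>R axis i 1) = E y + of_int n * k i" for y i and n :: int
  proof (induction n rule: int_induct[of _ 0])
    case (step1 n)
    have "E (y + of_int (n + 1) *\<^sub>R axis i 1) = E ((y + of_int n *\<^sub>R axis i 1) + axis i 1)"
      by (simp add: algebra_simps)
    also have "\<dots> = E (y + of_int n *\<^sub>R axis i 1) + k i" by (rule gen)
    also have "\<dots> = E y + of_int (n + 1) * k i" by (simp add: step1(2) distrib_right)
    finally show ?case .
  next
    case (step2 n)
    have "E (y + of_int n *\<^sub>R axis i 1) = E ((y + of_int (n - 1) *\<^sub>R axis i 1) + axis i 1)"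
      by (simp add: algebra_simps)
    also have "\<dots> = E (y + of_int (n - 1) *\<^sub>R axis i 1) + k i" by (rule gen)
    finally have "E (y + of_int (n - 1) *\<^sub>R axis i 1) = E (y + of_int n *\<^sub>R axis i 1) - k i"
      by simp
    also have "\<dots> = E y + of_int (n - 1) * k i" by (simp add: step2(2) left_diff_distrib)
    finally show ?case .
  qed simp
  have "lattice_vec \<gamma> = of_int (\<gamma> $ 1) *\<^sub>R axis 1 1 + of_int (\<gamma> $ 2) *\<^sub>R axis 2 1"
    by (simp add: vec_eq_iff forall_2 axis_def)
  then have "E (y + lattice_vec \<gamma>) =
      E ((y + of_int (\<gamma> $ 1) *\<^sub>R axis 1 1) + of_int (\<gamma> $ 2) *\<^sub>R axis 2 1)"
    by (simp only: add.assoc)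
  then show ?thesis by (simp add: step toC_colmat_lattice)
qed

definition colv :: "real^2 \<Rightarrow> real^2 \<Rightarrow> real^2^2" where
  "colv u v = (\<chi> i k. if k = 1 then u $ i else v $ i)"

lemma matrix_mult_colv: "A ** colv u v = colv (A *v u) (A *v v)"
  by (simp add: vec_eq_iff forall_2 matrix_mult_component matrix_mult_vec_component colv_def)

lemma tendsto_colv:
  assumes "(u \<longlongrightarrow> u0) F" "(v \<longlongrightarrow> v0) F"
  shows "((\<lambda>d. colv (u d) (v d)) \<longlongrightarrow> colv u0 v0) F"
proof (rule tendsto_matrixI)
  fix i k :: 2
  show "((\<lambda>d. colv (u d) (v d) $ i $ k) \<longlongrightarrow> colv u0 v0 $ i $ k) F"
    using assms by (cases "k = 1") (auto simp: colv_def intro: tendsto_vec_nth)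
qed

lemma det_colv_complex: "det (colv (ofC 1) (ofC z)) = Im z"
  by (simp add: det_2 colv_def)

lemma near_one_not_nonpos: "norm (z - 1 :: complex) < 1 \<Longrightarrow> z \<notin> \<real>\<^sub>\<le>\<^sub>0"
proof
  assume "norm (z - 1) < 1" "z \<in> \<real>\<^sub>\<le>\<^sub>0"
  then have "Re z \<le> 0" by (auto simp: complex_nonpos_Reals_iff)
  moreover have "\<bar>Re (z - 1)\<bar> < 1"
    using abs_Re_le_cmod[of "z - 1"] \<open>norm (z - 1) < 1\<close> by linarith
  ultimately show False by simp
qed

text \<open>
  The holonomy of \<open>g d\<close> is determined by the values at \<open>0\<close> and \<open>e\<^sub>j\<close> and their translates, so it converges to the
  holonomy of the limit and is conjugate to a complex one. Straightening \<open>g d\<close> by this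
  conjugation gives a map with a logarithm \<open>E\<close>, which is equivariant. On a convex set that
  contains the basis vectors, the values of the straightened map are so close to those of \<open>lexp C\<close> that the principal
  logarithm \<open>Ln\<close> of the quotient is continuous; it shows that the translations for \<open>E\<close> converge to those for \<open>C\<close>.
\<close>

lemma near_linear_development:
  fixes g :: "'d \<Rightarrow> real^2 \<Rightarrow> real^2" and F :: "'d filter" and A :: "'d \<Rightarrow> 2 \<Rightarrow> real^2^2"
  assumes C: "invertible C" and j: "Im (lexp C (axis j 1)) \<noteq> 0" and G: "invertible G"
    and cont: "\<And>d. continuous_on UNIV (g d)" and nz: "\<And>d y. g d y \<noteq> 0"
    and loc: "\<And>d y. local_diffeo_at (g d) y"
    and hol: "\<And>d i y. g d (y + axis i 1) = A d i *v g d y"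
    and lim: "uniform_limit (cball 0 3) g (\<lambda>y. G *v ofC (lexp C y)) F"
    and N: "open N" "C \<in> N"
  shows "eventually (\<lambda>d. \<exists>C'\<in>N. \<exists>Q \<psi>. invertible C' \<and> invertible Q \<and> \<psi> \<in> Diff1_lifts \<and>
           (\<forall>y. g d y = Q *v ofC (lexp C' (\<psi> y)))) F"
proof -
  let ?K = "cball (0 :: real^2) 3"
  define g0 where "g0 y = G *v ofC (lexp C y)" for y
  define a where "a i = lexp C (axis i 1)" for i
  define M where "M i = G ** cmat (a i) ** matrix_inv G" for i
  have n1: "norm (axis i 1 :: real^2) = 1" for i by simp
  have K: "0 \<in> ?K" "axis i 1 \<in> ?K" "axis i 1 + axis k 1 \<in> ?K" for i k
    using norm_triangle_ineq[of "axis i 1 :: real^2" "axis k 1"] n1 by auto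
  have pt: "((\<lambda>d. g d y) \<longlongrightarrow> g0 y) F" if "y \<in> ?K" for y
    unfolding g0_def by (rule tendsto_uniform_limitI[OF lim that])
  have g0_add: "g0 (y + axis i 1) = M i *v g0 y" for y i
    using G by (simp add: g0_def M_def a_def lexp_add mult_ac flip: matrix_vector_mul_assoc)
  \<comment> \<open>The values of the limit at \<open>0\<close> and \<open>e\<^sub>j\<close> are linearly independent since \<open>exp (C e\<^sub>j)\<close> is not real.\<close>
  define X where "X d = colv (g d 0) (g d (axis j 1))" for d
  define Y where "Y d i = colv (g d (axis i 1)) (g d (axis j 1 + axis i 1))" for d i
  define X0 where "X0 = colv (g0 0) (g0 (axis j 1))"
  have X: "(X \<longlongrightarrow> X0) F" unfolding X_def X0_def by (intro tendsto_colv pt K)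
  have Y: "((\<lambda>d. Y d i) \<longlongrightarrow> M i ** X0) F" for i
  proof -
    have "M i ** X0 = colv (g0 (axis i 1)) (g0 (axis j 1 + axis i 1))"
      using g0_add[of 0 i] g0_add[of "axis j 1" i] by (simp add: X0_def matrix_mult_colv)
    then show ?thesis unfolding Y_def by (simp only:) (intro tendsto_colv pt K)
  qed
  have "X0 = G ** colv (ofC 1) (ofC (a j))" by (simp add: X0_def g0_def a_def matrix_mult_colv)
  then have dX0: "det X0 \<noteq> 0"
    using G j by (simp add: det_mul det_colv_complex a_def invertible_det_nz)
  have AX: "A d i ** X d = Y d i" for d i
    using hol[of d 0 i] hol[of d "axis j 1" i] by (simp add: X_def Y_def matrix_mult_colv)
  have evX: "eventually (\<lambda>d. det (X d) \<noteq> 0) F"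
    using tendsto_imp_eventually_ne[OF tendsto_det[OF X] dX0] .
  have A: "((\<lambda>d. A d i) \<longlongrightarrow> M i) F" for i
  proof (rule Lim_transform_eventually)
    have "((\<lambda>d. Y d i ** inv2 (X d)) \<longlongrightarrow> M i ** X0 ** inv2 X0) F"
      by (intro tendsto_matrix_mult Y tendsto_inv2 X dX0)
    then show "((\<lambda>d. Y d i ** inv2 (X d)) \<longlongrightarrow> M i) F"
      using inv2_mult(1)[OF dX0] by (simp flip: matrix_mul_assoc)
    show "eventually (\<lambda>d. Y d i ** inv2 (X d) = A d i) F"
      using evX by eventually_elim (simp add: inv2_mult flip: AX matrix_mul_assoc)
  qed
  have comm: "eventually (\<lambda>d. A d 1 ** A d 2 = A d 2 ** A d 1) F"
    using evX
  proof eventually_elim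
    case (elim d)
    have "A d 1 *v (A d 2 *v g d y) = A d 2 *v (A d 1 *v g d y)" for y
      unfolding hol[symmetric] by (simp add: add_ac)
    then have "(A d 1 ** A d 2) ** X d = (A d 2 ** A d 1) ** X d"
      unfolding X_def matrix_mult_colv by (simp add: matrix_vector_mul_assoc)
    then have "(A d 1 ** A d 2) ** (X d ** inv2 (X d)) = (A d 2 ** A d 1) ** (X d ** inv2 (X d))"
      by (simp only: matrix_mul_assoc)
    then show ?case by (simp add: inv2_mult(1)[OF elim])
  qed
  have aj: "Im (a j) \<noteq> 0" using j by (simp add: a_def)
  obtain Q R b where R: "(R \<longlongrightarrow> matrix_inv G) F"
    and QR: "eventually (\<lambda>d. Q d ** R d = mat 1 \<and> R d ** Q d = mat 1 \<and>
        (\<forall>i. A d i = Q d ** cmat (b d i) ** R d)) F"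
    by (rule commuting_near_complex[of G a j A F, OF G aj _ comm]) (use A M_def in auto)
  \<comment> \<open>\<open>R d\<close> straightens \<open>g d\<close>, and \<open>r d\<close> tends to \<open>1\<close> uniformly on the compact set.\<close>
  define r where "r d y = toC (R d *v g d y) / lexp C y" for d y
  have g0_cont: "continuous_on ?K g0"
    unfolding g0_def
    by (intro linear_continuous_on_compose[OF continuous_on_ofC[OF continuous_on_lexp]]
        matrix_vector_mul_linear)
  have "uniform_limit ?K (\<lambda>d y. R d *v g d y) (\<lambda>y. matrix_inv G *v g0 y) F"
  proof (rule bounded_bilinear.bounded_uniform_limit[OF bounded_bilinear_matrix_vector_mult])
    show "uniform_limit ?K (\<lambda>d y. R d) (\<lambda>y. matrix_inv G) F"
      using R by (auto simp: uniform_limit_iff tendsto_iff elim: eventually_mono)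
    show "uniform_limit ?K g g0 F" using lim by (simp add: g0_def[abs_def])
    show "bounded (g0 ` ?K)"
      by (intro compact_imp_bounded compact_continuous_image g0_cont compact_cball)
    show "bounded ((\<lambda>y. matrix_inv G) ` ?K)"
      by (rule finite_imp_bounded) (auto intro: finite_subset[of _ "{matrix_inv G}"])
  qed
  then have ul: "uniform_limit ?K (\<lambda>d y. R d *v g d y) (\<lambda>y. ofC (lexp C y)) F"
    using G by (simp add: g0_def)
  have r1: "((\<lambda>d. r d y) \<longlongrightarrow> 1) F" if "y \<in> ?K" for y
  proof -
    have "((\<lambda>d. toC (R d *v g d y) / lexp C y) \<longlongrightarrow> toC (ofC (lexp C y)) / lexp C y) F"
      by (intro tendsto_divide tendsto_toC tendsto_uniform_limitI[OF ul that] tendsto_const) simp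
    then show ?thesis by (simp add: r_def)
  qed
  obtain m where m: "m > 0" "\<And>y. y \<in> ?K \<Longrightarrow> m \<le> norm (lexp C y)"
  proof -
    have "continuous_on ?K (\<lambda>y. norm (lexp C y))"
      by (intro continuous_on_norm continuous_on_lexp)
    then obtain y0 where "y0 \<in> ?K" "\<forall>y\<in>?K. norm (lexp C y0) \<le> norm (lexp C y)"
      using continuous_attains_inf[OF compact_cball, of 0 3 "\<lambda>y. norm (lexp C y)"] K(1) by blast
    then show thesis by (intro that[of "norm (lexp C y0)"]) auto
  qed
  have r_near: "eventually (\<lambda>d. \<forall>y\<in>?K. norm (r d y - 1) < 1) F"
    using uniform_limitD[OF ul m(1)]
  proof eventually_elim
    case (elim d)
    show ?case
    proof
      fix y assume y: "y \<in> ?K"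
      have "norm (toC (R d *v g d y) - lexp C y) = norm (toC (R d *v g d y - ofC (lexp C y)))"
        by simp
      also have "\<dots> < m" using elim y by (simp add: dist_norm del: toC_simps)
      also have "m \<le> norm (lexp C y)" using m(2) y by blast
      finally have "norm (toC (R d *v g d y) - lexp C y) < norm (lexp C y)" .
      moreover have "r d y - 1 = (toC (R d *v g d y) - lexp C y) / lexp C y"
        by (simp add: r_def diff_divide_distrib)
      ultimately show "norm (r d y - 1) < 1" by (simp add: norm_divide)
    qed
  qed
  define c where "c d i = toC (C *v axis i 1) + Ln (r d (axis i 1)) - Ln (r d 0)" for d i
  have "((\<lambda>d. c d i) \<longlongrightarrow> toC (C *v axis i 1)) F" for i
  proof -
    have "((\<lambda>d. c d i) \<longlongrightarrow> toC (C *v axis i 1) + Ln 1 - Ln 1) F"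
      unfolding c_def by (intro tendsto_intros r1 K) auto
    then show ?thesis by simp
  qed
  then have C'lim: "((\<lambda>d. colmat (c d)) \<longlongrightarrow> C) F"
    using tendsto_colmat[of c "\<lambda>i. toC (C *v axis i 1)" F] by (simp only: colmat_columns)
  have "det C \<noteq> 0" using C by (simp add: invertible_det_nz)
  then have evinv: "eventually (\<lambda>d. det (colmat (c d)) \<noteq> 0) F"
    by (rule tendsto_imp_eventually_ne[OF tendsto_det[OF C'lim]])
  have evN: "eventually (\<lambda>d. colmat (c d) \<in> N) F" by (rule topological_tendstoD[OF C'lim N])
  show ?thesis
    using QR r_near evinv evN
  proof eventually_elim
    case (elim d)
    have QR: "Q d ** R d = mat 1" "R d ** Q d = mat 1" "\<And>i. A d i = Q d ** cmat (b d i) ** R d"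
      using elim(1) by auto
    have invQ: "invertible (Q d)" and invR: "invertible (R d)"
      unfolding invertible_def using QR by blast+
    have C': "invertible (colmat (c d))" using elim(3) by (simp add: invertible_det_nz)
    define W where "W y = toC (R d *v g d y)" for y
    have W0: "W y \<noteq> 0" for y
      using nz[of d y] invR unfolding W_def by (metis invertible_mult_vec_eq_0 toC_eq_iff toC_simps(1))
    have Wadd: "W (y + axis i 1) = b d i * W y" for y i
    proof -
      have "R d *v g d (y + axis i 1) = (R d ** Q d) *v (cmat (b d i) *v (R d *v g d y))"
        unfolding hol QR(3) by (simp only: matrix_vector_mul_assoc matrix_mul_assoc)
      then show ?thesis by (simp add: W_def QR(2))
    qed
    have Wcont: "continuous_on UNIV W"
      unfolding W_def
      by (intro continuous_on_toC linear_continuous_on_compose[OF cont] matrix_vector_mul_linear)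
    obtain E where E: "continuous_on UNIV E" "\<And>y. y \<in> UNIV \<Longrightarrow> W y = exp (E y)"
      by (rule continuous_logarithm_on_contractible[OF Wcont _ W0])
         (auto intro: convex_imp_contractible)
    define k where "k i = E (axis i 1) - E 0" for i
    have Egen: "E (y + axis i 1) = E y + k i" for y i
    proof -
      have "continuous_on UNIV (\<lambda>y. E (y + axis i 1) - E y)"
        by (intro continuous_intros E(1) continuous_on_compose2[OF E(1)]) auto
      moreover have "exp (E (y + axis i 1) - E y) = b d i" for y
        using Wadd[of y i] E(2) by (simp add: exp_diff)
      ultimately have "E (y + axis i 1) - E y = E (0 + axis i 1) - E 0"
        by (rule continuous_exp_constant[OF connected_UNIV _ _ UNIV_I UNIV_I])
      then show ?thesis by (simp add: k_def algebra_simps)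
    qed
    have "k i = c d i" for i
    proof -
      have rnz: "r d y \<notin> \<real>\<^sub>\<le>\<^sub>0" if "y \<in> ?K" for y using elim(2) that near_one_not_nonpos by blast
      have rcont: "continuous_on ?K (r d)"
      proof -
        have "r d = (\<lambda>y. W y / lexp C y)" by (simp add: r_def W_def fun_eq_iff)
        then show ?thesis
          using continuous_on_subset[OF Wcont] continuous_on_lexp
          by (auto intro!: continuous_on_divide)
      qed
      have "E (axis i 1) - toC (C *v axis i 1) - Ln (r d (axis i 1)) = E 0 - toC (C *v 0) - Ln (r d 0)"
      proof (rule continuous_exp_constant[of ?K "\<lambda>y. E y - toC (C *v y) - Ln (r d y)" 1])
        show "continuous_on ?K (\<lambda>y. E y - toC (C *v y) - Ln (r d y))"
          by (intro continuous_on_diff continuous_on_subset[OF E(1)] continuous_on_toC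
              linear_continuous_on matrix_vector_mul_bounded_linear continuous_on_Ln' rcont rnz) auto
        fix y assume y: "y \<in> ?K"
        have "r d y \<noteq> 0" using rnz[OF y] by auto
        then show "exp (E y - toC (C *v y) - Ln (r d y)) = 1"
          using E(2)[of y] by (simp add: exp_diff r_def W_def lexp_def)
      qed (use K in auto)
      then show ?thesis by (simp add: k_def c_def algebra_simps)
    qed
    then have "k = c d" by (rule ext)
    then have Eequi: "E (y + lattice_vec \<gamma>) = E y + toC (colmat (c d) *v lattice_vec \<gamma>)" for y \<gamma>
      using lattice_equivariant_from_generators[of E k, OF Egen] by simp
    have "(\<lambda>y. ofC (exp (E y))) = (\<lambda>y. R d *v g d y)" using E(2) by (simp add: fun_eq_iff W_def flip: E(2))
    then have "local_diffeo_at (\<lambda>y. ofC (exp (E y))) y" for y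
      using local_diffeo_at_compose[OF loc local_diffeo_at_matrix[OF invR]] by simp
    then obtain \<psi> where \<psi>: "\<psi> \<in> Diff1_lifts" "\<And>y. exp (E y) = lexp (colmat (c d)) (\<psi> y)"
      using equivariant_logarithm_linear[OF E(1) _ C' Eequi] by metis
    have "g d y = Q d *v ofC (lexp (colmat (c d)) (\<psi> y))" for y
    proof -
      have "ofC (lexp (colmat (c d)) (\<psi> y)) = R d *v g d y"
        by (simp add: W_def flip: \<psi>(2) E(2))
      then show ?thesis by (simp add: matrix_vector_mul_assoc QR(1))
    qed
    then show ?case using elim(4) C' invQ \<psi>(1) by (intro bexI[of _ "colmat (c d)"] exI conjI allI)
  qed
qed

section \<open>The space of development maps\<close>

lemma openin_Cinf_nbhd:
  assumes "f \<in> Cinf_maps M" "compact K" "(V, c) \<in> atlas M" "f ` K \<subseteq> V" "\<epsilon> > 0"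
  shows "openin (compact_Cinf_topology M) (Cinf_nbhd M f K V c r \<epsilon>)"
  unfolding compact_Cinf_topology_def
  by (rule topology_generated_by_Basis, rule CollectI, rule exI[of _ f], rule exI[of _ K],
      rule exI[of _ V], rule exI[of _ c], rule exI[of _ r], rule exI[of _ \<epsilon>])
     (use assms in simp)

lemma topspace_Dev_topology: "topspace (Dev_topology PP) = Dev PP"
proof -
  have "D \<in> topspace (compact_Cinf_topology PP)" if "D \<in> Dev PP" for D
  proof -
    have D: "D \<in> Cinf_maps PP" using that Dev_subset_Cinf_maps by auto
    have "(axis 1 1 :: real^2) \<noteq> 0" by (simp add: axis_eq_0_iff)
    note Vc = chart_PP_at[OF this]
    have "openin (compact_Cinf_topology PP) (Cinf_nbhd PP D {} (pj ` ball (axis 1 1) (norm (axis 1 1 :: real^2)))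
        (the_inv_into (ball (axis 1 1) (norm (axis 1 1 :: real^2))) pj) 0 1)"
      by (rule openin_Cinf_nbhd[OF D _ Vc]) auto
    moreover have "D \<in> Cinf_nbhd PP D {} (pj ` ball (axis 1 1) (norm (axis 1 1 :: real^2)))
        (the_inv_into (ball (axis 1 1) (norm (axis 1 1 :: real^2))) pj) 0 1"
      using D by (simp add: Cinf_nbhd_def)
    ultimately show ?thesis using openin_subset by (metis subsetD)
  qed
  then show ?thesis unfolding Dev_topology_def by auto
qed

text \<open>
  Neighbourhoods of order \<open>0\<close> suffice. In the charts on the balls about \<open>f x\<close> of radius \<open>norm (f x)\<close>,
  nearness of \<open>D'\<close> means that one of its two lifts is close to \<open>f\<close> at each point of \<open>K\<close>. If the distance is
  smaller than the minimum of \<open>norm (f x)\<close>, this cannot hold for both lifts at a point, and it is the same lift everywhere because \<open>K\<close>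
  is connected.
\<close>

lemma uniformly_near_lift:
  assumes D: "(\<lambda>x. pj (f x)) \<in> Dev PP" and f: "continuous_on UNIV f" "\<And>x. f x \<noteq> 0"
    and K: "compact K" "connected K" "K \<noteq> {}" and \<epsilon>: "\<epsilon> > 0"
  shows "\<exists>T. openin (Dev_topology PP) T \<and> (\<lambda>x. pj (f x)) \<in> T \<and>
    (\<forall>D'\<in>T. \<exists>f'. continuous_on UNIV f' \<and> (\<forall>x. f' x \<noteq> 0) \<and> D' = (\<lambda>x. pj (f' x)) \<and>
       (\<forall>x\<in>K. dist (f' x) (f x) < \<epsilon>))"
proof -
  define D where "D = (\<lambda>x. pj (f x))"
  have D_in: "D \<in> Dev PP" "D \<in> Cinf_maps PP" using D Dev_subset_Cinf_maps by (auto simp: D_def)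
  obtain x0 where x0: "x0 \<in> K" "\<And>x. x \<in> K \<Longrightarrow> norm (f x0) \<le> norm (f x)"
    using continuous_attains_inf[OF K(1,3), of "\<lambda>x. norm (f x)"] continuous_on_subset[OF f(1)]
    by (metis continuous_on_norm subset_UNIV)
  define \<delta> where "\<delta> = min \<epsilon> (norm (f x0))"
  have \<delta>: "\<delta> > 0" "\<delta> \<le> \<epsilon>" "\<And>x. x \<in> K \<Longrightarrow> \<delta> \<le> norm (f x)"
    using \<epsilon> f(2) x0(2) by (auto simp: \<delta>_def intro: min.coboundedI2)
  let ?B = "\<lambda>x. ball (f x) (norm (f x))"
  have "\<exists>r>0. f ` cball x r \<subseteq> ?B x" for x
  proof -
    have "open (f -` ?B x)" using f(1) by (intro open_vimage) auto
    moreover have "x \<in> f -` ?B x" using f(2) by simp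
    ultimately obtain r where "r > 0" "cball x r \<subseteq> f -` ?B x" using open_contains_cball by metis
    then show ?thesis by (intro exI[of _ r]) auto
  qed
  then obtain r where r: "\<And>x. r x > 0" "\<And>x. f ` cball x (r x) \<subseteq> ?B x" by metis
  have "K \<subseteq> (\<Union>x\<in>K. ball x (r x))" using r(1) by force
  then obtain X where X: "X \<subseteq> K" "finite X" "K \<subseteq> (\<Union>x\<in>X. ball x (r x))"
    using compactE_image[OF K(1), of K "\<lambda>x. ball x (r x)"] by auto
  have "X \<noteq> {}" using X(3) K(3) by auto
  define Nb where "Nb x = Cinf_nbhd PP D (cball x (r x)) (pj ` ?B x) (the_inv_into (?B x) pj) 0 \<delta>" for x
  have sub: "D ` cball x (r x) \<subseteq> pj ` ?B x" for x
    unfolding D_def using r(2)[of x] by (auto simp: image_subset_iff)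
  have Nb: "openin (compact_Cinf_topology PP) (Nb x)" "D \<in> Nb x" for x
  proof -
    show "openin (compact_Cinf_topology PP) (Nb x)"
      unfolding Nb_def by (rule openin_Cinf_nbhd[OF D_in(2) compact_cball chart_PP_at[OF f(2)] sub \<delta>(1)])
    show "D \<in> Nb x"
      unfolding Nb_def Cinf_nbhd_def using D_in(2) sub \<delta>(1) by simp
  qed
  define T where "T = (\<Inter>x\<in>X. Nb x) \<inter> Dev PP"
  have "openin (compact_Cinf_topology PP) (\<Inter>x\<in>X. Nb x)"
    using X(2) \<open>X \<noteq> {}\<close> Nb(1) by (rule openin_INT2)
  then have "openin (Dev_topology PP) T" unfolding T_def Dev_topology_def openin_subtopology by blast
  moreover have "(\<lambda>x. pj (f x)) \<in> T" using Nb(2) D_in(1) by (simp add: T_def D_def)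
  moreover have "\<exists>f'. continuous_on UNIV f' \<and> (\<forall>x. f' x \<noteq> 0) \<and> D' = (\<lambda>x. pj (f' x)) \<and>
       (\<forall>x\<in>K. dist (f' x) (f x) < \<epsilon>)" if D': "D' \<in> T" for D'
  proof -
    have "D' \<in> Cinf_maps PP" using D' Dev_subset_Cinf_maps by (auto simp: T_def)
    then obtain E where E: "continuous_on UNIV E" "D' = (\<lambda>x. pj (ofC (exp (E x))))"
      by (rule Cinf_maps_PP_lift)
    define h where "h x = ofC (exp (E x))" for x
    have h: "continuous_on UNIV h" "\<And>x. h x \<noteq> 0" "D' = (\<lambda>x. pj (h x))"
      using E by (auto simp: h_def intro!: continuous_intros)
    have near: "dist (h y) (f y) < \<delta> \<or> dist (- h y) (f y) < \<delta>" if y: "y \<in> K" for y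
    proof -
      obtain x where x: "x \<in> X" "y \<in> ball x (r x)" using X(3) y by auto
      let ?c = "the_inv_into (?B x) pj"
      have yc: "y \<in> cball x (r x)" using x(2) by simp
      have "D' \<in> Nb x" using D' x(1) by (simp add: T_def)
      then have *: "D' ` cball x (r x) \<subseteq> pj ` ?B x"
        "\<And>y js. y \<in> cball x (r x) \<Longrightarrow> length js \<le> 0 \<Longrightarrow>
           norm (iter_pderiv js (?c \<circ> D') y - iter_pderiv js (?c \<circ> D) y) < \<delta>"
        unfolding Nb_def Cinf_nbhd_def by auto
      have n: "norm (?c (D' y) - ?c (D y)) < \<delta>" using *(2)[OF yc, of "[]"] by simp
      have "f y \<in> ?B x" using r(2)[of x] yc by blast
      then have "?c (D y) = f y" unfolding D_def by (rule chart_PP_at_apply)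
      moreover obtain w where w: "w \<in> ?B x" "D' y = pj w" using *(1) yc by blast
      then have "?c (D' y) = w" using chart_PP_at_apply by simp
      moreover have "w = h y \<or> w = - h y" using w(2) h(3) by (simp add: pj_eq_iff)
      ultimately show ?thesis using n by (auto simp: dist_norm)
    qed
    have excl: "\<not> (dist (h y) (f y) < \<delta> \<and> dist (- h y) (f y) < \<delta>)" if "y \<in> K" for y
    proof
      assume "dist (h y) (f y) < \<delta> \<and> dist (- h y) (f y) < \<delta>"
      then have "norm ((h y - f y) + (- h y - f y)) < \<delta> + \<delta>"
        unfolding dist_norm by (intro norm_add_less) auto
      moreover have "(h y - f y) + (- h y - f y) = - (2 *\<^sub>R f y)" by (simp add: scaleR_2)
      ultimately have "norm (f y) < \<delta>" by simp
      then show False using \<delta>(3)[OF that] by simp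
    qed
    define U1 where "U1 = {y. dist (h y) (f y) < \<delta>}"
    define U2 where "U2 = {y. dist (- h y) (f y) < \<delta>}"
    have "open U1" "open U2" unfolding U1_def U2_def
      by (intro open_Collect_less continuous_intros h(1) f(1))+
    moreover have "U1 \<inter> U2 \<inter> K = {}" using excl by (auto simp: U1_def U2_def)
    moreover have "K \<subseteq> U1 \<union> U2" using near by (auto simp: U1_def U2_def)
    ultimately consider "U1 \<inter> K = {}" | "U2 \<inter> K = {}" using connectedD[OF K(2)] by metis
    then show ?thesis
    proof cases
      case 1
      have "dist (- h y) (f y) < \<epsilon>" if "y \<in> K" for y
        using 1 near[OF that] that \<delta>(2) by (auto simp: U1_def)
      then show ?thesis using h by (intro exI[of _ "\<lambda>x. - h x"]) (auto intro: continuous_intros)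
    next
      case 2
      have "dist (h y) (f y) < \<epsilon>" if "y \<in> K" for y
        using 2 near[OF that] that \<delta>(2) by (auto simp: U2_def)
      then show ?thesis using h by (intro exI[of _ h]) auto
    qed
  qed
  ultimately show ?thesis by (intro exI[of _ T] conjI ballI)
qed

text \<open>
  The holonomy determines the matrix up to sign, and the sign is constant along the connected plane.
\<close>

lemma lifted_holonomy:
  assumes f: "continuous_on UNIV f" "\<And>x. f x \<noteq> 0" and h: "is_holonomy PP (\<lambda>x. pj (f x)) h"
  shows "\<exists>A. \<forall>x. f (x + lattice_vec \<gamma>) = A *v f x"
proof -
  have "h \<gamma> \<in> carrier PGL2" using h by (auto simp: is_holonomy_def hom_def int_lattice_def)
  then obtain A where A: "invertible A" "h \<gamma> = mclass A" by (rule PGL2_cases)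
  have "pj (f (x + lattice_vec \<gamma>)) = pj (A *v f x)" for x
    using h unfolding is_holonomy_def by (simp add: A(2))
  then have or: "f (x + lattice_vec \<gamma>) = A *v f x \<or> f (x + lattice_vec \<gamma>) = - (A *v f x)" for x
    by (metis minus_equation_iff pj_eq_iff)
  define U1 where "U1 = {x. f (x + lattice_vec \<gamma>) \<noteq> A *v f x}"
  define U2 where "U2 = {x. f (x + lattice_vec \<gamma>) \<noteq> - (A *v f x)}"
  have c: "continuous_on UNIV (\<lambda>x. f (x + lattice_vec \<gamma>))"
    by (intro continuous_on_compose2[OF f(1)] continuous_intros) auto
  have cA: "continuous_on UNIV (\<lambda>x. A *v f x)"
    by (intro linear_continuous_on_compose[OF f(1)] matrix_vector_mul_linear)
  have "open U1" "open U2" unfolding U1_def U2_def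
    by (intro open_Collect_neq c cA continuous_intros)+
  moreover have "U1 \<inter> U2 \<inter> UNIV = {}" using or by (auto simp: U1_def U2_def)
  moreover have "UNIV \<subseteq> U1 \<union> U2"
  proof
    fix x
    have "A *v f x \<noteq> 0" using f(2)[of x] A(1) by simp
    then have "A *v f x \<noteq> - (A *v f x)" by (simp add: eq_neg_iff_add_eq_0 flip: scaleR_2)
    then show "x \<in> U1 \<union> U2" by (auto simp: U1_def U2_def)
  qed
  ultimately consider "U1 = {}" | "U2 = {}" using connectedD[OF connected_UNIV] by (metis Int_UNIV_right)
  then show ?thesis
  proof cases
    case 1
    then show ?thesis by (intro exI[of _ A]) (auto simp: U1_def)
  next
    case 2
    then show ?thesis by (intro exI[of _ "- A"]) (auto simp: U2_def)
  qed
qed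

text \<open>
  A development map in one of the classes is \<open>lin_dev C\<close> up to a matrix \<open>G\<close> and a diffeomorphism \<open>\<phi>\<close>. The
  lift of a nearby map is uniformly close on the compact set \<open>\<phi>' ` cball 0 3\<close>, and \<open>near_linear_development\<close>
  applies to its composition with the inverse \<open>\<phi>'\<close> of \<open>\<phi>\<close>.
\<close>

lemma lin_dev_classes_open:
  assumes N: "open N" "\<And>C. C \<in> N \<Longrightarrow> invertible C" "\<And>C. C \<in> N \<Longrightarrow> Im (lexp C (axis j 1)) \<noteq> 0"
  shows "openin (deformation_space PP) ((\<lambda>C. dev_class PP (lin_dev C)) ` N)"
  unfolding deformation_space_def openin_quot_topology topspace_Dev_topology
proof
  show "(\<lambda>C. dev_class PP (lin_dev C)) ` N \<subseteq> dev_class PP ` Dev PP"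
    using lin_dev_in_Dev N(2) by auto
  let ?S = "{D \<in> Dev PP. dev_class PP D \<in> (\<lambda>C. dev_class PP (lin_dev C)) ` N}"
  show "openin (Dev_topology PP) ?S"
  proof (subst openin_subopen, rule ballI)
    fix D assume D_in: "D \<in> ?S"
    then obtain C where C: "C \<in> N" "dev_class PP D = dev_class PP (lin_dev C)" and D_Dev: "D \<in> Dev PP"
      by auto
    obtain E0 where E0: "D = (\<lambda>x. pj (ofC (exp (E0 x))))"
      using D_Dev Dev_subset_Cinf_maps Cinf_maps_PP_lift by (metis subsetD)
    have "D \<in> dev_class PP D" unfolding E0 by (rule in_dev_class_PP_self)
    then have "D \<in> dev_class PP (\<lambda>x. pj (ofC (lexp C x)))" using C(2) by (simp add: lin_dev_def)
    then obtain G \<phi> where D: "D = (\<lambda>x. pj (G *v ofC (lexp C (\<phi> x))))" and G: "invertible G"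
      and \<phi>: "\<phi> \<in> Diff1_lifts"
      unfolding in_dev_class_PP_iff by (elim exE conjE)
    obtain \<phi>' where \<phi>': "\<phi>' \<in> Diff1_lifts" "\<And>x. \<phi>' (\<phi> x) = x" "\<And>x. \<phi> (\<phi>' x) = x"
      using Diff1_lifts_inverse[OF \<phi>] by metis
    define f where "f x = G *v ofC (lexp C (\<phi> x))" for x
    have Df: "D = (\<lambda>x. pj (f x))" unfolding D f_def ..
    have f: "continuous_on UNIV f" "\<And>x. f x \<noteq> 0"
    proof -
      show "f x \<noteq> 0" for x using G by (simp add: f_def)
      show "continuous_on UNIV f" unfolding f_def
        by (intro linear_continuous_on_compose[OF continuous_on_ofC] matrix_vector_mul_linear
            continuous_on_compose2[OF continuous_on_lexp Diff1_lifts_continuous[OF \<phi>]]) auto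
    qed
    define K where "K = \<phi>' ` cball 0 3"
    have K: "compact K" "connected K" "K \<noteq> {}" unfolding K_def
      using continuous_on_subset[OF Diff1_lifts_continuous[OF \<phi>'(1)] subset_UNIV]
      by (auto intro: compact_continuous_image connected_continuous_image)
    \<comment> \<open>If no \<open>\<epsilon>\<close> works, there are lifts outside which converge uniformly on \<open>K\<close> to \<open>f\<close>.\<close>
    have "\<exists>\<epsilon>>0. \<forall>f'. continuous_on UNIV f' \<longrightarrow> (\<forall>x. f' x \<noteq> 0) \<longrightarrow> (\<lambda>x. pj (f' x)) \<in> Dev PP \<longrightarrow>
        (\<forall>x\<in>K. dist (f' x) (f x) < \<epsilon>) \<longrightarrow> (\<lambda>x. pj (f' x)) \<in> ?S"
    proof (rule ccontr)
      assume neg: "\<not> ?thesis"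
      have "\<exists>f'. continuous_on UNIV f' \<and> (\<forall>x. f' x \<noteq> 0) \<and> (\<lambda>x. pj (f' x)) \<in> Dev PP \<and>
        (\<forall>x\<in>K. dist (f' x) (f x) < inverse (real (Suc n))) \<and> (\<lambda>x. pj (f' x)) \<notin> ?S" for n
      proof -
        have "inverse (real (Suc n)) > 0" by simp
        with neg show ?thesis by meson
      qed
      then have "\<exists>fs. \<forall>n. continuous_on UNIV (fs n) \<and> (\<forall>x. fs n x \<noteq> 0) \<and> (\<lambda>x. pj (fs n x)) \<in> Dev PP \<and>
        (\<forall>x\<in>K. dist (fs n x) (f x) < inverse (real (Suc n))) \<and> (\<lambda>x. pj (fs n x)) \<notin> ?S"
        by (intro choice allI)
      then obtain fs where fs_all: "\<forall>n. continuous_on UNIV (fs n) \<and> (\<forall>x. fs n x \<noteq> 0) \<and> (\<lambda>x. pj (fs n x)) \<in> Dev PP \<and>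
        (\<forall>x\<in>K. dist (fs n x) (f x) < inverse (real (Suc n))) \<and> (\<lambda>x. pj (fs n x)) \<notin> ?S"
        by (elim exE)
      have fs: "\<And>n. continuous_on UNIV (fs n)" "\<And>n x. fs n x \<noteq> 0"
        "\<And>n. (\<lambda>x. pj (fs n x)) \<in> Dev PP" "\<And>n x. x \<in> K \<Longrightarrow> dist (fs n x) (f x) < inverse (real (Suc n))"
        "\<And>n. (\<lambda>x. pj (fs n x)) \<notin> ?S"
        using spec[OF fs_all] by (simp_all only: simp_thms)
      have loc: "local_diffeo_at (fs n) x" for n x
        using fs(3)[of n] local_diffeo_PP_lift_iff[OF fs(1,2), of n] by (simp add: Dev_def)
      have "\<exists>A. \<forall>x. fs n (x + axis i 1) = A *v fs n x" for n i
      proof -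
        obtain h where h: "is_holonomy PP (\<lambda>x. pj (fs n x)) h"
          using fs(3)[of n] by (auto simp: Dev_def)
        show ?thesis using lifted_holonomy[OF fs(1,2) h, of "axis i 1"] by simp
      qed
      then have "\<exists>A. \<forall>p. \<forall>x. fs (fst p) (x + axis (snd p) 1) = A p *v fs (fst p) x"
        by (intro choice allI)
      then obtain A where "\<forall>p. \<forall>x. fs (fst p) (x + axis (snd p) 1) = A p *v fs (fst p) x"
        by (elim exE)
      then have A: "fs n (x + axis i 1) = A (n, i) *v fs n x" for n i x
        by (elim allE[of _ "(n, i)"]) simp
      define g where "g n y = fs n (\<phi>' y)" for n y
      have \<phi>'_axis: "\<phi>' (y + axis i 1) = \<phi>' y + axis i 1" for y i
        using Diff1_lifts_equivariant[OF \<phi>'(1), of y "axis i 1"] by simp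
      have \<phi>'_loc: "local_diffeo_at \<phi>' y" for y
        using \<phi>'(1) by (simp add: Diff1_lifts_iff diffeomorphism_UNIV_iff)
      have ul: "uniform_limit (cball 0 3) g (\<lambda>y. G *v ofC (lexp C y)) sequentially"
      proof (rule uniform_limitI)
        fix e :: real assume "e > 0"
        then obtain n0 where n0: "inverse (real (Suc n0)) < e" using reals_Archimedean by blast
        have "dist (g n y) (G *v ofC (lexp C y)) < e" if "n \<ge> n0" "y \<in> cball 0 3" for n y
        proof -
          have "\<phi>' y \<in> K" using that(2) by (simp add: K_def)
          then have "dist (g n y) (f (\<phi>' y)) < inverse (real (Suc n))" unfolding g_def by (rule fs(4))
          moreover have "inverse (real (Suc n)) \<le> inverse (real (Suc n0))"
            using that(1) by (intro le_imp_inverse_le) auto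
          ultimately have "dist (g n y) (f (\<phi>' y)) < e" using n0 by linarith
          then show ?thesis by (simp add: f_def \<phi>'(3))
        qed
        then show "\<forall>\<^sub>F n in sequentially. \<forall>y\<in>cball 0 3. dist (g n y) (G *v ofC (lexp C y)) < e"
          unfolding eventually_sequentially by blast
      qed
      have "eventually (\<lambda>n. \<exists>C'\<in>N. \<exists>Q \<psi>. invertible C' \<and> invertible Q \<and> \<psi> \<in> Diff1_lifts \<and>
           (\<forall>y. g n y = Q *v ofC (lexp C' (\<psi> y)))) sequentially"
      proof (rule near_linear_development[where A = "\<lambda>n i. A (n, i)", OF N(2)[OF C(1)] N(3)[OF C(1)] G _ _ _ _ ul N(1) C(1)])
        show "continuous_on UNIV (g n)" for n unfolding g_def
          by (rule continuous_on_compose2[OF fs(1) Diff1_lifts_continuous[OF \<phi>'(1)]]) auto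
        show "g n y \<noteq> 0" for n y by (simp add: g_def fs(2))
        show "local_diffeo_at (g n) y" for n y unfolding g_def
          by (rule local_diffeo_at_compose[OF \<phi>'_loc loc])
        show "g n (y + axis i 1) = A (n, i) *v g n y" for n i y by (simp add: g_def \<phi>'_axis A)
      qed
      then have "\<exists>n. \<exists>C'\<in>N. \<exists>Q \<psi>. invertible C' \<and> invertible Q \<and> \<psi> \<in> Diff1_lifts \<and>
           (\<forall>y. g n y = Q *v ofC (lexp C' (\<psi> y)))"
        by (rule eventually_happens'[OF sequentially_bot])
      then obtain n C' Q \<psi> where C': "C' \<in> N" "invertible Q" "\<psi> \<in> Diff1_lifts"
        and gC': "\<forall>y. g n y = Q *v ofC (lexp C' (\<psi> y))" by (elim exE bexE conjE)
      have "fs n x = Q *v ofC (lexp C' (\<psi> (\<phi> x)))" for x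
        using spec[OF gC', of "\<phi> x"] by (simp add: g_def \<phi>'(2))
      then have "(\<lambda>x. pj (fs n x)) = (\<lambda>x. pj (Q *v ofC (lexp C' (\<psi> (\<phi> x)))))" by simp
      then have "dev_class PP (\<lambda>x. pj (fs n x)) = dev_class PP (lin_dev C')"
        using dev_class_PP_eq[OF C'(2) Diff1_lifts_compose[OF C'(3) \<phi>], of "\<lambda>x. ofC (lexp C' x)"]
        by (simp add: lin_dev_def)
      then have "(\<lambda>x. pj (fs n x)) \<in> ?S" using fs(3) C'(1) by auto
      then show False by (rule notE[OF fs(5)])
    qed
    then obtain \<epsilon> where \<epsilon>: "\<epsilon> > 0" and near: "\<forall>f'. continuous_on UNIV f' \<longrightarrow> (\<forall>x. f' x \<noteq> 0) \<longrightarrow>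
        (\<lambda>x. pj (f' x)) \<in> Dev PP \<longrightarrow> (\<forall>x\<in>K. dist (f' x) (f x) < \<epsilon>) \<longrightarrow> (\<lambda>x. pj (f' x)) \<in> ?S"
      by (elim exE conjE)
    obtain T where T: "openin (Dev_topology PP) T" "D \<in> T"
      and TD: "\<forall>D'\<in>T. \<exists>f'. continuous_on UNIV f' \<and> (\<forall>x. f' x \<noteq> 0) \<and> D' = (\<lambda>x. pj (f' x)) \<and>
       (\<forall>x\<in>K. dist (f' x) (f x) < \<epsilon>)"
      using uniformly_near_lift[OF D_Dev[unfolded Df] f K \<epsilon>] unfolding Df by (elim exE conjE)
    have "T \<subseteq> ?S"
    proof
      fix D' assume D': "D' \<in> T"
      then have Dev': "D' \<in> Dev PP" using openin_subset[OF T(1)] by (auto simp: topspace_Dev_topology)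
      obtain f' where f': "continuous_on UNIV f'" "\<forall>x. f' x \<noteq> 0" "D' = (\<lambda>x. pj (f' x))"
        "\<forall>x\<in>K. dist (f' x) (f x) < \<epsilon>" using bspec[OF TD D'] by (elim exE conjE)
      show "D' \<in> ?S"
        unfolding f'(3)
        by (rule near[rule_format, OF f'(1) f'(2)[rule_format] Dev'[unfolded f'(3)] f'(4)[rule_format]])
    qed
    then show "\<exists>T. openin (Dev_topology PP) T \<and> D \<in> T \<and> T \<subseteq> ?S" using T(1,2) by (intro exI[of _ T] conjI)
  qed
qed

lemma Cinf_maps_PP_chart_smooth:
  assumes f: "f \<in> Cinf_maps PP" and Vc: "(V, c) \<in> atlas PP" and x: "f x \<in> V"
  obtains P where "x \<in> P" "smooth_on P (c \<circ> f)"
proof -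
  obtain E where E: "continuous_on UNIV E" "f = (\<lambda>x. pj (ofC (exp (E x))))"
    by (rule Cinf_maps_PP_lift[OF f])
  define F where "F x = ofC (exp (E x))" for x
  have F: "continuous_on UNIV F" "f = (\<lambda>x. pj (F x))"
    using E by (auto simp: F_def intro!: continuous_intros)
  obtain V' c' U where c': "(V', c') \<in> atlas PP" "x \<in> U" "f ` U \<subseteq> V'" "smooth_on U (c' \<circ> f)"
    using f unfolding Cinf_maps_def by blast
  have "pj (F x) \<in> V" using x F(2) by simp
  then obtain P \<sigma> where P: "open P" "x \<in> P" "\<sigma> = 1 \<or> \<sigma> = -1"
    and cP: "\<forall>y\<in>P. pj (F y) \<in> V \<and> c (pj (F y)) = \<sigma> *\<^sub>R F y"
    by (rule chart_PP_lift[OF Vc F(1)])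
  have "pj (F x) \<in> V'" using c'(2,3) F(2) by auto
  then obtain P' \<sigma>' where P': "open P'" "x \<in> P'" "\<sigma>' = 1 \<or> \<sigma>' = -1"
    and cP': "\<forall>y\<in>P'. pj (F y) \<in> V' \<and> c' (pj (F y)) = \<sigma>' *\<^sub>R F y"
    by (rule chart_PP_lift[OF c'(1) F(1)])
  define Q where "Q = P \<inter> P' \<inter> U"
  have "open Q" using P(1) P'(1) c'(4) unfolding Q_def smooth_on_def by (intro open_Int) auto
  have Q: "smooth_on Q (c' \<circ> f)"
    by (rule smooth_on_subset[OF c'(4) \<open>open Q\<close>]) (auto simp: Q_def)
  have "smooth_on Q (\<lambda>y. ((\<sigma> * \<sigma>') *\<^sub>R mat 1 :: real^2^2) *v (c' \<circ> f) y)"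
    by (rule smooth_on_compose[OF smooth_on_matrix[OF open_UNIV] Q]) simp
  moreover have "((\<sigma> * \<sigma>') *\<^sub>R mat 1 :: real^2^2) *v (c' \<circ> f) y = (c \<circ> f) y" if "y \<in> Q" for y
  proof -
    have "c' (f y) = \<sigma>' *\<^sub>R F y" "c (f y) = \<sigma> *\<^sub>R F y"
      using that cP cP' by (auto simp: Q_def F(2))
    then show ?thesis using P(3) P'(3) by auto
  qed
  ultimately have "smooth_on Q (c \<circ> f)" by (rule smooth_on_cong)
  moreover have "x \<in> Q" using P P' c' by (simp add: Q_def)
  ultimately show thesis using that by blast
qed

lemma compact_uniform_neighbourhood:
  assumes K: "compact K" and loc: "\<And>x. x \<in> K \<Longrightarrow> \<exists>S. open S \<and> (a, x) \<in> S \<and> (\<forall>p\<in>S. snd p \<in> K \<longrightarrow> Q (fst p) (snd p))"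
  obtains A where "open A" "a \<in> A" "\<And>b x. b \<in> A \<Longrightarrow> x \<in> K \<Longrightarrow> Q b x"
proof -
  have "\<exists>p. open (fst p) \<and> open (snd p) \<and> a \<in> fst p \<and> x \<in> snd p \<and>
      (\<forall>b\<in>fst p. \<forall>y\<in>snd p. y \<in> K \<longrightarrow> Q b y)" if x: "x \<in> K" for x
  proof -
    obtain S where S: "open S" "(a, x) \<in> S" "\<forall>p\<in>S. snd p \<in> K \<longrightarrow> Q (fst p) (snd p)"
      using loc[OF x] by (elim exE conjE)
    obtain A B where AB: "open A" "open B" "(a, x) \<in> A \<times> B" "A \<times> B \<subseteq> S"
      by (rule open_prod_elim[OF S(1,2)])
    have "Q b y" if "b \<in> A" "y \<in> B" "y \<in> K" for b y
    proof -
      have "(b, y) \<in> S" using AB(4) that by auto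
      then show ?thesis using S(3) that(3) by force
    qed
    then show ?thesis using AB by (intro exI[of _ "(A, B)"]) auto
  qed
  then have "\<forall>x\<in>K. \<exists>p. open (fst p) \<and> open (snd p) \<and> a \<in> fst p \<and> x \<in> snd p \<and>
      (\<forall>b\<in>fst p. \<forall>y\<in>snd p. y \<in> K \<longrightarrow> Q b y)" by simp
  then have "\<exists>q. \<forall>x\<in>K. open (fst (q x)) \<and> open (snd (q x)) \<and> a \<in> fst (q x) \<and> x \<in> snd (q x) \<and>
      (\<forall>b\<in>fst (q x). \<forall>y\<in>snd (q x). y \<in> K \<longrightarrow> Q b y)" by (rule bchoice)
  then obtain q where q: "\<forall>x\<in>K. open (fst (q x)) \<and> open (snd (q x)) \<and> a \<in> fst (q x) \<and> x \<in> snd (q x) \<and>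
      (\<forall>b\<in>fst (q x). \<forall>y\<in>snd (q x). y \<in> K \<longrightarrow> Q b y)" by (elim exE)
  have "K \<subseteq> (\<Union>x\<in>K. snd (q x))" using q by auto
  then obtain X where X: "X \<subseteq> K" "finite X" "K \<subseteq> (\<Union>x\<in>X. snd (q x))"
    using compactE_image[OF K, of K "\<lambda>x. snd (q x)"] q by auto
  show thesis
  proof (rule that[of "\<Inter>x\<in>X. fst (q x)"])
    show "open (\<Inter>x\<in>X. fst (q x))" using X(1,2) q by (intro open_INT) auto
    show "a \<in> (\<Inter>x\<in>X. fst (q x))" using X(1) q by auto
    show "Q b y" if b: "b \<in> (\<Inter>x\<in>X. fst (q x))" and y: "y \<in> K" for b y
    proof -
      obtain x where x: "x \<in> X" "y \<in> snd (q x)" using X(3) y by auto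
      have "x \<in> K" "b \<in> fst (q x)" using x X(1) b by auto
      then show ?thesis using q x(2) y by simp
    qed
  qed
qed

text \<open>
  Locally, a chart composed with \<open>lin_dev C\<close> is \<open>lexp C\<close> up to a sign. All its derivatives are
  jointly continuous in \<open>C\<close> and in the point by \<open>iter_pderiv_exp_linear\<close>, and finitely many of them are controlled
  on a compact set.
\<close>

lemma continuous_map_lin_dev:
  assumes N: "open N" "\<And>C. C \<in> N \<Longrightarrow> invertible C"
  shows "continuous_map (top_of_set N) (Dev_topology PP) lin_dev"
  unfolding Dev_topology_def
proof (rule continuous_map_into_subtopology)
  show img: "lin_dev \<in> topspace (top_of_set N) \<rightarrow> Dev PP" using lin_dev_in_Dev N(2) by auto
  show "continuous_map (top_of_set N) (compact_Cinf_topology PP) lin_dev"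
    unfolding compact_Cinf_topology_def
  proof (rule continuous_on_generated_topo)
    have "Dev PP \<subseteq> topspace (compact_Cinf_topology PP)"
      using topspace_Dev_topology unfolding Dev_topology_def by auto
    then show "lin_dev ` topspace (top_of_set N) \<subseteq> \<Union> {Cinf_nbhd PP f K V c r \<epsilon> | f K V c r \<epsilon>.
        f \<in> Cinf_maps PP \<and> compact K \<and> (V, c) \<in> atlas PP \<and> f ` K \<subseteq> V \<and> \<epsilon> > 0}"
      using img unfolding compact_Cinf_topology_def topology_generated_by_topspace by auto
    fix U assume "U \<in> {Cinf_nbhd PP f K V c r \<epsilon> | f K V c r \<epsilon>.
        f \<in> Cinf_maps PP \<and> compact K \<and> (V, c) \<in> atlas PP \<and> f ` K \<subseteq> V \<and> \<epsilon> > 0}"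
    then obtain f K V c r \<epsilon> where U: "U = Cinf_nbhd PP f K V c r \<epsilon>" and f: "f \<in> Cinf_maps PP" "f ` K \<subseteq> V"
      and K: "compact K" and Vc: "(V, c) \<in> atlas PP" and \<epsilon>: "\<epsilon> > 0"
      unfolding mem_Collect_eq by (elim exE conjE)
    obtain W where W: "V = pj ` W" "c = the_inv_into W pj" "open W" "inj_on pj W"
      using Vc unfolding atlas_PP by (elim exE conjE)
    define Q where "Q C y \<longleftrightarrow> lin_dev C y \<in> V \<and> (\<forall>js. length js \<le> r \<longrightarrow>
        norm (iter_pderiv js (c \<circ> lin_dev C) y - iter_pderiv js (c \<circ> f) y) < \<epsilon>)" for C y
    have U_iff: "lin_dev C \<in> U \<longleftrightarrow> (\<forall>y\<in>K. Q C y)" if C: "C \<in> N" for C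
    proof -
      have "lin_dev C \<in> Cinf_maps PP" using lin_dev_in_Dev[OF N(2)[OF C]] Dev_subset_Cinf_maps by auto
      then show ?thesis unfolding U Cinf_nbhd_def Q_def by auto
    qed
    have "open (lin_dev -` U \<inter> N)"
    proof (subst open_subopen, rule ballI)
      fix C1 assume C1: "C1 \<in> lin_dev -` U \<inter> N"
      then have QC1: "Q C1 y" if "y \<in> K" for y
        using U_iff[of C1] C1 that by blast
      have "\<exists>S. open S \<and> (C1, x) \<in> S \<and> (\<forall>p\<in>S. snd p \<in> K \<longrightarrow> Q (fst p) (snd p))" if x: "x \<in> K" for x
      proof -
        obtain w where w: "w \<in> W" "lin_dev C1 x = pj w" using QC1[OF x] W(1) unfolding Q_def by auto
        have "w = ofC (lexp C1 x) \<or> w = - ofC (lexp C1 x)"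
          using w(2) unfolding lin_dev_def pj_eq_iff .
        then obtain \<sigma> :: real where \<sigma>: "\<sigma> = 1 \<or> \<sigma> = -1" "w = \<sigma> *\<^sub>R ofC (lexp C1 x)"
          by (metis scaleR_minus_left scaleR_one)
        have pj\<sigma>: "pj (\<sigma> *\<^sub>R v) = pj v" for v using \<sigma>(1) by auto
        have lexp\<sigma>: "\<sigma> *\<^sub>R ofC (lexp C z) = ofC (of_real \<sigma> * exp (toC (C *v z)))" for C z
          using \<sigma>(1) by (auto simp: lexp_def)
        define S0 where "S0 = (\<lambda>p :: (real^2^2) \<times> (real^2). ofC (of_real \<sigma> * exp (toC (fst p *v snd p)))) -` W"
        have cmv: "continuous_on UNIV (\<lambda>p :: (real^2^2) \<times> (real^2). fst p *v snd p)"
          by (intro bounded_bilinear.continuous_on[OF bounded_bilinear_matrix_vector_mult] continuous_intros)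
        have S0: "open S0"
          unfolding S0_def by (intro open_vimage W(3) continuous_intros cmv)
        define h where "h js p = ofC ((of_real \<sigma> * (\<Prod>j\<leftarrow>js. toC (fst p *v axis j 1))) * exp (toC (fst p *v snd p)))"
          for js and p :: "(real^2^2) \<times> (real^2)"
        have S0_D: "lin_dev (fst p) (snd p) \<in> V"
          "iter_pderiv js (c \<circ> lin_dev (fst p)) (snd p) = h js p" if p: "p \<in> S0" for p js
        proof -
          define Z where "Z = (\<lambda>z. ofC (of_real \<sigma> * exp (toC (fst p *v z)))) -` W"
          have cmz: "continuous_on UNIV (\<lambda>z. fst p *v z)"
            by (intro linear_continuous_on matrix_vector_mul_bounded_linear)
          have Z: "open Z" "snd p \<in> Z"
            using p by (auto simp: Z_def S0_def intro!: open_vimage W(3) continuous_intros cmz)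
          have cZ: "(c \<circ> lin_dev (fst p)) z = ofC (of_real \<sigma> * exp (toC (fst p *v z)))" if "z \<in> Z" for z
          proof -
            have "lin_dev (fst p) z = pj (ofC (of_real \<sigma> * exp (toC (fst p *v z))))"
              unfolding lin_dev_def lexp\<sigma>[symmetric] pj\<sigma> ..
            then show ?thesis using that W(2) the_inv_into_f_f[OF W(4)] by (simp add: Z_def)
          qed
          have "pj (ofC (of_real \<sigma> * exp (toC (fst p *v snd p)))) \<in> pj ` W"
            using p by (intro imageI) (simp add: S0_def)
          then show "lin_dev (fst p) (snd p) \<in> V"
            unfolding lexp\<sigma>[symmetric] pj\<sigma> W(1) lin_dev_def .
          show "iter_pderiv js (c \<circ> lin_dev (fst p)) (snd p) = h js p"
            using iter_pderiv_cong_open[where js = js, OF Z(1) cZ Z(2)]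
            by (simp only: iter_pderiv_exp_linear h_def)
        qed
        have prodc: "continuous_on UNIV (\<lambda>p :: (real^2^2) \<times> (real^2). \<Prod>j\<leftarrow>js. toC (fst p *v axis j 1))" for js
        proof (induction js)
          case (Cons j js)
          have "continuous_on UNIV (\<lambda>p :: (real^2^2) \<times> (real^2). fst p *v axis j 1)"
            by (intro bounded_bilinear.continuous_on[OF bounded_bilinear_matrix_vector_mult] continuous_intros)
          then show ?case using Cons by (auto intro!: continuous_intros)
        qed simp
        have hc: "continuous_on UNIV (h js)" for js
          unfolding h_def by (intro continuous_intros prodc cmv)
        have "f x \<in> V" using f(2) x by auto
        then obtain P where P: "x \<in> P" "smooth_on P (c \<circ> f)"
          by (rule Cinf_maps_PP_chart_smooth[OF f(1) Vc])
        have oP: "open P" using P(2) by (simp add: smooth_on_def)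
        define R where "R js = (UNIV \<times> P) \<inter>
            (\<lambda>p. norm (h js p - iter_pderiv js (c \<circ> f) (snd p))) -` {..<\<epsilon>}" for js
        have R: "open (R js)" for js
        proof -
          have "continuous_on (UNIV \<times> P) (\<lambda>p. norm (h js p - iter_pderiv js (c \<circ> f) (snd p)))"
            by (intro continuous_on_norm continuous_on_diff continuous_on_subset[OF hc]
                continuous_on_compose2[OF smooth_on_iter_pderiv_continuous[OF P(2)] continuous_on_snd[OF continuous_on_id]])
               auto
          then show ?thesis unfolding R_def
            by (intro continuous_open_preimage open_Times oP) auto
        qed
        define L where "L = {js :: 2 list. length js \<le> r}"
        have "finite L" using finite_lists_length_le[of "UNIV :: 2 set" r] by (simp add: L_def)
        define S where "S = S0 \<inter> (\<Inter>js\<in>L. R js)"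
        have "open S" unfolding S_def using S0 R \<open>finite L\<close> by (intro open_Int open_INT) auto
        moreover have "(C1, x) \<in> S"
        proof -
          have S0x: "(C1, x) \<in> S0" using w(1) \<sigma>(2) unfolding S0_def lexp\<sigma> by simp
          have "norm (h js (C1, x) - iter_pderiv js (c \<circ> f) x) < \<epsilon>" if "length js \<le> r" for js
          proof -
            have "norm (iter_pderiv js (c \<circ> lin_dev C1) x - iter_pderiv js (c \<circ> f) x) < \<epsilon>"
              using QC1[OF x] that unfolding Q_def by blast
            then show ?thesis using S0_D(2)[OF S0x, of js] by simp
          qed
          then show ?thesis using S0x P(1) by (auto simp: S_def R_def L_def)
        qed
        moreover have "Q (fst p) (snd p)" if p: "p \<in> S" for p
        proof -
          have pS0: "p \<in> S0" and pR: "p \<in> (\<Inter>js\<in>L. R js)" using p by (simp_all only: S_def Int_iff)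
          have "norm (h js p - iter_pderiv js (c \<circ> f) (snd p)) < \<epsilon>" if "length js \<le> r" for js
          proof -
            have "p \<in> R js" by (rule INT_D[OF pR]) (simp add: L_def that)
            then show ?thesis by (simp add: R_def)
          qed
          then show ?thesis
            unfolding Q_def S0_D(2)[OF pS0] using S0_D(1)[OF pS0] by blast
        qed
        ultimately show ?thesis by (intro exI[of _ S] conjI ballI impI)
      qed
      then obtain A where A: "open A" "C1 \<in> A" "\<And>C y. C \<in> A \<Longrightarrow> y \<in> K \<Longrightarrow> Q C y"
        using compact_uniform_neighbourhood[OF K, of C1 Q] by metis
      have "A \<inter> N \<subseteq> lin_dev -` U \<inter> N" using A(3) U_iff by auto
      then show "\<exists>T. open T \<and> C1 \<in> T \<and> T \<subseteq> lin_dev -` U \<inter> N"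
        using A(1,2) C1 N(1) by (intro exI[of _ "A \<inter> N"]) auto
    qed
    then show "openin (top_of_set N) (lin_dev -` U \<inter> topspace (top_of_set N))"
      by (intro open_subset) auto
  qed
qed

section \<open>The space of conjugacy classes of homomorphisms\<close>

lemma hom_int_lattice_eqI:
  assumes "group H" and h: "h \<in> hom int_lattice H" "h' \<in> hom int_lattice H"
    and eq: "\<And>i. h (axis i 1) = h' (axis i 1)"
  shows "h = h'"
proof -
  interpret group H by fact
  have cl: "h \<gamma> \<in> carrier H" "h' \<gamma> \<in> carrier H" for \<gamma>
    using h by (auto simp: hom_def int_lattice_def)
  have add: "h (\<gamma> + \<delta>) = h \<gamma> \<otimes>\<^bsub>H\<^esub> h \<delta>" "h' (\<gamma> + \<delta>) = h' \<gamma> \<otimes>\<^bsub>H\<^esub> h' \<delta>" for \<gamma> \<delta>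
    using h by (auto simp: hom_def int_lattice_def)
  have zero: "h 0 = \<one>\<^bsub>H\<^esub>" "h' 0 = \<one>\<^bsub>H\<^esub>"
    using add[of 0 0] cl[of 0] by (simp_all add: l_cancel_one)
  have up: "h (\<gamma> + axis i 1) = h' (\<gamma> + axis i 1) \<longleftrightarrow> h \<gamma> = h' \<gamma>" for \<gamma> i
    unfolding add eq using cl by (simp add: right_cancel)
  have step: "h (\<gamma> + axis i n) = h' (\<gamma> + axis i n)" if "h \<gamma> = h' \<gamma>" for \<gamma> i and n :: int
  proof (induction n rule: int_induct[of _ 0])
    case base
    have "\<gamma> + axis i 0 = \<gamma>" by (simp add: vec_eq_iff axis_def)
    then show ?case using that by (simp only:)
  next
    case (step1 n)
    have "\<gamma> + axis i (n + 1) = (\<gamma> + axis i n) + axis i 1" by (simp add: vec_eq_iff axis_def)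
    then show ?case using step1(2) by (simp only: up)
  next
    case (step2 n)
    have "\<gamma> + axis i n = (\<gamma> + axis i (n - 1)) + axis i 1" by (simp add: vec_eq_iff axis_def)
    then show ?case using step2(2) by (simp only: up)
  qed
  have "h \<gamma> = h' \<gamma>" for \<gamma>
  proof -
    have "\<gamma> = 0 + axis 1 (\<gamma> $ 1) + axis 2 (\<gamma> $ 2)" by (simp add: vec_eq_iff forall_2 axis_def)
    then show ?thesis using step[OF step, of 0 1 "\<gamma> $ 1" 2 "\<gamma> $ 2"] zero by simp
  qed
  then show ?thesis by (rule ext)
qed

lemma quotient_map_mclass: "quotient_map GL2_topology PGL2_topology mclass"
  unfolding PGL2_topology_def r_coset_mclass by (rule quotient_map_quot_topology)

lemma topspace_GL2: "topspace GL2_topology = {A. invertible A}"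
  by (simp add: GL2_topology_def carrier_GL2)

lemma topspace_PGL2: "topspace PGL2_topology = carrier PGL2"
  using quotient_map_mclass by (simp add: quotient_map_def topspace_GL2 carrier_PGL2)

lemma topspace_Hom: "topspace (Hom_topology PP) = hom int_lattice PGL2"
  by (auto simp: Hom_topology_def topspace_PGL2 hom_def int_lattice_def)

lemma openin_mclass_ball: "openin PGL2_topology (mclass ` (ball M \<epsilon> \<inter> {A. invertible A}))"
proof -
  have "{A \<in> {A. invertible A}. mclass A \<in> mclass ` (ball M \<epsilon> \<inter> {A. invertible A})} =
      {A. invertible A} \<inter> (ball M \<epsilon> \<union> uminus -` ball M \<epsilon>)"
  proof (intro equalityI subsetI)
    fix A assume "A \<in> {A \<in> {A. invertible A}. mclass A \<in> mclass ` (ball M \<epsilon> \<inter> {A. invertible A})}"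
    then obtain B where "invertible A" "B \<in> ball M \<epsilon>" "mclass A = mclass B" by auto
    then show "A \<in> {A. invertible A} \<inter> (ball M \<epsilon> \<union> uminus -` ball M \<epsilon>)"
      by (auto simp: mclass_eq_iff)
  next
    fix A assume A: "A \<in> {A. invertible A} \<inter> (ball M \<epsilon> \<union> uminus -` ball M \<epsilon>)"
    then have "A \<in> ball M \<epsilon> \<inter> {A. invertible A} \<or> - A \<in> ball M \<epsilon> \<inter> {A. invertible A}" by auto
    then have "mclass A \<in> mclass ` (ball M \<epsilon> \<inter> {A. invertible A})"
      by (metis imageI mclass_minus)
    then show "A \<in> {A \<in> {A. invertible A}. mclass A \<in> mclass ` (ball M \<epsilon> \<inter> {A. invertible A})}"
      using A by simp
  qed
  moreover have "open (ball M \<epsilon> \<union> uminus -` ball M \<epsilon>)"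
    by (intro open_Un open_ball open_vimage continuous_intros)
  ultimately have "openin GL2_topology
      {A \<in> topspace GL2_topology. mclass A \<in> mclass ` (ball M \<epsilon> \<inter> {A. invertible A})}"
    unfolding topspace_GL2 by (simp add: GL2_topology_def carrier_GL2 openin_open_Int)
  then show ?thesis
    unfolding PGL2_topology_def r_coset_mclass openin_quot_topology topspace_GL2
    by (intro conjI image_mono) auto
qed

lemma in_conj_class_PP_self:
  assumes "h \<in> hom int_lattice PGL2"
  shows "h \<in> conj_class PP h"
proof -
  interpret group PGL2 by (rule group_PGL2)
  have "h \<gamma> \<in> carrier PGL2" for \<gamma> using assms by (auto simp: hom_def int_lattice_def)
  then have "h = (\<lambda>\<gamma>. \<one>\<^bsub>PGL2\<^esub> \<otimes>\<^bsub>PGL2\<^esub> h \<gamma> \<otimes>\<^bsub>PGL2\<^esub> inv\<^bsub>PGL2\<^esub> \<one>\<^bsub>PGL2\<^esub>)" by simp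
  then show ?thesis
    unfolding conj_class_def PP_sel mem_Collect_eq by (intro exI[of _ "\<one>\<^bsub>PGL2\<^esub>"] conjI one_closed)
qed

lemma conj_lin_hol_hom:
  assumes "invertible A"
  shows "(\<lambda>\<gamma>. mclass (A ** cmat (lexp C (lattice_vec \<gamma>)) ** matrix_inv A)) \<in> hom int_lattice PGL2"
  using is_holonomy_lin_dev[OF assms Diff1_lifts_id, of C] by (simp add: is_holonomy_def)

lemma continuous_map_conj_class_lin_hol:
  "continuous_map (top_of_set N) (character_space PP) (\<lambda>C. conj_class PP (lin_hol C))"
proof -
  have cont: "continuous_map (top_of_set N) (Hom_topology PP) lin_hol"
    unfolding Hom_topology_def
  proof (rule continuous_map_into_subtopology)
    show "lin_hol \<in> topspace (top_of_set N) \<rightarrow> hom int_lattice (grp PP)"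
      using lin_hol_hom by simp
    show "continuous_map (top_of_set N) (product_topology (\<lambda>_. grp_top PP) UNIV) lin_hol"
      unfolding continuous_map_componentwise_UNIV PP_sel
    proof
      fix \<gamma>
      have "continuous_on UNIV (\<lambda>C :: real^2^2. C *v lattice_vec \<gamma>)"
        by (intro bounded_bilinear.continuous_on[OF bounded_bilinear_matrix_vector_mult] continuous_intros)
      then have l: "continuous_on UNIV (\<lambda>C. lexp C (lattice_vec \<gamma>))"
        unfolding lexp_def by (intro continuous_intros)
      have "bounded_linear cmat"
        unfolding linear_conv_bounded_linear[symmetric]
        by (rule linearI) (simp_all add: vec_eq_iff forall_2 cmat_def)
      then have "continuous_on N (\<lambda>C. cmat (lexp C (lattice_vec \<gamma>)))"
        by (rule bounded_linear.continuous_on) (rule continuous_on_subset[OF l subset_UNIV])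
      then have "continuous_map (top_of_set N) GL2_topology (\<lambda>C. cmat (lexp C (lattice_vec \<gamma>)))"
        unfolding GL2_topology_def
        by (intro continuous_map_into_subtopology) (auto simp: carrier_GL2 invertible_cmat)
      then have "continuous_map (top_of_set N) PGL2_topology (mclass \<circ> (\<lambda>C. cmat (lexp C (lattice_vec \<gamma>))))"
        by (rule continuous_map_compose[OF _ quotient_imp_continuous_map[OF quotient_map_mclass]])
      then show "continuous_map (top_of_set N) PGL2_topology (\<lambda>C. lin_hol C \<gamma>)"
        by (simp add: lin_hol_def comp_def)
    qed
  qed
  have "continuous_map (top_of_set N) (character_space PP) (conj_class PP \<circ> lin_hol)"
    unfolding character_space_def
    by (rule continuous_map_compose[OF cont quotient_imp_continuous_map[OF quotient_map_quot_topology]])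
  then show ?thesis by (simp add: comp_def)
qed

text \<open>
  The values at the two generators of a nearby homomorphism lift to matrices near those of the
  given one. They commute up to sign, and the sign is \<open>1\<close> because the product of the limits is not zero.
\<close>

lemma conj_classes_open:
  assumes N: "open N" "\<And>C. C \<in> N \<Longrightarrow> Im (lexp C (axis j 1)) \<noteq> 0"
  shows "openin (character_space PP) ((\<lambda>C. conj_class PP (lin_hol C)) ` N)"
  unfolding character_space_def openin_quot_topology topspace_Hom
proof
  show "(\<lambda>C. conj_class PP (lin_hol C)) ` N \<subseteq> conj_class PP ` hom int_lattice PGL2"
    using lin_hol_hom by auto
  let ?S = "{h \<in> hom int_lattice PGL2. conj_class PP h \<in> (\<lambda>C. conj_class PP (lin_hol C)) ` N}"
  show "openin (Hom_topology PP) ?S"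
  proof (subst openin_subopen, rule ballI)
    fix h assume h_in: "h \<in> ?S"
    then obtain C where C: "C \<in> N" "conj_class PP h = conj_class PP (lin_hol C)"
      and hom_h: "h \<in> hom int_lattice PGL2" by auto
    have "h \<in> conj_class PP (lin_hol C)" using in_conj_class_PP_self[OF hom_h] C(2) by simp
    then obtain G where h: "h = (\<lambda>\<gamma>. mclass (G ** cmat (lexp C (lattice_vec \<gamma>)) ** matrix_inv G))"
      and G: "invertible G"
      unfolding lin_hol_def in_conj_class_PP_iff by (elim exE conjE)
    define a where "a i = lexp C (axis i 1)" for i
    define M where "M i = G ** cmat (a i) ** matrix_inv G" for i
    have invM: "invertible (M i)" for i
      unfolding M_def a_def by (intro invertible_mult2 G matrix_inv_mult(3) invertible_cmat lexp_nonzero)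
    have MM: "M i ** M k = G ** cmat (a i * a k) ** matrix_inv G" for i k
    proof -
      have "M i ** M k = G ** cmat (a i) ** (matrix_inv G ** G) ** cmat (a k) ** matrix_inv G"
        unfolding M_def by (simp only: matrix_mul_assoc)
      then show ?thesis using matrix_inv_mult[OF G] by (simp add: cmat_mult flip: matrix_mul_assoc)
    qed
    have "\<exists>\<epsilon>>0. \<forall>h'\<in>hom int_lattice PGL2.
        (\<forall>i. \<exists>B. h' (axis i 1) = mclass B \<and> dist (M i) B < \<epsilon>) \<longrightarrow> h' \<in> ?S"
    proof (rule ccontr)
      assume neg: "\<not> ?thesis"
      have "\<exists>h'. h' \<in> hom int_lattice PGL2 \<and>
          (\<forall>i. \<exists>B. h' (axis i 1) = mclass B \<and> dist (M i) B < inverse (real (Suc n))) \<and> h' \<notin> ?S" for n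
      proof -
        have "inverse (real (Suc n)) > 0" by simp
        with neg show ?thesis by meson
      qed
      then have "\<exists>hs. \<forall>n. hs n \<in> hom int_lattice PGL2 \<and>
          (\<forall>i. \<exists>B. hs n (axis i 1) = mclass B \<and> dist (M i) B < inverse (real (Suc n))) \<and> hs n \<notin> ?S"
        by (intro choice allI)
      then obtain hs where hs_all: "\<forall>n. hs n \<in> hom int_lattice PGL2 \<and>
          (\<forall>i. \<exists>B. hs n (axis i 1) = mclass B \<and> dist (M i) B < inverse (real (Suc n))) \<and> hs n \<notin> ?S"
        by (elim exE)
      have hs: "hs n \<in> hom int_lattice PGL2" "hs n \<notin> ?S" for n
        using spec[OF hs_all] by (simp_all only: simp_thms)
      have "\<exists>B. hs (fst p) (axis (snd p) 1) = mclass B \<and> dist (M (snd p)) B < inverse (real (Suc (fst p)))" for p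
        using spec[OF hs_all, of "fst p"] by (simp only: simp_thms)
      then have "\<exists>B. \<forall>p. hs (fst p) (axis (snd p) 1) = mclass (B p) \<and>
          dist (M (snd p)) (B p) < inverse (real (Suc (fst p)))"
        by (intro choice allI)
      then obtain B where B_all: "\<forall>p. hs (fst p) (axis (snd p) 1) = mclass (B p) \<and>
          dist (M (snd p)) (B p) < inverse (real (Suc (fst p)))" by (elim exE)
      have B: "hs n (axis i 1) = mclass (B (n, i))" "dist (M i) (B (n, i)) < inverse (real (Suc n))" for n i
        using spec[OF B_all, of "(n, i)"] by (simp_all only: fst_conv snd_conv simp_thms)
      have Blim: "((\<lambda>n. B (n, i)) \<longlongrightarrow> M i) sequentially" for i
      proof (rule tendstoI)
        fix e :: real assume "e > 0"
        then obtain n0 where n0: "inverse (real (Suc n0)) < e" using reals_Archimedean by blast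
        have "dist (B (n, i)) (M i) < e" if "n \<ge> n0" for n
        proof -
          have "inverse (real (Suc n)) \<le> inverse (real (Suc n0))"
            using that by (intro le_imp_inverse_le) auto
          then show ?thesis using B(2)[of i n] n0 by (simp only: dist_commute)
        qed
        then show "\<forall>\<^sub>F n in sequentially. dist (B (n, i)) (M i) < e"
          unfolding eventually_sequentially by blast
      qed
      have comm: "eventually (\<lambda>n. B (n, 1) ** B (n, 2) = B (n, 2) ** B (n, 1)) sequentially"
      proof -
        have "((\<lambda>n. B (n, 1) ** B (n, 2) + B (n, 2) ** B (n, 1)) \<longlongrightarrow> M 1 ** M 2 + M 2 ** M 1) sequentially"
          by (intro tendsto_add tendsto_matrix_mult Blim)
        moreover have "M 1 ** M 2 + M 2 ** M 1 \<noteq> 0"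
        proof
          assume "M 1 ** M 2 + M 2 ** M 1 = 0"
          moreover have "M 2 ** M 1 = M 1 ** M 2" unfolding MM by (simp add: mult.commute)
          ultimately have "2 *\<^sub>R (M 1 ** M 2) = 0" by (simp add: scaleR_2)
          then have "M 1 ** M 2 = 0" by simp
          then have "(M 1 ** M 2) *v axis 1 1 = 0" by simp
          then show False
            using invertible_mult_vec_eq_0[OF invertible_mult2[OF invM invM], of 1 2 "axis 1 1"]
            by (simp add: axis_eq_0_iff)
        qed
        ultimately have "eventually (\<lambda>n. B (n, 1) ** B (n, 2) + B (n, 2) ** B (n, 1) \<noteq> 0) sequentially"
          by (rule tendsto_imp_eventually_ne)
        then show ?thesis
        proof eventually_elim
          case (elim n)
          have "hs n (axis 1 1 + axis 2 1) = mclass (B (n, 1) ** B (n, 2))"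
            "hs n (axis 2 1 + axis 1 1) = mclass (B (n, 2) ** B (n, 1))"
            using hs(1)[of n] by (simp_all add: hom_def int_lattice_def B(1) mult_PGL2)
          then have "mclass (B (n, 1) ** B (n, 2)) = mclass (B (n, 2) ** B (n, 1))"
            by (simp only: add.commute)
          then show ?case using elim by (auto simp: mclass_eq_iff)
        qed
      qed
      have aj: "Im (a j) \<noteq> 0" using N(2)[OF C(1)] by (simp add: a_def)
      obtain Q R b where b: "\<And>i. ((\<lambda>n. b n i) \<longlongrightarrow> a i) sequentially"
        and QR: "eventually (\<lambda>n. Q n ** R n = mat 1 \<and> R n ** Q n = mat 1 \<and>
          (\<forall>i. B (n, i) = Q n ** cmat (b n i) ** R n)) sequentially"
        by (rule commuting_near_complex[of G a j "\<lambda>n i. B (n, i)" sequentially, OF G aj _ comm])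
           (use Blim M_def in auto)
      have a0: "a i \<noteq> 0" for i by (simp add: a_def)
      define c where "c n i = toC (C *v axis i 1) + Ln (b n i / a i)" for n i
      have "((\<lambda>n. c n i) \<longlongrightarrow> toC (C *v axis i 1) + Ln (a i / a i)) sequentially" for i
        unfolding c_def by (intro tendsto_add tendsto_const tendsto_Ln tendsto_divide b a0) (simp add: a0)
      then have "((\<lambda>n. c n i) \<longlongrightarrow> toC (C *v axis i 1)) sequentially" for i by (simp add: a0)
      then have "((\<lambda>n. colmat (c n)) \<longlongrightarrow> C) sequentially"
        using tendsto_colmat[of c "\<lambda>i. toC (C *v axis i 1)" sequentially] by (simp only: colmat_columns)
      then have evN: "eventually (\<lambda>n. colmat (c n) \<in> N) sequentially"
        by (rule topological_tendstoD[OF _ N(1) C(1)])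
      have b_nz: "eventually (\<lambda>n. b n i \<noteq> 0) sequentially" for i
        by (rule tendsto_imp_eventually_ne[OF b a0])
      have "eventually (\<lambda>n. hs n \<in> ?S) sequentially"
        using QR evN b_nz[of 1] b_nz[of 2]
      proof eventually_elim
        case (elim n)
        have QR: "Q n ** R n = mat 1" "R n ** Q n = mat 1" "\<And>i. B (n, i) = Q n ** cmat (b n i) ** R n"
          using elim(1) by auto
        have invQ: "invertible (Q n)" unfolding invertible_def using QR by blast
        have RQ: "R n = matrix_inv (Q n)"
          by (rule inverse_unique_matrix[OF QR(1) matrix_inv_mult(2)[OF invQ]])
        have bn: "b n i \<noteq> 0" for i using elim(3,4) exhaust_2[of i] by auto
        have "lexp (colmat (c n)) (axis i 1) = b n i" for i
        proof -
          have "lexp (colmat (c n)) (axis i 1) = a i * exp (Ln (b n i / a i))"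
            by (simp add: lexp_def c_def exp_add a_def)
          then show ?thesis using bn a0 by simp
        qed
        then have "hs n (axis i 1) = mclass (Q n ** cmat (lexp (colmat (c n)) (lattice_vec (axis i 1))) ** matrix_inv (Q n))" for i
          by (simp add: B(1) QR(3) RQ)
        then have "hs n = (\<lambda>\<gamma>. mclass (Q n ** cmat (lexp (colmat (c n)) (lattice_vec \<gamma>)) ** matrix_inv (Q n)))"
          by (rule hom_int_lattice_eqI[OF group_PGL2 hs(1) conj_lin_hol_hom[OF invQ]])
        then have "conj_class PP (hs n) = conj_class PP (lin_hol (colmat (c n)))"
          unfolding lin_hol_def using conj_class_PP_conjugate[OF invQ] by simp
        then show ?case using hs(1) elim(2) by auto
      qed
      then have "\<exists>n. hs n \<in> ?S" by (rule eventually_happens'[OF sequentially_bot])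
      then show False using hs(2) by blast
    qed
    then obtain \<epsilon> where \<epsilon>: "\<epsilon> > 0" "\<forall>h'\<in>hom int_lattice PGL2.
        (\<forall>i. \<exists>B. h' (axis i 1) = mclass B \<and> dist (M i) B < \<epsilon>) \<longrightarrow> h' \<in> ?S" by (elim exE conjE)
    define T where "T i = {h' \<in> topspace (Hom_topology PP).
        h' (axis i 1) \<in> mclass ` (ball (M i) \<epsilon> \<inter> {A. invertible A})}" for i
    have T: "openin (Hom_topology PP) (T i)" for i
    proof -
      have "continuous_map (Hom_topology PP) PGL2_topology (\<lambda>h'. h' (axis i 1))"
        unfolding Hom_topology_def PP_sel
        by (intro continuous_map_from_subtopology continuous_map_product_projection) simp
      then show ?thesis unfolding T_def by (rule openin_continuous_map_preimage[OF _ openin_mclass_ball])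
    qed
    have "h \<in> T i" for i
    proof -
      have "h (axis i 1) = mclass (M i)" by (simp add: h M_def a_def)
      then show ?thesis using hom_h invM \<epsilon>(1) by (simp add: T_def topspace_Hom)
    qed
    moreover have "h' \<in> ?S" if h': "h' \<in> T 1 \<inter> T 2" for h'
    proof -
      have "h' \<in> T i" for i using h' exhaust_2[of i] by auto
      then have img: "h' (axis i 1) \<in> mclass ` (ball (M i) \<epsilon> \<inter> {A. invertible A})" for i
        by (simp only: T_def mem_Collect_eq)
      have "\<exists>B. h' (axis i 1) = mclass B \<and> dist (M i) B < \<epsilon>" for i using img[of i] by auto
      moreover have "h' \<in> hom int_lattice PGL2" using h' by (auto simp: T_def topspace_Hom)
      ultimately show ?thesis using \<epsilon>(2) by blast
    qed
    ultimately show "\<exists>T. openin (Hom_topology PP) T \<and> h \<in> T \<and> T \<subseteq> ?S"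
      by (intro exI[of _ "T 1 \<inter> T 2"] conjI openin_Int T IntI subsetI)
  qed
qed

section \<open>Branched double coverings from involutions\<close>

text \<open>
  The fibres of \<open>f\<close> are the orbits of \<open>\<tau>\<close>, so closed sets and the branch locus can be compared with
  their \<open>\<tau>\<close>-invariant preimages. Near a point \<open>x\<close> that is not fixed, a neighbourhood disjoint from its image
  under \<open>\<tau>\<close> and this image are the two sheets.
\<close>

lemma twofold_branched_covering_if_involution:
  assumes haus: "Hausdorff_space X"
    and cont: "continuous_map X Y f" and opn: "open_map X Y f"
    and surj: "f ` topspace X = topspace Y"
    and \<tau>: "continuous_map X X \<tau>" "\<And>x. x \<in> topspace X \<Longrightarrow> \<tau> (\<tau> x) = x"
    and fibre: "\<And>x x'. x \<in> topspace X \<Longrightarrow> x' \<in> topspace X \<Longrightarrow> f x = f x' \<longleftrightarrow> x' = x \<or> x' = \<tau> x"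
    and fixed: "branch_locus_in X {x \<in> topspace X. \<tau> x = x}"
  shows "twofold_branched_covering X Y f (f ` {x \<in> topspace X. \<tau> x = x})"
proof -
  define A where "A = {x \<in> topspace X. \<tau> x = x}"
  have \<tau>X: "\<tau> x \<in> topspace X" if "x \<in> topspace X" for x
    using \<tau>(1) that by (auto simp: continuous_map_def)
  have A: "closedin X A" "X interior_of A = {}"
    "\<And>x U. openin X U \<Longrightarrow> x \<in> U \<Longrightarrow> \<exists>W. openin X W \<and> x \<in> W \<and> W \<subseteq> U \<and> connectedin X (W - A)"
    using fixed unfolding A_def branch_locus_in_def by auto
  have pre: "f x \<in> f ` A \<longleftrightarrow> x \<in> A" if "x \<in> topspace X" for x
    using fibre that by (auto simp: A_def image_iff; metis)
  have f\<tau>: "f (\<tau> x) = f x" if "x \<in> topspace X" for x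
    using fibre[OF that \<tau>X[OF that]] by simp
  have preX: "{x \<in> topspace X. f x \<in> f ` A} = A" using pre by (auto simp: A_def)
  have clo: "closed_map X Y f"
    unfolding closed_map_def
  proof (intro allI impI)
    fix C assume C: "closedin X C"
    define D where "D = C \<union> {x \<in> topspace X. \<tau> x \<in> C}"
    have "closedin X {x \<in> topspace X. \<tau> x \<in> C}"
      by (rule closedin_continuous_map_preimage[OF \<tau>(1) C])
    then have "openin X (topspace X - D)" using C by (simp add: D_def closedin_Un openin_diff)
    then have "openin Y (f ` (topspace X - D))" using opn by (simp add: open_map_def)
    moreover have "f ` (topspace X - D) = topspace Y - f ` C"
    proof (intro equalityI subsetI)
      fix y assume "y \<in> f ` (topspace X - D)"
      then obtain x where x: "x \<in> topspace X" "x \<notin> D" "y = f x" by blast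
      have "f x \<noteq> f c" if "c \<in> C" for c
      proof -
        have c: "c \<in> topspace X" using C that closedin_subset by blast
        show ?thesis using fibre[OF x(1) c] x that by (auto simp: D_def)
      qed
      then show "y \<in> topspace Y - f ` C" using x surj by auto
    next
      fix y assume y: "y \<in> topspace Y - f ` C"
      then obtain x where x: "x \<in> topspace X" "y = f x" using surj by auto
      have "x \<notin> D" using y x f\<tau>[OF x(1)] by (auto simp: D_def image_iff)
      then show "y \<in> f ` (topspace X - D)" using x by blast
    qed
    moreover have "f ` C \<subseteq> topspace Y" using closedin_subset[OF C] surj by blast
    ultimately show "closedin Y (f ` C)" by (simp add: closedin_def)
  qed
  have "closedin Y (f ` A)" using clo A(1) by (simp add: closed_map_def)
  moreover have "Y interior_of (f ` A) = {}"
  proof (rule ccontr)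
    assume "Y interior_of (f ` A) \<noteq> {}"
    then obtain T y where T: "openin Y T" "T \<subseteq> f ` A" "y \<in> T"
      unfolding interior_of_def by auto
    have "openin X {x \<in> topspace X. f x \<in> T}" by (rule openin_continuous_map_preimage[OF cont T(1)])
    moreover have "{x \<in> topspace X. f x \<in> T} \<subseteq> A" using T(2) preX by blast
    moreover obtain x where x: "x \<in> A" "f x = y" using T by auto
    moreover have "x \<in> {x \<in> topspace X. f x \<in> T}" using x T(3) by (simp add: A_def)
    ultimately have "x \<in> X interior_of A" by (meson interior_of_maximal subsetD)
    then show False using A(2) by simp
  qed
  moreover have "\<exists>W. openin Y W \<and> y \<in> W \<and> W \<subseteq> U \<and> connectedin Y (W - f ` A)"
    if U: "openin Y U" "y \<in> U" for y U
  proof -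
    have "y \<in> topspace Y" using openin_subset[OF U(1)] U(2) by blast
    then have "y \<in> f ` topspace X" by (simp only: surj)
    then obtain x where x: "x \<in> topspace X" "f x = y" by auto
    have pre_open: "openin X {x \<in> topspace X. f x \<in> U}"
      by (rule openin_continuous_map_preimage[OF cont U(1)])
    have x_pre: "x \<in> {x \<in> topspace X. f x \<in> U}" using x U(2) by simp
    obtain W where W: "openin X W" "x \<in> W" "W \<subseteq> {x \<in> topspace X. f x \<in> U}" "connectedin X (W - A)"
      using A(3)[OF pre_open x_pre] by (elim exE conjE)
    have preW: "f w \<in> f ` A \<longleftrightarrow> w \<in> A" if "w \<in> W" for w
      using W(3) that by (intro pre) auto
    have "f ` W - f ` A = f ` (W - A)"
    proof (intro equalityI subsetI)
      fix z assume "z \<in> f ` W - f ` A"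
      then obtain w where "w \<in> W" "z = f w" "f w \<notin> f ` A" by auto
      then show "z \<in> f ` (W - A)" using preW[of w] by simp
    next
      fix z assume "z \<in> f ` (W - A)"
      then obtain w where w: "w \<in> W" "w \<notin> A" "z = f w" by auto
      then have "f w \<notin> f ` A" using preW by simp
      then show "z \<in> f ` W - f ` A" using w by simp
    qed
    then have "connectedin Y (f ` W - f ` A)"
      using connectedin_continuous_map_image[OF cont W(4)] by simp
    moreover have "openin Y (f ` W)" using opn W(1) by (simp add: open_map_def)
    ultimately show ?thesis using W x by (intro exI[of _ "f ` W"]) auto
  qed
  ultimately have brY: "branch_locus_in Y (f ` A)" by (simp add: branch_locus_in_def)
  have unique: "\<exists>!x. x \<in> topspace X \<and> f x = y" if y_in: "y \<in> f ` A" for y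
  proof -
    obtain x where x: "x \<in> A" "y = f x" using y_in by auto
    show ?thesis
    proof (rule ex1I[of _ x])
      show "x \<in> topspace X \<and> f x = y" using x by (simp add: A_def)
      fix z assume z: "z \<in> topspace X \<and> f z = y"
      then show "z = x" using x fibre[of x z] by (auto simp: A_def)
    qed
  qed
  define X' where "X' = subtopology X {x \<in> topspace X. f x \<notin> f ` A}"
  define Y' where "Y' = subtopology Y (topspace Y - f ` A)"
  have X': "{x \<in> topspace X. f x \<notin> f ` A} = topspace X - A" using pre by auto
  have topX': "topspace X' = topspace X - A" by (auto simp: X'_def X')
  have cov: "covering_of_degree 2 X' Y' f"
    unfolding covering_of_degree_def
  proof (intro conjI ballI)
    show "continuous_map X' Y' f"
      unfolding X'_def Y'_def
      by (intro continuous_map_into_subtopology continuous_map_from_subtopology cont)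
         (use cont in \<open>auto simp: continuous_map_def\<close>)
    fix y assume "y \<in> topspace Y'"
    then have "y \<in> topspace Y" "y \<notin> f ` A" by (auto simp: Y'_def)
    then have "y \<in> f ` topspace X" by (simp only: surj)
    then obtain x where x: "x \<in> topspace X" "y = f x" "x \<notin> A" using \<open>y \<notin> f ` A\<close> by auto
    then have "\<tau> x \<noteq> x" by (auto simp: A_def)
    then obtain U1 U2 where U: "openin X U1" "openin X U2" "x \<in> U1" "\<tau> x \<in> U2" "disjnt U1 U2"
      using haus x(1) \<tau>X[OF x(1)] unfolding Hausdorff_space_def by metis
    define S1 where "S1 = U1 \<inter> {x \<in> topspace X. \<tau> x \<in> U2} \<inter> (topspace X - A)"
    define S2 where "S2 = {x \<in> topspace X. \<tau> x \<in> S1}"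
    have S1: "openin X S1" unfolding S1_def
      by (intro openin_Int openin_diff openin_topspace U A openin_continuous_map_preimage[OF \<tau>(1)])
    then have S2: "openin X S2" unfolding S2_def by (rule openin_continuous_map_preimage[OF \<tau>(1)])
    have sub: "S1 \<subseteq> topspace X - A" "S2 \<subseteq> topspace X - A"
      using \<tau>(2) by (auto simp: S1_def S2_def A_def)
    have "S2 \<subseteq> U2" using \<tau>(2) by (auto simp: S1_def S2_def)
    then have disj: "S1 \<inter> S2 = {}" using U(5) by (auto simp: S1_def disjnt_def)
    have xS: "x \<in> S1" using x U by (auto simp: S1_def)
    have \<tau>S: "\<tau> z \<in> S2 \<longleftrightarrow> z \<in> S1" "\<tau> z \<in> S1 \<longleftrightarrow> z \<in> S2" if "z \<in> topspace X" for z
      using that \<tau>X \<tau>(2) by (auto simp: S2_def)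
    define V where "V = f ` S1"
    have VS2: "f ` S2 = V"
    proof (intro equalityI subsetI)
      fix w assume "w \<in> f ` S2"
      then obtain z where z: "z \<in> S2" "w = f z" by auto
      then have "\<tau> z \<in> S1" "f (\<tau> z) = w" using sub(2) \<tau>S(2)[of z] f\<tau>[of z] by auto
      then show "w \<in> V" unfolding V_def by (metis imageI)
    next
      fix w assume "w \<in> V"
      then obtain z where z: "z \<in> S1" "w = f z" unfolding V_def by auto
      then have "\<tau> z \<in> S2" "f (\<tau> z) = w" using sub(1) \<tau>S(1)[of z] f\<tau>[of z] by auto
      then show "w \<in> f ` S2" by (metis imageI)
    qed
    have V: "openin Y V" using opn S1 by (simp add: open_map_def V_def)
    have "V \<subseteq> topspace Y - f ` A" using sub(1) pre openin_subset[OF V] by (auto simp: V_def)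
    then have V': "openin Y' V" using V by (auto simp: Y'_def openin_subtopology)
    have YV: "subtopology Y' V = subtopology Y V"
      using \<open>V \<subseteq> topspace Y - f ` A\<close> by (simp add: Y'_def subtopology_subtopology Int_absorb1)
    have preV: "S1 \<union> S2 = {z \<in> topspace X'. f z \<in> V}"
    proof (intro equalityI subsetI)
      fix z assume "z \<in> S1 \<union> S2"
      then show "z \<in> {z \<in> topspace X'. f z \<in> V}" using sub VS2 by (auto simp: topX' V_def)
    next
      fix z assume "z \<in> {z \<in> topspace X'. f z \<in> V}"
      then obtain w where z: "z \<in> topspace X" and w: "w \<in> S1" "f w = f z"
        unfolding topX' V_def by auto
      then have "z = w \<or> z = \<tau> w" using fibre[of w z] sub(1) by auto
      then show "z \<in> S1 \<union> S2" using w(1) \<tau>S(1)[of w] sub(1) by auto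
    qed
    have sheet: "openin X' S \<and> homeomorphic_map (subtopology X' S) (subtopology Y' V) f"
      if S: "openin X S" "S \<subseteq> topspace X - A" "f ` S = V" "S \<inter> {z \<in> topspace X. \<tau> z \<in> S} = {}" for S
    proof
      show "openin X' S" using S by (auto simp: X'_def X' openin_subtopology)
      have XS: "subtopology X' S = subtopology X S"
        using S(2) by (simp add: X'_def X' subtopology_subtopology Int_absorb1)
      have topS: "topspace (subtopology X S) = S" using S(2) by auto
      have "inj_on f S"
      proof (rule inj_onI)
        fix a b assume ab: "a \<in> S" "b \<in> S" "f a = f b"
        then have "b = a \<or> b = \<tau> a" using fibre[of a b] S(2) by auto
        then show "a = b" using ab S(2,4) by auto
      qed
      then show "homeomorphic_map (subtopology X' S) (subtopology Y' V) f"
        unfolding XS YV using V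
        by (intro bijective_open_imp_homeomorphic_map continuous_map_into_subtopology
            continuous_map_from_subtopology cont open_map_into_subtopology
            open_map_from_subtopology opn S(1))
           (use S(3) topS openin_subset[OF V] in auto)
    qed
    have "openin X' S1 \<and> homeomorphic_map (subtopology X' S1) (subtopology Y' V) f"
      by (rule sheet[OF S1 sub(1)]) (use disj in \<open>auto simp: V_def S2_def\<close>)
    moreover have "openin X' S2 \<and> homeomorphic_map (subtopology X' S2) (subtopology Y' V) f"
      by (rule sheet[OF S2 sub(2) VS2]) (use disj \<tau>S(1) in auto)
    moreover have "S1 \<noteq> S2" using xS disj by auto
    moreover have "disjoint {S1, S2}" using disj by (auto simp: disjoint_def)
    ultimately have sheets: "finite {S1, S2} \<and> card {S1, S2} = 2 \<and> disjoint {S1, S2} \<and>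
        \<Union>{S1, S2} = {x \<in> topspace X'. f x \<in> V} \<and>
        (\<forall>S\<in>{S1, S2}. openin X' S \<and> homeomorphic_map (subtopology X' S) (subtopology Y' V) f)"
      using preV by simp
    have "y \<in> V" using xS x(2) by (simp add: V_def)
    moreover have "\<exists>\<S>. finite \<S> \<and> card \<S> = 2 \<and> disjoint \<S> \<and> \<Union>\<S> = {x \<in> topspace X'. f x \<in> V} \<and>
        (\<forall>S\<in>\<S>. openin X' S \<and> homeomorphic_map (subtopology X' S) (subtopology Y' V) f)"
      using sheets by (rule exI[of _ "{S1, S2}"])
    ultimately show "\<exists>V. openin Y' V \<and> y \<in> V \<and> (\<exists>\<S>. finite \<S> \<and> card \<S> = 2 \<and> disjoint \<S> \<and>
        \<Union>\<S> = {x \<in> topspace X'. f x \<in> V} \<and>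
        (\<forall>S\<in>\<S>. openin X' S \<and> homeomorphic_map (subtopology X' S) (subtopology Y' V) f))"
      using V' by (intro exI[of _ V] conjI)
  qed
  have "branch_locus_in X A" using fixed by (simp only: A_def)
  then show ?thesis
    unfolding twofold_branched_covering_def A_def[symmetric] preX
    using cont opn clo brY unique cov unfolding X'_def Y'_def by simp
qed

lemma branch_locus_in_homeomorphic_image:
  assumes g: "homeomorphic_map X X' g" and A: "branch_locus_in X A"
  shows "branch_locus_in X' (g ` A)"
proof -
  have A: "closedin X A" "X interior_of A = {}"
    "\<And>x U. openin X U \<Longrightarrow> x \<in> U \<Longrightarrow> \<exists>W. openin X W \<and> x \<in> W \<and> W \<subseteq> U \<and> connectedin X (W - A)"
    using A unfolding branch_locus_in_def by auto
  have cont: "continuous_map X X' g" and opn: "open_map X X' g"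
    and surj: "g ` topspace X = topspace X'" and inj: "inj_on g (topspace X)"
    using g by (auto simp: homeomorphic_imp_continuous_map homeomorphic_imp_open_map
        homeomorphic_imp_surjective_map homeomorphic_imp_injective_map)
  have AX: "A \<subseteq> topspace X" by (rule closedin_subset[OF A(1)])
  have "closedin X' (g ` A)" using g A(1) homeomorphic_map_closedness AX by blast
  moreover have "X' interior_of (g ` A) = {}"
    using homeomorphic_map_interior_of[OF g AX] A(2) by simp
  moreover have "\<exists>W. openin X' W \<and> y \<in> W \<and> W \<subseteq> U \<and> connectedin X' (W - g ` A)"
    if U: "openin X' U" "y \<in> U" for y U
  proof -
    have "y \<in> g ` topspace X" using openin_subset[OF U(1)] U(2) by (auto simp only: surj)
    then obtain x where x: "x \<in> topspace X" "g x = y" by auto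
    have pre_open: "openin X {x \<in> topspace X. g x \<in> U}"
      by (rule openin_continuous_map_preimage[OF cont U(1)])
    have x_pre: "x \<in> {x \<in> topspace X. g x \<in> U}" using x U(2) by simp
    obtain W where W: "openin X W" "x \<in> W" "W \<subseteq> {x \<in> topspace X. g x \<in> U}" "connectedin X (W - A)"
      using A(3)[OF pre_open x_pre] by (elim exE conjE)
    have "g ` W - g ` A = g ` (W - A)"
      using inj_on_image_set_diff[OF inj, of W A] W(3) AX by auto
    then have "connectedin X' (g ` W - g ` A)"
      using connectedin_continuous_map_image[OF cont W(4)] by simp
    moreover have "openin X' (g ` W)" using opn W(1) by (simp add: open_map_def)
    ultimately show ?thesis using W x by (intro exI[of _ "g ` W"]) auto
  qed
  ultimately show ?thesis by (simp add: branch_locus_in_def)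
qed

text \<open>
  A plane of codimension two does not separate: in a product of balls about one of its points, its
  complement is the product of a disc and a punctured disc.
\<close>

lemma branch_locus_in_matrix_row:
  fixes N :: "(real^2^2) set" and r :: "real^2"
  assumes N: "open N"
  shows "branch_locus_in (top_of_set N) {C \<in> N. C $ 2 = r}"
proof -
  define B where "B = {C :: real^2^2. C $ 2 = r}"
  have eq: "{C \<in> N. C $ 2 = r} = N \<inter> B" by (auto simp: B_def)
  have clB: "closed B" unfolding B_def by (intro closed_Collect_eq continuous_intros)
  then have "closedin (top_of_set N) (N \<inter> B)" by (simp add: closedin_closed_Int)
  moreover have "top_of_set N interior_of (N \<inter> B) = {}"
  proof (rule ccontr)
    assume "top_of_set N interior_of (N \<inter> B) \<noteq> {}"
    then obtain T C where "openin (top_of_set N) T" "T \<subseteq> N \<inter> B" "C \<in> T"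
      unfolding interior_of_def by blast
    then have "open T" using N openin_open_trans by blast
    then obtain e where e: "e > 0" "ball C e \<subseteq> T" using \<open>C \<in> T\<close> openE by blast
    define E :: "real^2^2" where "E = axis 2 (axis 1 (e/2))"
    have "norm E = e / 2" using e(1) by (simp add: E_def norm_vec_def L2_set_def sum_2 axis_def)
    then have "C + E \<in> ball C e" using e(1) by (simp add: dist_norm)
    then have "C + E \<in> B" "C \<in> B" using e(2) \<open>T \<subseteq> N \<inter> B\<close> \<open>C \<in> T\<close> by auto
    then have "E $ 2 = 0" by (simp add: B_def)
    then have "E $ 2 $ 1 = 0" by simp
    then show False using e(1) by (simp add: E_def axis_def)
  qed
  moreover have "\<exists>W. openin (top_of_set N) W \<and> C \<in> W \<and> W \<subseteq> U \<and> connectedin (top_of_set N) (W - N \<inter> B)"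
    if U: "openin (top_of_set N) U" "C \<in> U" for C U
  proof -
    have "open U" "U \<subseteq> N" using U(1) N openin_open_trans openin_imp_subset by blast+
    show ?thesis
    proof (cases "C \<in> B")
      case False
      have "open (U - B)" using \<open>open U\<close> clB by (rule open_Diff)
      then obtain e where e: "e > 0" "ball C e \<subseteq> U - B" using False U(2) openE by blast
      then have "ball C e - N \<inter> B = ball C e" by blast
      then have "connectedin (top_of_set N) (ball C e - N \<inter> B)"
        using e(2) \<open>U \<subseteq> N\<close> by (auto simp: connectedin_subtopology)
      moreover have "openin (top_of_set N) (ball C e)" using e \<open>U \<subseteq> N\<close> by (intro open_subset) auto
      ultimately show ?thesis using e by (intro exI[of _ "ball C e"]) auto
    next
      case True
      then have C2: "C $ 2 = r" by (simp add: B_def)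
      obtain e where e: "e > 0" "ball C e \<subseteq> U" using \<open>open U\<close> U(2) openE by blast
      define W where "W = {M :: real^2^2. M $ 1 \<in> ball (C $ 1) (e/2) \<and> M $ 2 \<in> ball r (e/2)}"
      have "W = (\<lambda>M. M $ 1) -` ball (C $ 1) (e/2) \<inter> (\<lambda>M. M $ 2) -` ball r (e/2)"
        by (auto simp: W_def)
      then have oW: "open W" by (auto intro!: open_Int open_vimage continuous_intros)
      have "W \<subseteq> ball C e"
      proof
        fix M assume M: "M \<in> W"
        have "norm (C - M) \<le> norm ((C - M) $ 1) + norm ((C - M) $ 2)"
          unfolding norm_vec_def by (rule order_trans[OF L2_set_le_sum]) (simp_all add: sum_2)
        also have "\<dots> < e" using M C2 by (simp add: W_def dist_norm)
        finally show "M \<in> ball C e" by (simp add: dist_norm)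
      qed
      then have WU: "W \<subseteq> U" using e(2) by blast
      have "W - N \<inter> B = (\<lambda>(u, v). vector [u, v]) ` (ball (C $ 1) (e/2) \<times> (ball r (e/2) - {r}))"
      proof (intro equalityI subsetI)
        fix M assume M: "M \<in> W - N \<inter> B"
        then have "M \<in> N" using WU \<open>U \<subseteq> N\<close> by blast
        then have "M $ 2 \<noteq> r" using M by (simp add: B_def)
        moreover have "M = vector [M $ 1, M $ 2]" by (simp add: vec_eq_iff[of M] forall_2)
        ultimately show "M \<in> (\<lambda>(u, v). vector [u, v]) ` (ball (C $ 1) (e/2) \<times> (ball r (e/2) - {r}))"
          using M by (intro image_eqI[of _ _ "(M $ 1, M $ 2)"]) (auto simp: W_def)
      qed (auto simp: W_def B_def)
      moreover have "connected ((\<lambda>(u, v). vector [u, v] :: real^2^2) `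
          (ball (C $ 1) (e/2) \<times> (ball r (e/2) - {r})))"
      proof (rule connected_continuous_image)
        have "(\<lambda>(u, v). vector [u, v] :: real^2^2) = (\<lambda>p. \<chi> i. if i = 1 then fst p else snd p)"
          by (auto simp: fun_eq_iff vec_eq_iff forall_2)
        moreover have "continuous_on S (\<lambda>p :: (real^2) \<times> (real^2). \<chi> i::2. if i = 1 then fst p else snd p)" for S
        proof (rule continuous_on_vec_lambda)
          show "continuous_on S (\<lambda>p :: (real^2) \<times> (real^2). if i = 1 then fst p else snd p)" for i :: 2
            by (cases "i = 1") (auto intro!: continuous_intros)
        qed
        ultimately show "continuous_on (ball (C $ 1) (e/2) \<times> (ball r (e/2) - {r}))
            (\<lambda>(u, v). vector [u, v] :: real^2^2)" by simp
        show "connected (ball (C $ 1) (e/2) \<times> (ball r (e/2) - {r}))"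
          by (intro connected_Times connected_punctured_ball) auto
      qed
      ultimately have "connected (W - N \<inter> B)" by simp
      then have "connectedin (top_of_set N) (W - N \<inter> B)"
        using WU \<open>U \<subseteq> N\<close> by (auto simp: connectedin_subtopology)
      moreover have "openin (top_of_set N) W" using oW WU \<open>U \<subseteq> N\<close> by (intro open_subset) auto
      moreover have "C \<in> W" using e(1) C2 by (simp add: W_def)
      ultimately show ?thesis using WU by blast
    qed
  qed
  ultimately show ?thesis unfolding eq by (simp add: branch_locus_in_def)
qed

section \<open>Markings of the torus\<close>

lemma linear_axis_smooth_family:
  fixes u :: "real \<Rightarrow> real"
  assumes "(u has_real_derivative u') (at (v $ 1))"
  shows "((\<lambda>v :: real^2. vector [u (v $ 1), a * v $ 2 + b] :: real^2) has_derivative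
           (\<lambda>h. vector [u' * h $ 1, a * h $ 2])) (at v)"
proof -
  have "((\<lambda>v :: real^2. v $ 1) has_derivative (\<lambda>h. h $ 1)) (at v)"
    by (rule bounded_linear_imp_has_derivative[OF bounded_linear_vec_nth])
  moreover have "(u has_derivative (\<lambda>h. u' * h)) (at (v $ 1))"
    using assms by (simp add: has_field_derivative_def)
  ultimately have 1: "((\<lambda>v :: real^2. u (v $ 1)) has_derivative (\<lambda>h. u' * h $ 1)) (at v)"
    by (rule has_derivative_compose)
  have 2: "((\<lambda>v :: real^2. a * v $ 2 + b) has_derivative (\<lambda>h. a * h $ 2)) (at v)"
  proof -
    have "((\<lambda>v :: real^2. v $ 2) has_derivative (\<lambda>h. h $ 2)) (at v)"
      by (rule bounded_linear_imp_has_derivative[OF bounded_linear_vec_nth])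
    then have "((\<lambda>v :: real^2. a * v $ 2) has_derivative (\<lambda>h. a * h $ 2)) (at v)"
      by (rule has_derivative_mult_right)
    from has_derivative_add[OF this has_derivative_const[of b]] show ?thesis by simp
  qed
  have "((\<lambda>v :: real^2. u (v $ 1) *\<^sub>R axis 1 1 + (a * v $ 2 + b) *\<^sub>R axis 2 1 :: real^2) has_derivative
      (\<lambda>h. (u' * h $ 1) *\<^sub>R axis 1 1 + (a * h $ 2) *\<^sub>R axis 2 1)) (at v)"
    by (intro has_derivative_add has_derivative_scaleR_left 1 2)
  moreover have "vector [p, q] = p *\<^sub>R axis 1 1 + q *\<^sub>R (axis 2 1 :: real^2)" for p q :: real
    by (simp add: vec_eq_iff forall_2 axis_def)
  ultimately show ?thesis by simp
qed

text \<open>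
  Maps \<open>(r, \<theta>) \<mapsto> (u r, a \<theta> + b)\<close> with \<open>u\<close> in a family closed under derivatives form a family closed under
  partial derivatives. This gives smoothness of the passage from polar to logarithmic coordinates.
\<close>

lemma smooth_on_first_coordinate:
  fixes U :: "(real \<Rightarrow> real) set"
  assumes S: "open S" and u: "u \<in> U"
    and U: "\<And>u. u \<in> U \<Longrightarrow> \<exists>u'\<in>U. \<forall>v\<in>S. (u has_real_derivative u' (v $ 1)) (at (v $ 1))"
    and U0: "(\<lambda>_. 0) \<in> U"
  shows "smooth_on S (\<lambda>v :: real^2. vector [u (v $ 1), v $ 2] :: real^2)"
proof (rule smooth_onI_family[OF S])
  let ?F = "{\<lambda>v :: real^2. vector [u (v $ 1), a * v $ 2 + b] :: real^2 | u a b. u \<in> U}"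
  have "(\<lambda>v :: real^2. vector [u (v $ 1), 1 * v $ 2 + 0] :: real^2) \<in> ?F" using u by blast
  then show "(\<lambda>v :: real^2. vector [u (v $ 1), v $ 2] :: real^2) \<in> ?F" by simp
  show "g differentiable (at v)" if g_in: "g \<in> ?F" and v: "v \<in> S" for g v
  proof -
    obtain u a b where g: "g = (\<lambda>v :: real^2. vector [u (v $ 1), a * v $ 2 + b])" "u \<in> U"
      using g_in unfolding mem_Collect_eq by (elim exE conjE)
    obtain u' where "(u has_real_derivative u' (v $ 1)) (at (v $ 1))" using U[OF g(2)] v by auto
    then show ?thesis unfolding g(1) by (intro differentiableI[OF linear_axis_smooth_family])
  qed
  show "\<exists>g'\<in>?F. \<forall>v\<in>S. frechet_derivative g (at v) (axis j 1) = g' v" if g_in: "g \<in> ?F" for g j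
  proof -
    obtain u a b where g: "g = (\<lambda>v :: real^2. vector [u (v $ 1), a * v $ 2 + b])" "u \<in> U"
      using g_in unfolding mem_Collect_eq by (elim exE conjE)
    obtain u' where u': "u' \<in> U" "\<And>v. v \<in> S \<Longrightarrow> (u has_real_derivative u' (v $ 1)) (at (v $ 1))"
      using U[OF g(2)] by auto
    have D: "frechet_derivative g (at v) (axis j 1) =
        vector [u' (v $ 1) * axis j 1 $ 1, a * axis j 1 $ 2]" if "v \<in> S" for v
      unfolding g(1)
      by (rule conjunct2[OF has_derivative_imp_frechet_derivative_eq[OF linear_axis_smooth_family[OF u'(2)[OF that]]]])
         simp
    consider "j = 1" | "j = 2" using exhaust_2 by blast
    then show ?thesis
    proof cases
      case 1
      have "(\<lambda>v :: real^2. vector [u' (v $ 1), 0 * v $ 2 + 0] :: real^2) \<in> ?F" using u'(1) by blast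
      moreover have "frechet_derivative g (at v) (axis j 1) = vector [u' (v $ 1), 0 * v $ 2 + 0]"
        if "v \<in> S" for v unfolding D[OF that] by (simp add: 1 axis_def)
      ultimately show ?thesis by (intro bexI ballI)
    next
      case 2
      have "(\<lambda>v :: real^2. vector [(\<lambda>_. 0) (v $ 1), 0 * v $ 2 + a] :: real^2) \<in> ?F"
        by (rule CollectI, rule exI[of _ "\<lambda>_. 0"], rule exI[of _ 0], rule exI[of _ a]) (simp add: U0)
      moreover have "frechet_derivative g (at v) (axis j 1) = vector [(\<lambda>_. 0) (v $ 1), 0 * v $ 2 + a]"
        if "v \<in> S" for v unfolding D[OF that] by (simp add: 2 axis_def)
      ultimately show ?thesis by (intro bexI ballI)
    qed
  qed
qed

lemma local_diffeo_at_log_radius: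
  assumes "p \<in> polar_half_plane"
  shows "local_diffeo_at (\<lambda>v. vector [ln (v $ 1), v $ 2]) p"
proof -
  have oh: "open polar_half_plane" unfolding polar_half_plane_def
    by (intro open_Collect_less continuous_intros)
  have "smooth_on polar_half_plane (\<lambda>v :: real^2. vector [ln (v $ 1), v $ 2] :: real^2)"
  proof (rule smooth_on_first_coordinate[OF oh, of ln "insert ln {\<lambda>r. c * inverse r ^ n | c n. True}"])
    have z: "(\<lambda>r :: real. 0 * inverse r ^ 0) \<in> {\<lambda>r. c * inverse r ^ n | c n. True}" by blast
    then show "(\<lambda>_. 0 :: real) \<in> insert ln {\<lambda>r. c * inverse r ^ n | c n. True}" by simp
    fix u :: "real \<Rightarrow> real" assume u_in: "u \<in> insert ln {\<lambda>r. c * inverse r ^ n | c n. True}"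
    then consider "u = ln" | c n where "u = (\<lambda>r. c * inverse r ^ n)"
      unfolding insert_iff mem_Collect_eq by (elim disjE exE conjE)
    then show "\<exists>u'\<in>insert ln {\<lambda>r. c * inverse r ^ n | c n. True}.
        \<forall>v\<in>polar_half_plane. (u has_real_derivative u' (v $ 1)) (at (v $ 1))"
    proof cases
      case 1
      have "(\<lambda>r :: real. 1 * inverse r ^ 1) \<in> {\<lambda>r. c * inverse r ^ n | c n. True}" by blast
      moreover have "(u has_real_derivative 1 * inverse (v $ 1) ^ 1) (at (v $ 1))"
        if "v \<in> polar_half_plane" for v
        unfolding 1 using that by (auto simp: polar_half_plane_def intro!: derivative_eq_intros simp: field_simps)
      ultimately show ?thesis by (intro bexI[of _ "\<lambda>r. 1 * inverse r ^ 1"] insertI2 ballI)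
    next
      case 2
      let ?u' = "\<lambda>r :: real. (- c * real n) * inverse r ^ (n + 1)"
      have "?u' \<in> {\<lambda>r. c * inverse r ^ n | c n. True}" by blast
      moreover have "(u has_real_derivative ?u' (v $ 1)) (at (v $ 1))" if v: "v \<in> polar_half_plane" for v
      proof -
        have "v $ 1 \<noteq> 0" using v by (simp add: polar_half_plane_def)
        then have "((\<lambda>r. inverse r ^ n) has_real_derivative
            real n * (- (inverse (v $ 1) ^ Suc (Suc 0)) * inverse (v $ 1) ^ (n - Suc 0))) (at (v $ 1))"
          by (intro DERIV_power DERIV_inverse)
        then have "(u has_real_derivative
            c * (real n * (- (inverse (v $ 1) ^ Suc (Suc 0)) * inverse (v $ 1) ^ (n - Suc 0)))) (at (v $ 1))"
          unfolding 2 by (rule DERIV_cmult)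
        moreover have "c * (real n * (- (inverse (v $ 1) ^ Suc (Suc 0)) * inverse (v $ 1) ^ (n - Suc 0))) = ?u' (v $ 1)"
          by (cases n) (simp_all add: algebra_simps)
        ultimately show ?thesis by (simp only:)
      qed
      ultimately show ?thesis by (intro bexI[of _ ?u'] insertI2 ballI)
    qed
  qed simp
  moreover have "smooth_on UNIV (\<lambda>v :: real^2. vector [exp (v $ 1), v $ 2] :: real^2)"
  proof (rule smooth_on_first_coordinate[OF open_UNIV, of exp "{\<lambda>r. c * exp r | c. True}"])
    have "(\<lambda>r :: real. 1 * exp r) \<in> {\<lambda>r. c * exp r | c. True}" by blast
    then show "(exp :: real \<Rightarrow> real) \<in> {\<lambda>r. c * exp r | c. True}" by simp
    have "(\<lambda>r :: real. 0 * exp r) \<in> {\<lambda>r. c * exp r | c. True}" by blast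
    then show "(\<lambda>_. 0 :: real) \<in> {\<lambda>r. c * exp r | c. True}" by simp
    fix u :: "real \<Rightarrow> real" assume u_in: "u \<in> {\<lambda>r. c * exp r | c. True}"
    then obtain c where c: "u = (\<lambda>r. c * exp r)" unfolding mem_Collect_eq by (elim exE conjE)
    have "(u has_real_derivative u x) (at x)" for x unfolding c by (auto intro!: derivative_eq_intros)
    then show "\<exists>u'\<in>{\<lambda>r. c * exp r | c. True}. \<forall>v\<in>UNIV. (u has_real_derivative u' ((v :: real^2) $ 1)) (at (v $ 1))"
      by (intro bexI[OF _ u_in] ballI)
  qed
  ultimately have "smooth_inverse polar_half_plane UNIV
      (\<lambda>v. vector [ln (v $ 1), v $ 2]) (\<lambda>v. vector [exp (v $ 1), v $ 2])"
    by (auto simp: smooth_inverse_def polar_half_plane_def vec_eq_iff forall_2)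
  then show ?thesis by (rule local_diffeo_atI[OF _ assms])
qed

lemma ln_power_int: "lam > 0 \<Longrightarrow> ln (lam powi l) = of_int l * ln lam" for lam :: real
  by (auto simp: power_int_def ln_realpow ln_inverse)

text \<open>
  In the coordinates \<open>L = ln r + \<i> \<theta>\<close>, the deck transformations are translations by elements of the lattice spanned by
  \<open>ln lam\<close> and \<open>\<i> \<pi> / 2\<close>, which contains \<open>2 \<pi> k \<i>\<close>. So \<open>L (x + \<gamma>) - L x\<close> takes values in a
  discrete set and does not depend on \<open>x\<close>; this yields \<open>C\<close> and \<open>m\<close>. All elements of that lattice occur:
  hence \<open>C\<close> is invertible, and the integers \<open>m\<^sub>i\<close> are not both even.
\<close>

lemma marking_linear:
  fixes F :: "real^2 \<Rightarrow> real^2"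
  assumes lam: "lam > 0" "lam \<noteq> 1" and F: "H_marking lam (pi / 2) k F"
  obtains C m j \<phi> where "invertible C" "\<And>i. C $ 2 $ i = of_int (m i) * (pi / 2)" "odd (m j)"
    "\<phi> \<in> Diff1_lifts" "\<And>x. polar_map (F x) = ofC (lexp C (\<phi> x))"
proof -
  have dF: "diffeomorphism_between UNIV polar_half_plane F"
    and rel: "\<And>x y. torus_proj x = torus_proj y \<longleftrightarrow> H_rel lam (pi / 2) k (F x) (F y)"
    using F by (auto simp: H_marking_def)
  have bijF: "bij_betw F UNIV polar_half_plane" using dF by (simp add: diffeomorphism_between_def)
  have Fpos: "F x \<in> polar_half_plane" for x using bij_betwE[OF bijF] by simp
  then have Fpos': "F x $ 1 > 0" for x by (simp add: polar_half_plane_def)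
  define L where "L x = Complex (ln (F x $ 1)) (F x $ 2)" for x
  have ofL: "ofC (L x) = vector [ln (F x $ 1), F x $ 2]" for x
    by (simp add: vec_eq_iff forall_2 L_def)
  have locF: "local_diffeo_at F x" for x unfolding local_diffeo_at_iff using dF by blast
  have locL: "local_diffeo_at (\<lambda>x. ofC (L x)) x" for x
    unfolding ofL by (rule local_diffeo_at_compose[OF locF local_diffeo_at_log_radius[OF Fpos]])
  have expL: "polar_map (F x) = ofC (exp (L x))" for x
    using Fpos'[of x] by (simp add: vec_eq_iff forall_2 polar_map_def L_def Re_exp Im_exp)
  have loc: "local_diffeo_at (\<lambda>x. ofC (exp (L x))) x" for x
    using local_diffeo_at_compose[OF locL local_diffeo_at_exp] by simp
  have Lcont: "continuous_on UNIV L"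
  proof -
    have "continuous_on UNIV (\<lambda>x. ofC (L x))"
      using local_diffeo_at_imp_isCont[OF locL] by (simp add: continuous_at_imp_continuous_on)
    then have "continuous_on UNIV (\<lambda>x. toC (ofC (L x)))" by (rule continuous_on_toC)
    then show ?thesis by simp
  qed
  have lnlam: "ln lam \<noteq> 0" using lam by simp
  have diff: "\<exists>l m :: int. L (x + lattice_vec \<gamma>) - L x = Complex (of_int l * ln lam) (of_int m * (pi / 2))" for x \<gamma>
  proof -
    have "torus_proj x = torus_proj (x + lattice_vec \<gamma>)" unfolding torus_proj_eq_iff by blast
    then obtain l m n :: int where *: "F (x + lattice_vec \<gamma>) $ 1 = lam powi l * F x $ 1"
      "F (x + lattice_vec \<gamma>) $ 2 = F x $ 2 + of_int m * (pi / 2) + of_int n * (2 * pi * real k)"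
      unfolding rel H_rel_def by (elim exE conjE)
    have "ln (lam powi l * F x $ 1) = of_int l * ln lam + ln (F x $ 1)"
      using lam Fpos'[of x] by (simp add: ln_mult ln_power_int)
    moreover have "of_int m * (pi / 2) + of_int n * (2 * pi * real k) = of_int (m + 4 * n * int k) * (pi / 2)"
      by (simp add: algebra_simps)
    ultimately show ?thesis
      by (intro exI[of _ l] exI[of _ "m + 4 * n * int k"]) (simp add: L_def * complex_eq_iff)
  qed
  have const: "L (x + lattice_vec \<gamma>) - L x = L (0 + lattice_vec \<gamma>) - L 0" for x \<gamma>
  proof -
    have cs: "continuous_on UNIV (\<lambda>x. L (x + lattice_vec \<gamma>))"
      by (intro continuous_on_compose2[OF Lcont] continuous_intros) auto
    let ?re = "\<lambda>x. complex_of_real (2 * pi / ln lam * Re (L (x + lattice_vec \<gamma>) - L x)) * \<i>"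
    let ?im = "\<lambda>x. complex_of_real (4 * Im (L (x + lattice_vec \<gamma>) - L x)) * \<i>"
    have e: "exp (?re x) = 1" "exp (?im x) = 1" for x
    proof -
      obtain l m :: int where d: "L (x + lattice_vec \<gamma>) - L x = Complex (of_int l * ln lam) (of_int m * (pi / 2))"
        using diff by blast
      have "2 * pi / ln lam * (of_int l * ln lam) = 2 * of_int l * pi" using lnlam by simp
      then show "exp (?re x) = 1" unfolding d complex.sel
        by (metis exp_integer_2pi Ints_of_int mult.commute mult.assoc of_real_mult of_real_numeral of_real_of_int_eq)
      have "4 * (of_int m * (pi / 2)) = 2 * of_int m * pi" by simp
      then show "exp (?im x) = 1" unfolding d complex.sel
        by (metis exp_integer_2pi Ints_of_int mult.commute mult.assoc of_real_mult of_real_numeral of_real_of_int_eq)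
    qed
    have "?re x = ?re 0"
      by (rule continuous_exp_constant[OF connected_UNIV _ e(1) UNIV_I UNIV_I])
         (intro continuous_intros cs Lcont)
    moreover have "?im x = ?im 0"
      by (rule continuous_exp_constant[OF connected_UNIV _ e(2) UNIV_I UNIV_I])
         (intro continuous_intros cs Lcont)
    ultimately show ?thesis using lnlam by (simp add: complex_eq_iff)
  qed
  have "\<exists>lm :: int \<times> int. L (0 + lattice_vec (axis i 1)) - L 0 =
      Complex (of_int (fst lm) * ln lam) (of_int (snd lm) * (pi / 2))" for i
    using diff[of 0 "axis i 1"] by auto
  then obtain lm :: "2 \<Rightarrow> int \<times> int" where lm: "\<And>i. L (0 + lattice_vec (axis i 1)) - L 0 =
      Complex (of_int (fst (lm i)) * ln lam) (of_int (snd (lm i)) * (pi / 2))" by metis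
  define c where "c i = Complex (of_int (fst (lm i)) * ln lam) (of_int (snd (lm i)) * (pi / 2))" for i
  define C where "C = colmat c"
  have gen: "L (x + axis i 1) = L x + c i" for x i
  proof -
    have "L (x + lattice_vec (axis i 1)) - L x = c i"
      by (rule trans[OF const]) (simp only: lm c_def)
    then show ?thesis by (simp add: diff_eq_eq add.commute)
  qed
  have equi: "L (x + lattice_vec \<gamma>) = L x + toC (C *v lattice_vec \<gamma>)" for x \<gamma>
    unfolding C_def by (rule lattice_equivariant_from_generators[OF gen])
  \<comment> \<open>Points in one orbit of the deck group are images of points which differ by a lattice vector.\<close>
  have surj: "\<exists>\<gamma>. C *v lattice_vec \<gamma> = vector [of_int p * ln lam, of_int q * (pi / 2)]" for p q :: int
  proof -
    define w :: "real^2" where "w = vector [lam powi p * F 0 $ 1, F 0 $ 2 + of_int q * (pi / 2)]"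
    have "w \<in> polar_half_plane" using lam Fpos'[of 0] by (simp add: w_def polar_half_plane_def)
    then have "w \<in> range F" using bijF by (simp add: bij_betw_def)
    then obtain y where y: "F y = w" by auto
    have "H_rel lam (pi / 2) k (F 0) (F y)"
      unfolding H_rel_def y
      by (rule exI[of _ p], rule exI[of _ q], rule exI[of _ 0]) (simp add: w_def)
    then have "torus_proj 0 = torus_proj y" using rel by blast
    then obtain \<gamma> where \<gamma>: "y = 0 + lattice_vec \<gamma>" unfolding torus_proj_eq_iff by blast
    have "L y - L 0 = Complex (of_int p * ln lam) (of_int q * (pi / 2))"
      using lam Fpos'[of 0] by (simp add: L_def y w_def complex_eq_iff ln_mult ln_power_int)
    moreover have "L y - L 0 = toC (C *v lattice_vec \<gamma>)" using equi[of 0 \<gamma>] \<gamma> by simp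
    ultimately have "C *v lattice_vec \<gamma> = ofC (Complex (of_int p * ln lam) (of_int q * (pi / 2)))"
      by (metis ofC_toC)
    then show ?thesis by (intro exI[of _ \<gamma>]) (simp add: vec_eq_iff forall_2)
  qed
  have C2: "C $ 2 $ i = of_int (snd (lm i)) * (pi / 2)" for i
    by (simp add: C_def colmat_def c_def)
  obtain \<gamma> where \<gamma>: "C *v lattice_vec \<gamma> = vector [of_int 1 * ln lam, of_int 0 * (pi / 2)]" using surj by blast
  obtain \<delta> where \<delta>: "C *v lattice_vec \<delta> = vector [of_int 0 * ln lam, of_int 1 * (pi / 2)]" using surj by blast
  have "C ** colv (lattice_vec \<gamma>) (lattice_vec \<delta>) =
      colv (vector [of_int 1 * ln lam, of_int 0 * (pi / 2)]) (vector [of_int 0 * ln lam, of_int 1 * (pi / 2)])"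
    unfolding matrix_mult_colv \<gamma> \<delta> ..
  then have "det C * det (colv (lattice_vec \<gamma>) (lattice_vec \<delta>)) = ln lam * (pi / 2)"
    unfolding det_mul[symmetric] by (simp add: det_2 colv_def)
  then have "det C \<noteq> 0" using lnlam by auto
  then have C: "invertible C" by (simp add: invertible_det_nz)
  have "(C *v lattice_vec \<delta>) $ 2 = pi / 2" unfolding \<delta> by simp
  then have "(of_int (snd (lm 1) * \<delta> $ 1 + snd (lm 2) * \<delta> $ 2) :: real) * (pi / 2) = of_int 1 * (pi / 2)"
    by (simp add: matrix_mult_vec_component C2 algebra_simps)
  then have "(of_int (snd (lm 1) * \<delta> $ 1 + snd (lm 2) * \<delta> $ 2) :: real) = of_int 1"
    by (subst (asm) mult_right_cancel) auto
  then have one: "snd (lm 1) * \<delta> $ 1 + snd (lm 2) * \<delta> $ 2 = 1" by (simp only: of_int_eq_iff)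
  have "odd (snd (lm 1)) \<or> odd (snd (lm 2))"
  proof (rule ccontr)
    assume "\<not> ?thesis"
    then have "even (snd (lm 1) * \<delta> $ 1 + snd (lm 2) * \<delta> $ 2)" by simp
    then show False unfolding one by simp
  qed
  then obtain j where j: "odd (snd (lm j))" by blast
  obtain \<phi> where \<phi>: "\<phi> \<in> Diff1_lifts" "\<And>x. exp (L x) = lexp C (\<phi> x)"
    using equivariant_logarithm_linear[OF Lcont loc C equi] by metis
  show thesis by (rule that[OF C C2 j \<phi>(1)]) (simp add: expL \<phi>(2))
qed

section \<open>The local involution\<close>

text \<open>
  Conjugation by a reflection turns \<open>exp (C e\<^sub>i)\<close> into its complex conjugate, and the factor
  \<open>exp (m\<^sub>i \<pi> \<i>)\<close> is a sign, which disappears in the projective group. The shift is chosen such that the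
  matrix of the given torus is fixed.
\<close>

definition flip :: "(2 \<Rightarrow> int) \<Rightarrow> real^2^2 \<Rightarrow> real^2^2" where
  "flip m C = colmat (\<lambda>i. cnj (toC (C *v axis i 1)) + \<i> * of_real (pi * of_int (m i)))"

lemma toC_column: "toC ((C :: real^2^2) *v axis i 1) = Complex (C $ 1 $ i) (C $ 2 $ i)"
  by (simp add: complex_eq_iff matrix_vector_mult_basis column_def)

lemma flip_column: "toC (flip m C *v axis i 1) = cnj (toC (C *v axis i 1)) + \<i> * of_real (pi * of_int (m i))"
  by (simp add: flip_def)

lemma flip_flip: "flip m (flip m C) = C"
proof (rule matrix_eq_if_lattice_values)
  fix i
  have "toC (flip m (flip m C) *v axis i 1) = toC (C *v axis i 1)"
    unfolding flip_column by simp
  then show "flip m (flip m C) *v axis i 1 = C *v axis i 1" by (simp only: toC_eq_iff)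
qed

lemma flip_eq_iff: "flip m C = C \<longleftrightarrow> C $ 2 = (\<chi> i. of_int (m i) * (pi / 2))"
proof -
  have "flip m C = C \<longleftrightarrow> (\<forall>i. toC (flip m C *v axis i 1) = toC (C *v axis i 1))"
    using matrix_eq_if_lattice_values[of "flip m C" C] by (auto simp only: toC_eq_iff)
  also have "\<dots> \<longleftrightarrow> (\<forall>i. C $ 2 $ i = of_int (m i) * (pi / 2))"
    unfolding flip_column unfolding toC_column
    by (simp add: complex_eq_iff field_simps) metis
  also have "\<dots> \<longleftrightarrow> C $ 2 = (\<chi> i. of_int (m i) * (pi / 2))" by (simp add: vec_eq_iff[of "C $ 2"])
  finally show ?thesis .
qed

lemma continuous_on_matrix_vec: "continuous_on S (\<lambda>C :: real^2^2. C *v v)"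
  by (intro bounded_bilinear.continuous_on[OF bounded_bilinear_matrix_vector_mult] continuous_intros)

lemma continuous_on_flip: "continuous_on S (flip m)"
  unfolding flip_def colmat_def
  by (intro continuous_on_vec_lambda continuous_intros continuous_on_matrix_vec)

lemma exp_pi_int: "exp (\<i> * of_real (pi * of_int n)) = 1 \<or> exp (\<i> * of_real (pi * of_int n)) = -1"
proof -
  have "exp (\<i> * of_real (pi * of_int n)) ^ 2 = exp (2 * (\<i> * of_real (pi * of_int n)))"
    by (simp only: exp_double)
  also have "2 * (\<i> * of_real (pi * of_int n)) = (2 * of_int n * of_real pi) * \<i>" by simp
  also have "exp \<dots> = 1" using exp_integer_2pi[of "of_int n"] by (simp add: mult_ac)
  finally show ?thesis by (simp only: power2_eq_1_iff)
qed

lemma lexp_flip: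
  "lexp (flip m C) (axis i 1) = cnj (lexp C (axis i 1)) \<or> lexp (flip m C) (axis i 1) = - cnj (lexp C (axis i 1))"
  unfolding lexp_def flip_column exp_add exp_cnj using exp_pi_int[of "m i"] by auto

lemma conj_class_flip: "conj_class PP (lin_hol (flip m C)) = conj_class PP (lin_hol C)"
proof -
  have K: "matrix_inv conj_mat = conj_mat"
    using inverse_unique_matrix[OF matrix_inv_mult(1)[OF invertible_conj_mat] conj_mat_square] .
  have "lin_hol (flip m C) =
      (\<lambda>\<gamma>. mclass (conj_mat ** cmat (lexp C (lattice_vec \<gamma>)) ** matrix_inv conj_mat))"
  proof (rule hom_int_lattice_eqI[OF group_PGL2 lin_hol_hom conj_lin_hol_hom[OF invertible_conj_mat]])
    fix i
    show "lin_hol (flip m C) (axis i 1) =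
        mclass (conj_mat ** cmat (lexp C (lattice_vec (axis i 1))) ** matrix_inv conj_mat)"
      using lexp_flip[of m C i] by (auto simp: lin_hol_def K conj_mat_cmat cmat_minus mclass_minus)
  qed
  then show ?thesis
    unfolding lin_hol_def[of C] using conj_class_PP_conjugate[OF invertible_conj_mat] by simp
qed

text \<open>
  The two cases correspond to complex linear and to antilinear conjugating matrices; the signs,
  which may depend on \<open>i\<close>, come from the projective group.
\<close>

lemma conj_class_lin_hol_eqD:
  assumes eq: "conj_class PP (lin_hol C) = conj_class PP (lin_hol C')" and j: "Im (lexp C (axis j 1)) \<noteq> 0"
  shows "(\<forall>i. lexp C' (axis i 1) = lexp C (axis i 1) \<or> lexp C' (axis i 1) = - lexp C (axis i 1)) \<or>
    (\<forall>i. lexp C' (axis i 1) = cnj (lexp C (axis i 1)) \<or> lexp C' (axis i 1) = - cnj (lexp C (axis i 1)))"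
proof -
  have "lin_hol C' \<in> conj_class PP (lin_hol C)"
    unfolding eq by (rule in_conj_class_PP_self[OF lin_hol_hom])
  then obtain A where A: "lin_hol C' = (\<lambda>\<gamma>. mclass (A ** cmat (lexp C (lattice_vec \<gamma>)) ** matrix_inv A))" "invertible A"
    unfolding lin_hol_def[of C] in_conj_class_PP_iff by (elim exE conjE)
  have "mclass (A ** cmat (lexp C (axis i 1)) ** matrix_inv A) = mclass (cmat (lexp C' (axis i 1)))" for i
    using fun_cong[OF A(1), of "axis i 1"] by (simp add: lin_hol_def)
  then have ex: "\<exists>w. (w = lexp C' (axis i 1) \<or> w = - lexp C' (axis i 1)) \<and>
      A ** cmat (lexp C (axis i 1)) ** matrix_inv A = cmat w" for i
    unfolding mclass_eq_iff cmat_minus[symmetric] by blast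
  have tw: "\<exists>w. (w = lexp C' (axis i 1) \<or> w = - lexp C' (axis i 1)) \<and>
      A ** cmat (lexp C (axis i 1)) = cmat w ** A" for i
  proof -
    obtain w where w: "w = lexp C' (axis i 1) \<or> w = - lexp C' (axis i 1)"
      "A ** cmat (lexp C (axis i 1)) ** matrix_inv A = cmat w" using ex by blast
    have "A ** cmat (lexp C (axis i 1)) = A ** cmat (lexp C (axis i 1)) ** (matrix_inv A ** A)"
      using matrix_inv_mult[OF A(2)] by simp
    also have "\<dots> = cmat w ** A" unfolding matrix_mul_assoc w(2) ..
    finally show ?thesis using w(1) by blast
  qed
  obtain w where w: "A ** cmat (lexp C (axis j 1)) = cmat w ** A" using tw by blast
  have nz: "toC (A *v ofC 1) \<noteq> 0"
    using A(2) by (simp only: toC_eq_iff[of _ 0, simplified] invertible_mult_vec_eq_0) simp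
  show ?thesis
    using w A(2) j
  proof (rule intertwining_cmat)
    fix \<alpha> assume \<alpha>: "A = cmat \<alpha>"
    then have \<alpha>0: "\<alpha> \<noteq> 0" using nz by simp
    have "lexp C' (axis i 1) = lexp C (axis i 1) \<or> lexp C' (axis i 1) = - lexp C (axis i 1)" for i
    proof -
      obtain w where w: "w = lexp C' (axis i 1) \<or> w = - lexp C' (axis i 1)"
        "A ** cmat (lexp C (axis i 1)) = cmat w ** A" using tw by blast
      have "\<alpha> * lexp C (axis i 1) = w * \<alpha>" using w(2) unfolding \<alpha> cmat_mult cmat_eq_iff .
      then show ?thesis using w(1) \<alpha>0 by auto
    qed
    then show ?thesis by blast
  next
    fix \<alpha> assume \<alpha>: "A = cmat \<alpha> ** conj_mat"
    then have \<alpha>0: "\<alpha> \<noteq> 0" using nz by (auto simp flip: matrix_vector_mul_assoc)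
    have "lexp C' (axis i 1) = cnj (lexp C (axis i 1)) \<or> lexp C' (axis i 1) = - cnj (lexp C (axis i 1))" for i
    proof -
      obtain w where w: "w = lexp C' (axis i 1) \<or> w = - lexp C' (axis i 1)"
        "A ** cmat (lexp C (axis i 1)) = cmat w ** A" using tw by blast
      have "(A ** cmat (lexp C (axis i 1))) *v ofC 1 = (cmat w ** A) *v ofC 1" by (simp only: w(2))
      then have "\<alpha> * cnj (lexp C (axis i 1)) = w * \<alpha>"
        unfolding \<alpha> by (simp flip: matrix_vector_mul_assoc)
      then show ?thesis using w(1) \<alpha>0 by auto
    qed
    then show ?thesis by blast
  qed
qed

text \<open>
  Unlike a ball in the matrix norm, this neighbourhood is compared directly with the arguments \<open>C e\<^sub>i\<close>
  of the exponential function, in terms of which \<open>flip\<close> is defined.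
\<close>

definition column_box :: "real^2^2 \<Rightarrow> real \<Rightarrow> (real^2^2) set" where
  "column_box C0 \<delta> = {C. \<forall>i. norm (toC (C *v axis i 1) - toC (C0 *v axis i 1)) < \<delta>}"

lemma open_column_box: "open (column_box C0 \<delta>)"
proof -
  have "column_box C0 \<delta> = (\<Inter>i\<in>UNIV. {C. norm (toC (C *v axis i 1) - toC (C0 *v axis i 1)) < \<delta>})"
    by (auto simp: column_box_def)
  moreover have "open {C. norm (toC (C *v axis i 1) - toC (C0 *v axis i 1)) < \<delta>}" for i
    by (intro open_Collect_less continuous_intros continuous_on_matrix_vec)
  ultimately show ?thesis by (simp only:, intro open_INT ballI finite)
qed

lemma column_box_subset:
  assumes "open G" "C0 \<in> G"
  obtains \<delta> where "\<delta> > 0" "\<delta> \<le> 1" "column_box C0 \<delta> \<subseteq> G"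
proof -
  obtain e where e: "e > 0" "ball C0 e \<subseteq> G" using assms openE by blast
  define \<delta> where "\<delta> = min 1 (e / 4)"
  have "C \<in> ball C0 e" if C: "C \<in> column_box C0 \<delta>" for C
  proof -
    have col: "\<bar>(C - C0) $ k $ i\<bar> < e / 4" for k i
    proof -
      have "norm (toC (C *v axis i 1) - toC (C0 *v axis i 1)) < e / 4"
        using C by (auto simp: column_box_def \<delta>_def)
      moreover have "\<bar>(C - C0) $ k $ i\<bar> \<le> norm (toC (C *v axis i 1) - toC (C0 *v axis i 1))"
        unfolding toC_column
        using abs_Re_le_cmod[of "Complex (C $ 1 $ i) (C $ 2 $ i) - Complex (C0 $ 1 $ i) (C0 $ 2 $ i)"]
          abs_Im_le_cmod[of "Complex (C $ 1 $ i) (C $ 2 $ i) - Complex (C0 $ 1 $ i) (C0 $ 2 $ i)"]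
          exhaust_2[of k] by auto
      ultimately show ?thesis by linarith
    qed
    have "norm (C - C0) \<le> norm ((C - C0) $ 1) + norm ((C - C0) $ 2)"
      unfolding norm_vec_def[of "C - C0"] by (rule order_trans[OF L2_set_le_sum]) (simp_all add: sum_2)
    also have "\<dots> \<le> (\<bar>(C - C0) $ 1 $ 1\<bar> + \<bar>(C - C0) $ 1 $ 2\<bar>) + (\<bar>(C - C0) $ 2 $ 1\<bar> + \<bar>(C - C0) $ 2 $ 2\<bar>)"
      by (intro add_mono order_trans[OF norm_le_l1_cart]) (simp_all add: sum_2)
    also have "\<dots> < e" using col[of 1 1] col[of 1 2] col[of 2 1] col[of 2 2] by linarith
    finally show ?thesis by (simp add: dist_norm norm_minus_commute)
  qed
  then show thesis using e by (intro that[of \<delta>]) (auto simp: \<delta>_def)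
qed

text \<open>
  Arguments with the same exponential up to sign differ by an integral multiple of \<open>\<pi> \<i>\<close>.
\<close>

lemma exp_eq_up_to_sign_near:
  fixes z w :: complex
  assumes "exp z = exp w \<or> exp z = - exp w" "norm (z - w) < pi"
  shows "z = w"
proof -
  have "exp (2 * z) = exp (2 * w)" using assms(1) unfolding exp_double by auto
  then obtain n :: int where n: "2 * z = 2 * w + (of_int (2 * n) * pi) * \<i>" using exp_eq by blast
  have "2 * (z - w) = 2 * ((of_int n * pi) * \<i>)" using n by (simp add: algebra_simps)
  then have zw: "z - w = (of_int n * pi) * \<i>" by (simp only: mult_cancel_left) simp
  have "n = 0"
  proof (rule ccontr)
    assume "n \<noteq> 0"
    then have "1 \<le> \<bar>real_of_int n\<bar>" by linarith
    then have "pi \<le> norm (z - w)" unfolding zw by (simp add: norm_mult)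
    then show False using assms(2) by simp
  qed
  then show ?thesis using zw by simp
qed

lemma flip_column_box:
  assumes "flip m C0 = C0" "C \<in> column_box C0 \<delta>"
  shows "flip m C \<in> column_box C0 \<delta>"
  unfolding column_box_def
proof (intro CollectI allI)
  fix i
  have "toC (C0 *v axis i 1) = cnj (toC (C0 *v axis i 1)) + \<i> * of_real (pi * of_int (m i))"
    using flip_column[of m C0 i] assms(1) by simp
  then have K: "\<i> * of_real (pi * of_int (m i)) = toC (C0 *v axis i 1) - cnj (toC (C0 *v axis i 1))"
    by (metis add_diff_cancel_left')
  have "toC (flip m C *v axis i 1) - toC (C0 *v axis i 1) = cnj (toC (C *v axis i 1) - toC (C0 *v axis i 1))"
    unfolding flip_column K by simp
  moreover have "norm (cnj (toC (C *v axis i 1) - toC (C0 *v axis i 1))) < \<delta>"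
    using assms(2) unfolding complex_mod_cnj by (simp add: column_box_def)
  ultimately show "norm (toC (flip m C *v axis i 1) - toC (C0 *v axis i 1)) < \<delta>" by (simp only:)
qed

lemma column_box_eqI:
  assumes C: "C \<in> column_box C0 \<delta>" "C' \<in> column_box C0 \<delta>" "\<delta> \<le> 1"
    and eq: "\<And>i. lexp C' (axis i 1) = lexp C (axis i 1) \<or> lexp C' (axis i 1) = - lexp C (axis i 1)"
  shows "C' = C"
proof (rule matrix_eq_if_lattice_values)
  fix i
  have "norm (toC (C' *v axis i 1) - toC (C *v axis i 1)) \<le>
      norm (toC (C' *v axis i 1) - toC (C0 *v axis i 1)) + norm (toC (C *v axis i 1) - toC (C0 *v axis i 1))"
    using norm_triangle_ineq4[of "toC (C' *v axis i 1) - toC (C0 *v axis i 1)"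
        "toC (C *v axis i 1) - toC (C0 *v axis i 1)"] by simp
  also have "\<dots> < 1 + 1" using C unfolding column_box_def by (intro add_strict_mono) (auto intro: less_le_trans)
  also have "1 + 1 < pi" using pi_gt3 by simp
  finally have "toC (C' *v axis i 1) = toC (C *v axis i 1)"
    using eq[of i] unfolding lexp_def by (intro exp_eq_up_to_sign_near)
  then show "C' *v axis i 1 = C *v axis i 1" by (simp only: toC_eq_iff)
qed

section \<open>The branched covering\<close>

lemma induced_map_H_class:
  assumes C: "invertible C" and \<phi>: "\<phi> \<in> Diff1_lifts" and F: "\<And>x. polar_map (F x) = ofC (lexp C (\<phi> x))"
  shows "induced_map (H_class F) = dev_class PP (lin_dev C)"
proof -
  have i: "invertible (mat 1 :: real^2^2)" by (auto simp: invertible_def)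
  have "dev_class PP (pj \<circ> D) = dev_class PP (lin_dev C)" if D_in: "D \<in> H_class F" for D
  proof -
    obtain A \<psi> where A: "D = (\<lambda>x. A *v (polar_map \<circ> F) (\<psi> x))" "A \<in> carrier GL2" "\<psi> \<in> Diff1_lifts"
      using D_in unfolding H_class_def dev_class_def mem_Collect_eq
      by (simp add: punctured_plane_def) (elim exE conjE)
    have D: "pj \<circ> D = (\<lambda>x. pj (A *v ofC (lexp C (\<phi> (\<psi> x)))))"
      unfolding A(1) by (simp add: fun_eq_iff F)
    have "invertible A" using A(2) by (simp add: carrier_GL2)
    then show ?thesis
      unfolding D lin_dev_def
      using dev_class_PP_eq[OF _ Diff1_lifts_compose[OF \<phi> A(3)], of A "\<lambda>x. ofC (lexp C x)"] by simp
  qed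
  then have "induced_map (H_class F) = (\<Union>D\<in>H_class F. dev_class PP (lin_dev C))"
    unfolding induced_map_def by (intro SUP_cong refl)
  moreover have "(\<lambda>x. mat 1 *v (polar_map \<circ> F) x) \<in> H_class F"
    unfolding H_class_def dev_class_def mem_Collect_eq
    by (rule exI[of _ "mat 1"], rule exI[of _ "\<lambda>x. x"])
       (simp add: punctured_plane_def carrier_GL2 i Diff1_lifts_id)
  then have "H_class F \<noteq> {}" by (intro notI) simp
  ultimately show ?thesis by (simp only: UN_constant if_False)
qed

theorem propositionB1:
  fixes lam :: real and k :: nat and F :: "real^2 \<Rightarrow> real^2"
  assumes "lam > 0" and "lam \<noteq> 1" and "k \<ge> 1"
    and "H_marking lam (pi / 2) k F"
  shows "twofold_branched_covering_near
           (deformation_space proj_punctured_plane) (character_space proj_punctured_plane)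
           (hol proj_punctured_plane) (induced_map (H_class F))"
proof -
  obtain C0 m j \<phi> where C0: "invertible C0" "\<And>i. C0 $ 2 $ i = of_int (m i) * (pi / 2)" "odd (m j)"
    "\<phi> \<in> Diff1_lifts" "\<And>x. polar_map (F x) = ofC (lexp C0 (\<phi> x))"
    using marking_linear[OF assms(1,2,4)] by metis
  have x0: "induced_map (H_class F) = dev_class PP (lin_dev C0)"
    by (rule induced_map_H_class[OF C0(1,4,5)])
  define r :: "real^2" where "r = (\<chi> i. of_int (m i) * (pi / 2))"
  have C0r: "C0 $ 2 = r" by (simp add: vec_eq_iff r_def C0(2))
  have C0flip: "flip m C0 = C0" unfolding flip_eq_iff using C0r by (simp add: r_def)
  have det0: "det C0 \<noteq> 0" using C0(1) by (simp add: invertible_det_nz)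
  have im0: "Im (lexp C0 (axis j 1)) \<noteq> 0"
  proof
    assume "Im (lexp C0 (axis j 1)) = 0"
    then have "sin (of_int (m j) * (pi / 2)) = 0"
      by (simp add: lexp_def toC_column C0(2) Im_exp)
    then obtain n :: int where "of_int (m j) * (pi / 2) = of_int n * pi"
      unfolding sin_zero_iff_int2 by blast
    then have "real_of_int (m j) = real_of_int (2 * n)" by (simp add: field_simps)
    then have "m j = 2 * n" by (simp only: of_int_eq_iff)
    then show False using C0(3) by simp
  qed
  define G where "G = {C :: real^2^2. 0 < det C * det C0} \<inter>
      {C. 0 < Im (lexp C (axis j 1)) * Im (lexp C0 (axis j 1))}"
  have "open G" unfolding G_def det_2 lexp_def
    by (intro open_Int open_Collect_less continuous_intros continuous_on_matrix_vec)
  moreover have "C0 \<in> G" 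
    using det0 im0 not_real_square_gt_zero[of "det C0"] not_real_square_gt_zero[of "Im (lexp C0 (axis j 1))"]
    unfolding G_def by blast
  ultimately obtain \<delta> where \<delta>: "\<delta> > 0" "\<delta> \<le> 1" "column_box C0 \<delta> \<subseteq> G" by (rule column_box_subset)
  define N where "N = column_box C0 \<delta>"
  have N: "open N" unfolding N_def by (rule open_column_box)
  have C0N: "C0 \<in> N" using \<delta>(1) by (simp add: N_def column_box_def)
  have NG: "0 < det C * det C0" "0 < Im (lexp C (axis j 1)) * Im (lexp C0 (axis j 1))" if "C \<in> N" for C
    using that \<delta>(3) unfolding N_def G_def by auto
  have inv: "invertible C" if "C \<in> N" for C using NG(1)[OF that] by (auto simp: invertible_det_nz)
  have im: "Im (lexp C (axis j 1)) \<noteq> 0" if "C \<in> N" for C using NG(2)[OF that] by auto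
  have flipN: "flip m C \<in> N" if "C \<in> N" for C
    using flip_column_box[OF C0flip] that unfolding N_def by blast
  define \<Psi> where "\<Psi> C = dev_class PP (lin_dev C)" for C
  define f where "f C = conj_class PP (lin_hol C)" for C
  have inj: "C' = C" if "C \<in> N" "C' \<in> N" "\<Psi> C = \<Psi> C'" for C C'
  proof -
    have "C' = C \<or> C' = conj_mat ** C"
      using lin_dev_class_eqD[OF inv inv _ im, of C C'] that unfolding \<Psi>_def by blast
    moreover have "C' \<noteq> conj_mat ** C"
    proof
      assume "C' = conj_mat ** C"
      moreover have "det conj_mat = -1" by (simp add: det_2 conj_mat_def)
      ultimately have "det C' = - det C" by (simp add: det_mul)
      then show False using NG(1)[OF that(1)] NG(1)[OF that(2)] by simp
    qed
    ultimately show ?thesis by blast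
  qed
  have fibre: "f C = f C' \<longleftrightarrow> C' = C \<or> C' = flip m C" if C: "C \<in> N" "C' \<in> N" for C C'
  proof
    assume "f C = f C'"
    then have "(\<forall>i. lexp C' (axis i 1) = lexp C (axis i 1) \<or> lexp C' (axis i 1) = - lexp C (axis i 1)) \<or>
        (\<forall>i. lexp C' (axis i 1) = cnj (lexp C (axis i 1)) \<or> lexp C' (axis i 1) = - cnj (lexp C (axis i 1)))"
      unfolding f_def by (rule conj_class_lin_hol_eqD[OF _ im[OF C(1)]])
    then show "C' = C \<or> C' = flip m C"
    proof
      assume *: "\<forall>i. lexp C' (axis i 1) = lexp C (axis i 1) \<or> lexp C' (axis i 1) = - lexp C (axis i 1)"
      have "C' = C" using C \<delta>(2) spec[OF *] unfolding N_def by (intro column_box_eqI[of C C0 \<delta> C'])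
      then show ?thesis ..
    next
      assume *: "\<forall>i. lexp C' (axis i 1) = cnj (lexp C (axis i 1)) \<or> lexp C' (axis i 1) = - cnj (lexp C (axis i 1))"
      have "lexp C' (axis i 1) = lexp (flip m C) (axis i 1) \<or> lexp C' (axis i 1) = - lexp (flip m C) (axis i 1)" for i
        using spec[OF *, of i] lexp_flip[of m C i] by auto
      then have "C' = flip m C"
        using flipN[OF C(1)] C(2) \<delta>(2) unfolding N_def by (intro column_box_eqI[of "flip m C" C0 \<delta> C'])
      then show ?thesis ..
    qed
  next
    assume "C' = C \<or> C' = flip m C"
    then show "f C = f C'" unfolding f_def using conj_class_flip by auto
  qed
  have \<Psi>_open: "openin (deformation_space PP) (\<Psi> ` U)" if "open U" "U \<subseteq> N" for U
    unfolding \<Psi>_def by (rule lin_dev_classes_open[of U j]) (use that inv im in auto)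
  have f_open: "openin (character_space PP) (f ` U)" if "open U" "U \<subseteq> N" for U
    unfolding f_def by (rule conj_classes_open[of U j]) (use that im in auto)
  define X where "X = subtopology (deformation_space PP) (\<Psi> ` N)"
  define Y where "Y = subtopology (character_space PP) (f ` N)"
  have topX: "topspace X = \<Psi> ` N"
    unfolding X_def using openin_subset[OF \<Psi>_open[OF N order_refl]] by auto
  have topY: "topspace Y = f ` N"
    unfolding Y_def using openin_subset[OF f_open[OF N order_refl]] by auto
  have hol\<Psi>: "hol PP (\<Psi> C) = f C" if "C \<in> N" for C
    unfolding \<Psi>_def f_def by (rule hol_lin_dev[OF inv[OF that]])
  have opN: "open U \<and> U \<subseteq> N" if "openin (top_of_set N) U" for U
    using that N openin_open_trans openin_imp_subset by blast
  have "homeomorphic_map (top_of_set N) X \<Psi>"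
  proof (rule bijective_open_imp_homeomorphic_map)
    have "continuous_map (top_of_set N) (deformation_space PP) (dev_class PP \<circ> lin_dev)"
      unfolding deformation_space_def
      by (rule continuous_map_compose[OF continuous_map_lin_dev[OF N inv]
            quotient_imp_continuous_map[OF quotient_map_quot_topology]])
    then show "continuous_map (top_of_set N) X \<Psi>"
      unfolding X_def \<Psi>_def by (intro continuous_map_into_subtopology) (auto simp: comp_def)
    show "open_map (top_of_set N) X \<Psi>"
      unfolding open_map_def
    proof (intro allI impI)
      fix U assume "openin (top_of_set N) U"
      then have U: "open U" "U \<subseteq> N" using opN by auto
      show "openin X (\<Psi> ` U)"
        unfolding X_def openin_subtopology using \<Psi>_open[OF U] U(2) by (intro exI[of _ "\<Psi> ` U"]) auto
    qed
    show "\<Psi> ` topspace (top_of_set N) = topspace X" by (simp add: topX)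
    show "inj_on \<Psi> (topspace (top_of_set N))" using inj by (auto simp: inj_on_def)
  qed
  note hm = this
  obtain g where g: "homeomorphic_maps (top_of_set N) X \<Psi> g" using hm by (auto simp: homeomorphic_map_maps)
  have gc: "continuous_map X (top_of_set N) g" and \<Psi>c: "continuous_map (top_of_set N) X \<Psi>"
    and g\<Psi>: "\<And>C. C \<in> N \<Longrightarrow> g (\<Psi> C) = C"
    using g by (auto simp: homeomorphic_maps_def)
  have fc: "continuous_map (top_of_set N) Y f"
    unfolding Y_def f_def
    by (intro continuous_map_into_subtopology continuous_map_conj_class_lin_hol) auto
  define \<tau> where "\<tau> x = \<Psi> (flip m (g x))" for x
  have \<tau>\<Psi>: "\<tau> (\<Psi> C) = \<Psi> (flip m C)" if "C \<in> N" for C by (simp add: \<tau>_def g\<Psi>[OF that])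
  have fixed: "{x \<in> topspace X. \<tau> x = x} = \<Psi> ` {C \<in> N. C $ 2 = r}"
  proof (intro equalityI subsetI)
    fix x assume "x \<in> {x \<in> topspace X. \<tau> x = x}"
    then obtain C where C: "C \<in> N" "x = \<Psi> C" "\<Psi> (flip m C) = \<Psi> C" using \<tau>\<Psi> topX by auto
    then have "flip m C = C" using inj[OF C(1) flipN[OF C(1)]] by simp
    then show "x \<in> \<Psi> ` {C \<in> N. C $ 2 = r}" using C by (simp add: flip_eq_iff r_def)
  next
    fix x assume "x \<in> \<Psi> ` {C \<in> N. C $ 2 = r}"
    then obtain C where C: "C \<in> N" "C $ 2 = r" "x = \<Psi> C" by auto
    then have "flip m C = C" by (simp add: flip_eq_iff r_def)
    then show "x \<in> {x \<in> topspace X. \<tau> x = x}" using C \<tau>\<Psi>[OF C(1)] topX by simp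
  qed
  have "twofold_branched_covering X Y (hol PP) (hol PP ` {x \<in> topspace X. \<tau> x = x})"
  proof (rule twofold_branched_covering_if_involution)
    have "top_of_set N homeomorphic_space X" using hm by (rule homeomorphic_map_imp_homeomorphic_space)
    then show "Hausdorff_space X"
      using homeomorphic_Hausdorff_space Hausdorff_space_subtopology Hausdorff_space_euclidean by blast
    have "continuous_map X Y (f \<circ> g)" by (rule continuous_map_compose[OF gc fc])
    then show "continuous_map X Y (hol PP)"
      by (rule continuous_map_eq) (auto simp: topX g\<Psi> hol\<Psi>)
    show "open_map X Y (hol PP)"
      unfolding open_map_def
    proof (intro allI impI)
      fix U assume U: "openin X U"
      define U' where "U' = {C \<in> topspace (top_of_set N). \<Psi> C \<in> U}"
      have "openin (top_of_set N) U'" unfolding U'_def by (rule openin_continuous_map_preimage[OF \<Psi>c U])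
      then have U': "open U'" "U' \<subseteq> N" using opN by auto
      have "U \<subseteq> \<Psi> ` N" using openin_subset[OF U] topX by simp
      then have "U = \<Psi> ` U'" by (auto simp: U'_def)
      then have "hol PP ` U = (\<lambda>C. hol PP (\<Psi> C)) ` U'" by (simp add: image_image)
      also have "\<dots> = f ` U'" using U'(2) hol\<Psi> by (intro image_cong) auto
      finally have "hol PP ` U = f ` U'" .
      then show "openin Y (hol PP ` U)"
        unfolding Y_def openin_subtopology using f_open[OF U'] U'(2) by (intro exI[of _ "f ` U'"]) auto
    qed
    show "hol PP ` topspace X = topspace Y" unfolding topX topY image_image using hol\<Psi> by (intro image_cong) auto
    have "continuous_map (top_of_set N) (top_of_set N) (flip m)"
      using flipN continuous_on_flip by auto
    then have "continuous_map X X (\<Psi> \<circ> (flip m \<circ> g))"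
      by (intro continuous_map_compose[OF _ \<Psi>c] continuous_map_compose[OF gc])
    then show "continuous_map X X \<tau>" by (simp add: \<tau>_def[abs_def] comp_def)
    show "\<tau> (\<tau> x) = x" if "x \<in> topspace X" for x
      using that by (auto simp: topX \<tau>\<Psi> flipN flip_flip)
    show "hol PP x = hol PP x' \<longleftrightarrow> x' = x \<or> x' = \<tau> x" if x: "x \<in> topspace X" "x' \<in> topspace X" for x x'
    proof -
      obtain C C' where C: "C \<in> N" "x = \<Psi> C" "C' \<in> N" "x' = \<Psi> C'" using x unfolding topX by auto
      have "x' = x \<longleftrightarrow> C' = C" "x' = \<tau> x \<longleftrightarrow> C' = flip m C"
        using C inj[OF C(1,3)] inj[OF flipN[OF C(1)] C(3)] \<tau>\<Psi>[OF C(1)] by auto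
      then show ?thesis using C hol\<Psi> fibre by simp
    qed
    show "branch_locus_in X {x \<in> topspace X. \<tau> x = x}"
      unfolding fixed by (rule branch_locus_in_homeomorphic_image[OF hm branch_locus_in_matrix_row[OF N]])
  qed
  moreover have "openin (deformation_space PP) (\<Psi> ` N)" "openin (character_space PP) (f ` N)"
    using \<Psi>_open[OF N] f_open[OF N] by auto
  moreover have "induced_map (H_class F) \<in> \<Psi> ` N" unfolding x0 using C0N by (auto simp: \<Psi>_def)
  moreover have "hol PP (induced_map (H_class F)) \<in> hol PP ` {x \<in> topspace X. \<tau> x = x}"
    unfolding fixed x0 using C0N C0r by (intro imageI) (auto simp: \<Psi>_def)
  ultimately show ?thesis
    unfolding twofold_branched_covering_near_def X_def Y_def
    by (intro exI[of _ "\<Psi> ` N"] exI[of _ "f ` N"] exI conjI)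
qed

end
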